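(* Let the signature contain at least one constant $c$ and a binary function symbol $\langle\rangle$. Then the proof system $\langle\mathsf{RTC}\rangle_{G}$ is sound and complete for the admissible Henkin semantics, and the proof system $\langle\mathsf{RTC}\rangle^{\omega}_{G}$ is sound and complete for the admissible standard semantics. That is, a sequent is provable in $\langle\mathsf{RTC}\rangle_{G}$ iff it is valid in all admissible Henkin structures, and a sequent is provable in $\langle\mathsf{RTC}\rangle^{\omega}_{G}$ iff it is valid in all admissible standard structures.
   Context: Formulas of $\mathcal{L}_{\mathsf{RTC}}$: first-order formulas with equality extended by $(RTC_{x,y}\,\varphi)(s,t)$ for distinct variables $x,y$ bound in $\varphi$ and terms $s,t$. Write $\langle x,y\rangle$ for $\langle\rangle(x,y)$. Standard semantics: usual first-order satisfaction, and $M,v\models (RTC_{x,y}\varphi)(s,t)$ iff $v(s)=v(t)$ or there are $a_0,\dots,a_n$ ($n>0$) with $a_0=v(s)$, $a_n=v(t)$, $M,v[x:=a_i,y:=a_{i+1}]\models\varphi$ for $i<n$. Henkin semantics: a frame is $\langle D,I,\mathcal{D}\rangle$ with $\langle D,I\rangle$ a first-order structure and $\mathcal{D}\subseteq\wp(D)$; formulas are interpreted as usual except $M,v\models(RTC_{x,y}\varphi)(s,t)$ iff for every $A\in\mathcal{D}$, if $v(s)\in A$ and $A$ is closed under $\varphi$ (for all $a,b\in D$, $a\in A$ and $M,v[x:=a,y:=b]\models\varphi$ imply $b\in A$) then $v(t)\in A$. A Henkin structure is a frame such that $\{a\in D\mid M,v[x:=a]\models\varphi\}\in\mathcal{D}$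 for every formula $\varphi$, variable $x$ and valuation $v$. A structure (or Henkin structure) is admissible if its first-order part interprets $\langle\rangle$ as a pairing function: $\langle a,b\rangle=\langle a',b'\rangle$ implies $a=a'$ and $b=b'$, and $\langle a,b\rangle\neq c$. A sequent $\Gamma\Rightarrow\Delta$ is valid in a class of structures if in every structure of the class and every valuation satisfying all of $\Gamma$, some formula of $\Delta$ holds. $\mathcal{LK}_=$: classical sequent calculus with axiom $\varphi\Rightarrow\varphi$, weakening, usual connective/quantifier rules, $(=L_1)$: from $\Gamma\Rightarrow\varphi[s/x],\Delta$ infer $\Gamma,s=t\Rightarrow\varphi[t/x],\Delta$, $(=L_2)$: symmetric with $s,t$ swapped, $(=R)$: $\Rightarrow t=t$, Cut, and (Subst): from $\Gamma\Rightarrow\Delta$ infer $\Gamma\theta\Rightarrow\Delta\theta$. $\mathsf{RTC}_G$ is $\mathcal{LK}_=$ plus (Refl) $\Gamma\Rightarrow\Delta,(RTC_{x,y}\varphi)(s,s)$; (Trans) from $\Gamma\Rightarrow\Delta,(RTC_{x,y}\varphi)(s,r)$ and $\Gamma\Rightarrow\Delta,\varphi[r/x,t/y]$ infer $\Gamma\Rightarrow\Delta,(RTC_{x,y}\varphi)(s,t)$; (Ind) from $\Gamma,\psi(x),\varphi(x,y)\Rightarrow\Delta,\psi[y/x]$ infer $\Gamma,\psi[s/x],(RTC_{x,y}\varphi)(s,t)\Rightarrow\Delta,\psi[t/x]$, where $x\notin fv(\Gamma,\Delta)$ and $y\notin fv(\Gamma,\Delta,\psi)$; proofs are finite derivation trees.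 $\mathsf{RTC}^{\omega}_{G}$ is $\mathcal{LK}_=$ plus (Refl), (Trans) and (Case): from $\Gamma,s=t\Rightarrow\Delta$ and $\Gamma,(RTC_{x,y}\varphi)(s,z),\varphi[z/x,t/y]\Rightarrow\Delta$ infer $\Gamma,(RTC_{x,y}\varphi)(s,t)\Rightarrow\Delta$ ($z$ fresh; $(RTC_{x,y}\varphi)(s,z)$ is the immediate ancestor of the principal formula); its proofs are possibly infinite derivation trees without open leaves in which every infinite path is followed by an infinitely progressing trace, where a trace is a sequence of $RTC$-formulas in antecedents such that, from some point on, consecutive formulas are equal, or related by $\tau=\tau'\theta$ across a (Subst) with substitution $\theta$, or are a principal formula of (Case) followed by its immediate ancestor (a progress point). $\langle\mathsf{RTC}\rangle_{G}$ and $\langle\mathsf{RTC}\rangle^{\omega}_{G}$ are $\mathsf{RTC}_G$ and $\mathsf{RTC}^{\omega}_G$ respectively extended with the rules: from $\Gamma\Rightarrow\langle x,y\rangle=\langle u,v\rangle,\Delta$ infer $\Gamma\Rightarrow x=u\wedge y=v,\Delta$; and the axiom $\Gamma,\langle x,y\rangle=c\Rightarrow\Delta$. *)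

theory Defs
  imports Main "HOL-Library.FSet"
begin

section \<open>Syntax\<close>

text \<open>The symbol sets are explicit because HOL types are nonempty, whereas a signature may well have
  no predicate symbols besides equality. Constants are function symbols of arity 0.\<close>

record ('f, 'p) signature =
  funs :: "'f set"
  preds :: "'p set"
  fun_ar :: "'f \<Rightarrow> nat"
  pred_ar :: "'p \<Rightarrow> nat"

type_synonym var = nat

datatype 'f tm = Var var | Fun 'f "'f tm list"

text \<open>\<open>RTC x y \<phi> s t\<close> stands for $(RTC_{x,y}\,\varphi)(s,t)$; it binds \<open>x\<close> and \<open>y\<close> in \<open>\<phi>\<close>, not in \<open>s\<close>, \<open>t\<close>.\<close>

datatype ('f, 'p) fm =
    Eq "'f tm" "'f tm"
  | Pred 'p "'f tm list"
  | Neg "('f, 'p) fm"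
  | Conj "('f, 'p) fm" "('f, 'p) fm"
  | Disj "('f, 'p) fm" "('f, 'p) fm"
  | Imp "('f, 'p) fm" "('f, 'p) fm"
  | All var "('f, 'p) fm"
  | Ex var "('f, 'p) fm"
  | RTC var var "('f, 'p) fm" "'f tm" "'f tm"

primrec wf_tm :: "('f, 'p) signature \<Rightarrow> 'f tm \<Rightarrow> bool" where
  "wf_tm S (Var x) \<longleftrightarrow> True"
| "wf_tm S (Fun f ts) \<longleftrightarrow> f \<in> funs S \<and> length ts = fun_ar S f \<and> list_all (wf_tm S) ts"

primrec wf_fm :: "('f, 'p) signature \<Rightarrow> ('f, 'p) fm \<Rightarrow> bool" where
  "wf_fm S (Eq s t) \<longleftrightarrow> wf_tm S s \<and> wf_tm S t"
| "wf_fm S (Pred P ts) \<longleftrightarrow> P \<in> preds S \<and> length ts = pred_ar S P \<and> list_all (wf_tm S) ts"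
| "wf_fm S (Neg \<phi>) \<longleftrightarrow> wf_fm S \<phi>"
| "wf_fm S (Conj \<phi> \<psi>) \<longleftrightarrow> wf_fm S \<phi> \<and> wf_fm S \<psi>"
| "wf_fm S (Disj \<phi> \<psi>) \<longleftrightarrow> wf_fm S \<phi> \<and> wf_fm S \<psi>"
| "wf_fm S (Imp \<phi> \<psi>) \<longleftrightarrow> wf_fm S \<phi> \<and> wf_fm S \<psi>"
| "wf_fm S (All x \<phi>) \<longleftrightarrow> wf_fm S \<phi>"
| "wf_fm S (Ex x \<phi>) \<longleftrightarrow> wf_fm S \<phi>"
| "wf_fm S (RTC x y \<phi> s t) \<longleftrightarrow> x \<noteq> y \<and> wf_fm S \<phi> \<and> wf_tm S s \<and> wf_tm S t"

primrec fv_tm :: "'f tm \<Rightarrow> var set" where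
  "fv_tm (Var x) = {x}"
| "fv_tm (Fun f ts) = \<Union> (set (map fv_tm ts))"

primrec fv :: "('f, 'p) fm \<Rightarrow> var set" where
  "fv (Eq s t) = fv_tm s \<union> fv_tm t"
| "fv (Pred P ts) = \<Union> (set (map fv_tm ts))"
| "fv (Neg \<phi>) = fv \<phi>"
| "fv (Conj \<phi> \<psi>) = fv \<phi> \<union> fv \<psi>"
| "fv (Disj \<phi> \<psi>) = fv \<phi> \<union> fv \<psi>"
| "fv (Imp \<phi> \<psi>) = fv \<phi> \<union> fv \<psi>"
| "fv (All x \<phi>) = fv \<phi> - {x}"
| "fv (Ex x \<phi>) = fv \<phi> - {x}"
| "fv (RTC x y \<phi> s t) = (fv \<phi> - {x, y}) \<union> fv_tm s \<union> fv_tm t"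

text \<open>Simultaneous capture-avoiding substitution. A bound variable is renamed only when it would
  capture: \<open>captured \<theta> V\<close> collects the variables introduced by \<open>\<theta>\<close> on \<open>V\<close>, and \<open>pick x B C\<close>
  keeps \<open>x\<close> unless it lies in \<open>C\<close>, in which case it takes a variable outside \<open>B \<union> C\<close>
  (\<open>B\<close> keeps the two variables bound by \<open>RTC\<close> distinct). Thus \<open>subst (Var(x := r, y := t)) \<phi>\<close> is
  $\varphi[r/x,t/y]$.\<close>

primrec subst_tm :: "(var \<Rightarrow> 'f tm) \<Rightarrow> 'f tm \<Rightarrow> 'f tm" where
  "subst_tm \<theta> (Var x) = \<theta> x"
| "subst_tm \<theta> (Fun f ts) = Fun f (map (subst_tm \<theta>) ts)"

definition captured :: "(var \<Rightarrow> 'f tm) \<Rightarrow> var set \<Rightarrow> var set" where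
  "captured \<theta> V = (\<Union>u\<in>V. fv_tm (\<theta> u))"

definition pick :: "var \<Rightarrow> var set \<Rightarrow> var set \<Rightarrow> var" where
  "pick x B C = (if x \<in> C then (LEAST z. z \<notin> B \<union> C) else x)"

primrec subst :: "(var \<Rightarrow> 'f tm) \<Rightarrow> ('f, 'p) fm \<Rightarrow> ('f, 'p) fm" where
  "subst \<theta> (Eq s t) = Eq (subst_tm \<theta> s) (subst_tm \<theta> t)"
| "subst \<theta> (Pred P ts) = Pred P (map (subst_tm \<theta>) ts)"
| "subst \<theta> (Neg \<phi>) = Neg (subst \<theta> \<phi>)"
| "subst \<theta> (Conj \<phi> \<psi>) = Conj (subst \<theta> \<phi>) (subst \<theta> \<psi>)"
| "subst \<theta> (Disj \<phi> \<psi>) = Disj (subst \<theta> \<phi>) (subst \<theta> \<psi>)"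
| "subst \<theta> (Imp \<phi> \<psi>) = Imp (subst \<theta> \<phi>) (subst \<theta> \<psi>)"
| "subst \<theta> (All x \<phi>) =
     (let x' = pick x {} (captured \<theta> (fv \<phi> - {x}))
      in All x' (subst (\<theta>(x := Var x')) \<phi>))"
| "subst \<theta> (Ex x \<phi>) =
     (let x' = pick x {} (captured \<theta> (fv \<phi> - {x}))
      in Ex x' (subst (\<theta>(x := Var x')) \<phi>))"
| "subst \<theta> (RTC x y \<phi> s t) =
     (let C = captured \<theta> (fv \<phi> - {x, y}); x' = pick x {y} C; y' = pick y {x'} C
      in RTC x' y' (subst (\<theta>(x := Var x', y := Var y')) \<phi>) (subst_tm \<theta> s) (subst_tm \<theta> t))"

section \<open>Semantics\<close>

text \<open>The domain is a subset of the type \<open>'d\<close>, so that a single type accommodates structures of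
  different cardinalities. Interpretations are only constrained on symbols of the signature applied
  to the right number of elements of the domain.\<close>

record ('d, 'f, 'p) struct =
  univ :: "'d set"
  fun_int :: "'f \<Rightarrow> 'd list \<Rightarrow> 'd"
  pred_int :: "'p \<Rightarrow> 'd list \<Rightarrow> bool"

definition fo_struct :: "('f, 'p) signature \<Rightarrow> ('d, 'f, 'p) struct \<Rightarrow> bool" where
  "fo_struct S M \<longleftrightarrow> univ M \<noteq> {} \<and>
     (\<forall>f \<in> funs S. \<forall>as. length as = fun_ar S f \<and> set as \<subseteq> univ M \<longrightarrow> fun_int M f as \<in> univ M)"

definition valuations :: "('d, 'f, 'p) struct \<Rightarrow> (var \<Rightarrow> 'd) set" where
  "valuations M = {v. \<forall>x. v x \<in> univ M}"

primrec tm_val :: "('d, 'f, 'p) struct \<Rightarrow> (var \<Rightarrow> 'd) \<Rightarrow> 'f tm \<Rightarrow> 'd" where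
  "tm_val M v (Var x) = v x"
| "tm_val M v (Fun f ts) = fun_int M f (map (tm_val M v) ts)"

primrec sat :: "('d, 'f, 'p) struct \<Rightarrow> (var \<Rightarrow> 'd) \<Rightarrow> ('f, 'p) fm \<Rightarrow> bool" where
  "sat M v (Eq s t) \<longleftrightarrow> tm_val M v s = tm_val M v t"
| "sat M v (Pred P ts) \<longleftrightarrow> pred_int M P (map (tm_val M v) ts)"
| "sat M v (Neg \<phi>) \<longleftrightarrow> \<not> sat M v \<phi>"
| "sat M v (Conj \<phi> \<psi>) \<longleftrightarrow> sat M v \<phi> \<and> sat M v \<psi>"
| "sat M v (Disj \<phi> \<psi>) \<longleftrightarrow> sat M v \<phi> \<or> sat M v \<psi>"
| "sat M v (Imp \<phi> \<psi>) \<longleftrightarrow> (sat M v \<phi> \<longrightarrow> sat M v \<psi>)"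
| "sat M v (All x \<phi>) \<longleftrightarrow> (\<forall>a \<in> univ M. sat M (v(x := a)) \<phi>)"
| "sat M v (Ex x \<phi>) \<longleftrightarrow> (\<exists>a \<in> univ M. sat M (v(x := a)) \<phi>)"
| "sat M v (RTC x y \<phi> s t) \<longleftrightarrow>
     tm_val M v s = tm_val M v t \<or>
     (\<exists>n > 0. \<exists>a :: nat \<Rightarrow> 'd. (\<forall>i \<le> n. a i \<in> univ M) \<and>
        a 0 = tm_val M v s \<and> a n = tm_val M v t \<and>
        (\<forall>i < n. sat M (v(x := a i, y := a (Suc i))) \<phi>))"

type_synonym ('d, 'f, 'p) frame = "('d, 'f, 'p) struct \<times> 'd set set"

primrec hsat :: "('d, 'f, 'p) frame \<Rightarrow> (var \<Rightarrow> 'd) \<Rightarrow> ('f, 'p) fm \<Rightarrow> bool" where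
  "hsat F v (Eq s t) \<longleftrightarrow> tm_val (fst F) v s = tm_val (fst F) v t"
| "hsat F v (Pred P ts) \<longleftrightarrow> pred_int (fst F) P (map (tm_val (fst F) v) ts)"
| "hsat F v (Neg \<phi>) \<longleftrightarrow> \<not> hsat F v \<phi>"
| "hsat F v (Conj \<phi> \<psi>) \<longleftrightarrow> hsat F v \<phi> \<and> hsat F v \<psi>"
| "hsat F v (Disj \<phi> \<psi>) \<longleftrightarrow> hsat F v \<phi> \<or> hsat F v \<psi>"
| "hsat F v (Imp \<phi> \<psi>) \<longleftrightarrow> (hsat F v \<phi> \<longrightarrow> hsat F v \<psi>)"
| "hsat F v (All x \<phi>) \<longleftrightarrow> (\<forall>a \<in> univ (fst F). hsat F (v(x := a)) \<phi>)"
| "hsat F v (Ex x \<phi>) \<longleftrightarrow> (\<exists>a \<in> univ (fst F). hsat F (v(x := a)) \<phi>)"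
| "hsat F v (RTC x y \<phi> s t) \<longleftrightarrow>
     (\<forall>A \<in> snd F. tm_val (fst F) v s \<in> A \<and>
        (\<forall>a \<in> univ (fst F). \<forall>b \<in> univ (fst F).
           a \<in> A \<and> hsat F (v(x := a, y := b)) \<phi> \<longrightarrow> b \<in> A)
        \<longrightarrow> tm_val (fst F) v t \<in> A)"

definition henkin_struct :: "('f, 'p) signature \<Rightarrow> ('d, 'f, 'p) frame \<Rightarrow> bool" where
  "henkin_struct S F \<longleftrightarrow> fo_struct S (fst F) \<and> snd F \<subseteq> Pow (univ (fst F)) \<and>
     (\<forall>\<phi> x v. wf_fm S \<phi> \<and> v \<in> valuations (fst F) \<longrightarrow>
        {a \<in> univ (fst F). hsat F (v(x := a)) \<phi>} \<in> snd F)"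

definition admissible :: "'f \<Rightarrow> 'f \<Rightarrow> ('d, 'f, 'p) struct \<Rightarrow> bool" where
  "admissible c pr M \<longleftrightarrow>
     (\<forall>a \<in> univ M. \<forall>b \<in> univ M. \<forall>a' \<in> univ M. \<forall>b' \<in> univ M.
        fun_int M pr [a, b] = fun_int M pr [a', b'] \<longrightarrow> a = a' \<and> b = b') \<and>
     (\<forall>a \<in> univ M. \<forall>b \<in> univ M. fun_int M pr [a, b] \<noteq> fun_int M c [])"

definition admissible_standard ::
  "('f, 'p) signature \<Rightarrow> 'f \<Rightarrow> 'f \<Rightarrow> ('d, 'f, 'p) struct set" where
  "admissible_standard S c pr = {M. fo_struct S M \<and> admissible c pr M}"

definition admissible_henkin ::
  "('f, 'p) signature \<Rightarrow> 'f \<Rightarrow> 'f \<Rightarrow> ('d, 'f, 'p) frame set" where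
  "admissible_henkin S c pr = {F. henkin_struct S F \<and> admissible c pr (fst F)}"

section \<open>Sequents\<close>

text \<open>Both sides of a sequent are finite sets, so exchange and contraction are implicit and
  \<open>finsert \<phi> \<Gamma>\<close> renders $\Gamma,\varphi$.\<close>

type_synonym ('f, 'p) seq = "('f, 'p) fm fset \<times> ('f, 'p) fm fset"

definition wf_seq :: "('f, 'p) signature \<Rightarrow> ('f, 'p) seq \<Rightarrow> bool" where
  "wf_seq S \<sigma> \<longleftrightarrow> (\<forall>\<phi>. \<phi> |\<in>| fst \<sigma> |\<union>| snd \<sigma> \<longrightarrow> wf_fm S \<phi>)"

definition fv_set :: "('f, 'p) fm fset \<Rightarrow> var set" where
  "fv_set \<Gamma> = \<Union> (fv ` fset \<Gamma>)"

definition valid_in :: "('d, 'f, 'p) struct set \<Rightarrow> ('f, 'p) seq \<Rightarrow> bool" where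
  "valid_in K \<sigma> \<longleftrightarrow> (\<forall>M \<in> K. \<forall>v \<in> valuations M.
     (\<forall>\<phi>. \<phi> |\<in>| fst \<sigma> \<longrightarrow> sat M v \<phi>) \<longrightarrow> (\<exists>\<phi>. \<phi> |\<in>| snd \<sigma> \<and> sat M v \<phi>))"

definition hvalid_in :: "('d, 'f, 'p) frame set \<Rightarrow> ('f, 'p) seq \<Rightarrow> bool" where
  "hvalid_in K \<sigma> \<longleftrightarrow> (\<forall>F \<in> K. \<forall>v \<in> valuations (fst F).
     (\<forall>\<phi>. \<phi> |\<in>| fst \<sigma> \<longrightarrow> hsat F v \<phi>) \<longrightarrow> (\<exists>\<phi>. \<phi> |\<in>| snd \<sigma> \<and> hsat F v \<phi>))"

section \<open>Inference rules\<close>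

text \<open>A rule instance relates a tag, the list of premises and the conclusion. The tag records what
  the trace condition needs to know: the substitution of a (Subst) instance, and the principal
  formula and its immediate ancestor for a (Case) instance.\<close>

datatype ('f, 'p) tag =
    Plain
  | Substitution "var \<Rightarrow> 'f tm"
  | CaseSplit "('f, 'p) fm" "('f, 'p) fm"

type_synonym ('f, 'p) inferences = "('f, 'p) tag \<Rightarrow> ('f, 'p) seq list \<Rightarrow> ('f, 'p) seq \<Rightarrow> bool"

text \<open>Derivations (below) only contain well-formed sequents. Well-formedness is imposed here only on
  terms and formulas whose well-formedness does not follow from that of the premises and conclusion.\<close>

inductive lk_rule :: "('f, 'p) signature \<Rightarrow> ('f, 'p) inferences" for S where
  Ax: "lk_rule S Plain [] ({|\<phi>|}, {|\<phi>|})"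
| WL: "lk_rule S Plain [(\<Gamma>, \<Delta>)] (finsert \<phi> \<Gamma>, \<Delta>)"
| WR: "lk_rule S Plain [(\<Gamma>, \<Delta>)] (\<Gamma>, finsert \<phi> \<Delta>)"
| NegL: "lk_rule S Plain [(\<Gamma>, finsert \<phi> \<Delta>)] (finsert (Neg \<phi>) \<Gamma>, \<Delta>)"
| NegR: "lk_rule S Plain [(finsert \<phi> \<Gamma>, \<Delta>)] (\<Gamma>, finsert (Neg \<phi>) \<Delta>)"
| ConjL: "lk_rule S Plain [(finsert \<phi> (finsert \<psi> \<Gamma>), \<Delta>)] (finsert (Conj \<phi> \<psi>) \<Gamma>, \<Delta>)"
| ConjR: "lk_rule S Plain [(\<Gamma>, finsert \<phi> \<Delta>), (\<Gamma>, finsert \<psi> \<Delta>)] (\<Gamma>, finsert (Conj \<phi> \<psi>) \<Delta>)"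
| DisjL: "lk_rule S Plain [(finsert \<phi> \<Gamma>, \<Delta>), (finsert \<psi> \<Gamma>, \<Delta>)] (finsert (Disj \<phi> \<psi>) \<Gamma>, \<Delta>)"
| DisjR: "lk_rule S Plain [(\<Gamma>, finsert \<phi> (finsert \<psi> \<Delta>))] (\<Gamma>, finsert (Disj \<phi> \<psi>) \<Delta>)"
| ImpL: "lk_rule S Plain [(\<Gamma>, finsert \<phi> \<Delta>), (finsert \<psi> \<Gamma>, \<Delta>)] (finsert (Imp \<phi> \<psi>) \<Gamma>, \<Delta>)"
| ImpR: "lk_rule S Plain [(finsert \<phi> \<Gamma>, finsert \<psi> \<Delta>)] (\<Gamma>, finsert (Imp \<phi> \<psi>) \<Delta>)"
| AllL: "wf_tm S t \<Longrightarrow>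
    lk_rule S Plain [(finsert (subst (Var(x := t)) \<phi>) \<Gamma>, \<Delta>)] (finsert (All x \<phi>) \<Gamma>, \<Delta>)"
| AllR: "z \<notin> fv_set \<Gamma> \<union> fv_set \<Delta> \<union> fv (All x \<phi>) \<Longrightarrow>
    lk_rule S Plain [(\<Gamma>, finsert (subst (Var(x := Var z)) \<phi>) \<Delta>)] (\<Gamma>, finsert (All x \<phi>) \<Delta>)"
| ExL: "z \<notin> fv_set \<Gamma> \<union> fv_set \<Delta> \<union> fv (Ex x \<phi>) \<Longrightarrow>
    lk_rule S Plain [(finsert (subst (Var(x := Var z)) \<phi>) \<Gamma>, \<Delta>)] (finsert (Ex x \<phi>) \<Gamma>, \<Delta>)"
| ExR: "wf_tm S t \<Longrightarrow>
    lk_rule S Plain [(\<Gamma>, finsert (subst (Var(x := t)) \<phi>) \<Delta>)] (\<Gamma>, finsert (Ex x \<phi>) \<Delta>)"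
| EqL1: "wf_fm S \<phi> \<Longrightarrow>
    lk_rule S Plain [(\<Gamma>, finsert (subst (Var(x := s)) \<phi>) \<Delta>)]
      (finsert (Eq s t) \<Gamma>, finsert (subst (Var(x := t)) \<phi>) \<Delta>)"
| EqL2: "wf_fm S \<phi> \<Longrightarrow>
    lk_rule S Plain [(\<Gamma>, finsert (subst (Var(x := t)) \<phi>) \<Delta>)]
      (finsert (Eq s t) \<Gamma>, finsert (subst (Var(x := s)) \<phi>) \<Delta>)"
| EqR: "lk_rule S Plain [] ({||}, {|Eq t t|})"
| Cut: "lk_rule S Plain [(\<Gamma>, finsert \<phi> \<Delta>), (finsert \<phi> \<Gamma>, \<Delta>)] (\<Gamma>, \<Delta>)"
| Subst: "(\<And>x. wf_tm S (\<theta> x)) \<Longrightarrow>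
    lk_rule S (Substitution \<theta>) [(\<Gamma>, \<Delta>)] (subst \<theta> |`| \<Gamma>, subst \<theta> |`| \<Delta>)"

inductive rtc_rule :: "('f, 'p) inferences" where
  Refl: "rtc_rule Plain [] (\<Gamma>, finsert (RTC x y \<phi> s s) \<Delta>)"
| Trans: "rtc_rule Plain
    [(\<Gamma>, finsert (RTC x y \<phi> s r) \<Delta>), (\<Gamma>, finsert (subst (Var(x := r, y := t)) \<phi>) \<Delta>)]
    (\<Gamma>, finsert (RTC x y \<phi> s t) \<Delta>)"

inductive ind_rule :: "('f, 'p) inferences" where
  Ind: "x \<notin> fv_set \<Gamma> \<union> fv_set \<Delta> \<Longrightarrow> y \<notin> fv_set \<Gamma> \<union> fv_set \<Delta> \<union> fv \<psi> \<Longrightarrow>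
    ind_rule Plain
      [(finsert \<psi> (finsert \<phi> \<Gamma>), finsert (subst (Var(x := Var y)) \<psi>) \<Delta>)]
      (finsert (subst (Var(x := s)) \<psi>) (finsert (RTC x y \<phi> s t) \<Gamma>),
       finsert (subst (Var(x := t)) \<psi>) \<Delta>)"

inductive case_rule :: "('f, 'p) inferences" where
  Case: "z \<notin> fv_set \<Gamma> \<union> fv_set \<Delta> \<union> fv (RTC x y \<phi> s t) \<Longrightarrow>
    case_rule (CaseSplit (RTC x y \<phi> s t) (RTC x y \<phi> s (Var z)))
      [(finsert (Eq s t) \<Gamma>, \<Delta>),
       (finsert (RTC x y \<phi> s (Var z)) (finsert (subst (Var(x := Var z, y := t)) \<phi>) \<Gamma>), \<Delta>)]
      (finsert (RTC x y \<phi> s t) \<Gamma>, \<Delta>)"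

inductive pair_rule :: "'f \<Rightarrow> 'f \<Rightarrow> ('f, 'p) inferences" for c pr where
  PairInj: "pair_rule c pr Plain
    [(\<Gamma>, finsert (Eq (Fun pr [Var x, Var y]) (Fun pr [Var u, Var v])) \<Delta>)]
    (\<Gamma>, finsert (Conj (Eq (Var x) (Var u)) (Eq (Var y) (Var v))) \<Delta>)"
| PairConst: "pair_rule c pr Plain [] (finsert (Eq (Fun pr [Var x, Var y]) (Fun c [])) \<Gamma>, \<Delta>)"

definition RTC_G :: "('f, 'p) signature \<Rightarrow> ('f, 'p) inferences" where
  "RTC_G S = sup (lk_rule S) (sup rtc_rule ind_rule)"

definition RTC_G_omega :: "('f, 'p) signature \<Rightarrow> ('f, 'p) inferences" where
  "RTC_G_omega S = sup (lk_rule S) (sup rtc_rule case_rule)"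

definition pair_RTC_G :: "('f, 'p) signature \<Rightarrow> 'f \<Rightarrow> 'f \<Rightarrow> ('f, 'p) inferences" where
  "pair_RTC_G S c pr = sup (RTC_G S) (pair_rule c pr)"

definition pair_RTC_G_omega :: "('f, 'p) signature \<Rightarrow> 'f \<Rightarrow> 'f \<Rightarrow> ('f, 'p) inferences" where
  "pair_RTC_G_omega S c pr = sup (RTC_G_omega S) (pair_rule c pr)"

section \<open>Proofs\<close>

inductive fin_provable :: "('f, 'p) signature \<Rightarrow> ('f, 'p) inferences \<Rightarrow> ('f, 'p) seq \<Rightarrow> bool"
  for S R where
  "\<lbrakk>R r \<Sigma> \<sigma>; wf_seq S \<sigma>; \<And>\<sigma>'. \<sigma>' \<in> set \<Sigma> \<Longrightarrow> fin_provable S R \<sigma>'\<rbrakk> \<Longrightarrow> fin_provable S R \<sigma>"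

codatatype ('f, 'p) deriv =
  Node (concl: "('f, 'p) seq") (tag_of: "('f, 'p) tag") (subs: "('f, 'p) deriv list")

text \<open>Every node, leaves included, is the conclusion of a rule instance: there are no open leaves.\<close>

coinductive preproof :: "('f, 'p) signature \<Rightarrow> ('f, 'p) inferences \<Rightarrow> ('f, 'p) deriv \<Rightarrow> bool"
  for S R where
  "\<lbrakk>R r (map concl Ts) \<sigma>; wf_seq S \<sigma>; \<And>T. T \<in> set Ts \<Longrightarrow> preproof S R T\<rbrakk>
    \<Longrightarrow> preproof S R (Node \<sigma> r Ts)"

text \<open>An infinite path from the root: its nodes \<open>p\<close> and the index \<open>d n\<close> of the premise chosen
  at step \<open>n\<close>.\<close>

definition inf_path :: "('f, 'p) deriv \<Rightarrow> (nat \<Rightarrow> ('f, 'p) deriv) \<Rightarrow> (nat \<Rightarrow> nat) \<Rightarrow> bool" where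
  "inf_path T p d \<longleftrightarrow> p 0 = T \<and>
     (\<forall>n. d n < length (subs (p n)) \<and> p (Suc n) = subs (p n) ! d n)"

text \<open>\<open>\<tau>\<close> is in the antecedent of the conclusion and \<open>\<tau>'\<close> in that of premise number \<open>i\<close>. Across (Subst)
  only \<open>\<tau> = \<tau>'\<theta>\<close> is allowed; the immediate ancestor in (Case) sits in premise number 1.\<close>

fun progress_pair ::
  "('f, 'p) tag \<Rightarrow> nat \<Rightarrow> ('f, 'p) fm \<Rightarrow> ('f, 'p) fm \<Rightarrow> bool" where
  "progress_pair (CaseSplit \<pi> \<alpha>) i \<tau> \<tau>' \<longleftrightarrow> i = 1 \<and> \<tau> = \<pi> \<and> \<tau>' = \<alpha>"
| "progress_pair _ i \<tau> \<tau>' \<longleftrightarrow> False"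

fun trace_pair ::
  "('f, 'p) tag \<Rightarrow> nat \<Rightarrow> ('f, 'p) fm \<Rightarrow> ('f, 'p) fm \<Rightarrow> bool" where
  "trace_pair (Substitution \<theta>) i \<tau> \<tau>' \<longleftrightarrow> \<tau> = subst \<theta> \<tau>'"
| "trace_pair r i \<tau> \<tau>' \<longleftrightarrow> \<tau> = \<tau>' \<or> progress_pair r i \<tau> \<tau>'"

definition inf_progressing_trace ::
  "(nat \<Rightarrow> ('f, 'p) deriv) \<Rightarrow> (nat \<Rightarrow> nat) \<Rightarrow> (nat \<Rightarrow> ('f, 'p) fm) \<Rightarrow> bool" where
  "inf_progressing_trace p d \<tau> \<longleftrightarrow>
     (\<exists>k. \<forall>n \<ge> k. (\<exists>x y \<phi> s t. \<tau> n = RTC x y \<phi> s t) \<and> \<tau> n |\<in>| fst (concl (p n)) \<and>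
        trace_pair (tag_of (p n)) (d n) (\<tau> n) (\<tau> (Suc n))) \<and>
     (\<forall>m. \<exists>n \<ge> m. progress_pair (tag_of (p n)) (d n) (\<tau> n) (\<tau> (Suc n)))"

definition omega_provable ::
  "('f, 'p) signature \<Rightarrow> ('f, 'p) inferences \<Rightarrow> ('f, 'p) seq \<Rightarrow> bool" where
  "omega_provable S R \<sigma> \<longleftrightarrow>
     (\<exists>T. preproof S R T \<and> concl T = \<sigma> \<and>
        (\<forall>p d. inf_path T p d \<longrightarrow> (\<exists>\<tau>. inf_progressing_trace p d \<tau>)))"

end

(* Soundness. A valuation falsifying the conclusion of a rule yields one falsifying some premise. In the
   infinitary system this produces an infinite path, along which the length of a shortest path
   witnessing a traced RTC formula never increases, and decreases at each progress point.

   Completeness. An unprovable sequent is extended, along a chain of unprovable sequents, to a pair (L, R)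
   meeting countably many dense conditions: every formula is decided, quantifiers have witnesses, and
   - standard semantics: if (RTC phi)(s, t) is in L, then so is an explicit finite phi-path from s to t.
     This is dense because the infinitary system admits an omega-rule: if every finite unfolding of
     the RTC formula gives a provable sequent, then applying (Case) forever on the rightmost branch
     gives a proof;
   - Henkin semantics: if (RTC phi)(s, t) and psi(s) are in L and psi(t) in R, then there are a, b with
     psi(a) and phi(a, b) in L and psi(b) in R. This is dense by (Ind).
   Terms modulo provable equality then form a countermodel, where for the Henkin semantics the
   second-order part consists of the sets definable by formulas in L. The chain is countable because
   it only uses the finitely many symbols of the given sequent; the others are interpreted trivially. *)

theory Submission
  imports Defs "HOL-Library.Countable_Set"
begin

section \<open>Substitution\<close>

text \<open>Formulas are not identified up to renaming of bound variables. Composition of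
  substitutions is therefore an equality only under a freshness condition, and the equivalence of
  two variants of an \<open>RTC\<close> formula has to be derived inside the finitary calculus
  before (Ind) can be used with fresh variables. Conditions are met by finite sequents because
  compactness fails for the standard semantics: finite paths must be secured while the set is being
  built. Finiteness also leaves fresh variables at every stage, so variables serve as witnesses and
  the language is never extended. The domain type is given and merely infinite, so equality classes
  of terms are named by its elements, which works because there are countably many. Restricting the
  symbols has a price for Henkin structures: comprehension still concerns all formulas of the full
  signature, and these are translated into the restricted one.\<close>

lemma finite_fv_tm [simp]: "finite (fv_tm t)"
  by (induction t) auto

lemma finite_fv [simp]: "finite (fv \<phi>)"
  by (induction \<phi>) auto

lemma finite_fv_set [simp]: "finite (fv_set \<Gamma>)"
  by (simp add: fv_set_def)

lemma fv_set_finsert [simp]: "fv_set (finsert \<phi> \<Gamma>) = fv \<phi> \<union> fv_set \<Gamma>"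
  by (simp add: fv_set_def)

lemma fv_set_empty [simp]: "fv_set {||} = {}"
  by (simp add: fv_set_def)

lemma fv_subset_fv_set: "\<phi> |\<in>| \<Gamma> \<Longrightarrow> fv \<phi> \<subseteq> fv_set \<Gamma>"
  by (auto simp: fv_set_def)

lemma finite_captured [simp]: "finite V \<Longrightarrow> finite (captured \<theta> V)"
  by (simp add: captured_def)

lemma notin_captured: "z \<notin> captured \<theta> V \<Longrightarrow> u \<in> V \<Longrightarrow> z \<notin> fv_tm (\<theta> u)"
  by (auto simp: captured_def)

lemma ex_fresh_var: "finite A \<Longrightarrow> \<exists>z :: var. z \<notin> A"
  using ex_new_if_finite[OF infinite_UNIV_nat] .

lemma Least_fresh: "finite (A :: var set) \<Longrightarrow> (LEAST z. z \<notin> A) \<notin> A"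
  by (rule LeastI_ex) (rule ex_fresh_var)

lemma pick_notin_right: "finite B \<Longrightarrow> finite C \<Longrightarrow> pick x B C \<notin> C"
  using Least_fresh[of "B \<union> C"] by (auto simp: pick_def)

lemma pick_notin_left: "finite B \<Longrightarrow> finite C \<Longrightarrow> x \<notin> B \<Longrightarrow> pick x B C \<notin> B"
  using Least_fresh[of "B \<union> C"] by (auto simp: pick_def)

lemma pick_same: "x \<notin> C \<Longrightarrow> pick x B C = x"
  by (simp add: pick_def)

text \<open>If \<open>y\<close> is kept, distinctness comes from \<open>x'\<close> avoiding
  \<open>y\<close>; if \<open>y\<close> is renamed, from \<open>y'\<close> avoiding
  \<open>x'\<close>.\<close>

lemma pick_pair:
  assumes "finite C" "x' = pick x {y} C" "y' = pick y {x'} C"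
  shows "x' \<notin> C" "y' \<notin> C" "x \<noteq> y \<Longrightarrow> x' \<noteq> y'"
proof -
  show "x' \<notin> C" "y' \<notin> C"
    using assms pick_notin_right[of "{y}" C x] pick_notin_right[of "{x'}" C y] by auto
  assume "x \<noteq> y"
  then have "x' \<noteq> y"
    using assms pick_notin_left[of "{y}" C x] by auto
  then show "x' \<noteq> y'"
    using assms pick_notin_left[of "{x'}" C y] by auto
qed

lemma tm_val_cong: "(\<And>x. x \<in> fv_tm t \<Longrightarrow> v x = w x) \<Longrightarrow> tm_val M v t = tm_val M w t"
proof (induction t)
  case (Fun f ts)
  then have "map (tm_val M v) ts = map (tm_val M w) ts"
    by (intro map_cong) auto
  then show ?case by (simp only: tm_val.simps)
qed simp

lemma subst_tm_cong: "(\<And>x. x \<in> fv_tm t \<Longrightarrow> \<theta> x = \<sigma> x) \<Longrightarrow> subst_tm \<theta> t = subst_tm \<sigma> t"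
  by (induction t) auto

lemma subst_tm_Var [simp]: "subst_tm Var t = t"
  by (induction t) (auto intro: map_idI)

lemma tm_val_subst: "tm_val M v (subst_tm \<theta> t) = tm_val M (\<lambda>x. tm_val M v (\<theta> x)) t"
proof (induction t)
  case (Fun f ts)
  then have "map (tm_val M v \<circ> subst_tm \<theta>) ts = map (tm_val M (\<lambda>x. tm_val M v (\<theta> x))) ts"
    by (intro map_cong) auto
  then show ?case by (simp only: tm_val.simps subst_tm.simps map_map)
qed simp

lemma fv_subst_tm: "fv_tm (subst_tm \<theta> t) = captured \<theta> (fv_tm t)"
  by (induction t) (auto simp: captured_def)

lemma subst_tm_subst_tm: "subst_tm \<sigma> (subst_tm \<theta> t) = subst_tm (\<lambda>x. subst_tm \<sigma> (\<theta> x)) t"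
  by (induction t) auto

lemma wf_subst_tm: "(\<And>x. wf_tm S (\<theta> x)) \<Longrightarrow> wf_tm S t \<Longrightarrow> wf_tm S (subst_tm \<theta> t)"
  by (induction t) (auto simp: list_all_iff)

lemma captured_Un: "captured \<theta> (A \<union> B) = captured \<theta> A \<union> captured \<theta> B"
  by (auto simp: captured_def)

lemma captured_UN: "captured \<theta> (\<Union>i\<in>I. A i) = (\<Union>i\<in>I. captured \<theta> (A i))"
  by (auto simp: captured_def)

text \<open>The chosen bound variable lies outside everything that \<open>\<theta>\<close>
  introduces for the other free variables, so binding it removes only itself and the result is an
  equality.\<close>

lemma fv_subst: "fv (subst \<theta> \<phi>) = captured \<theta> (fv \<phi>)"
proof (induction \<phi> arbitrary: \<theta>)
  case (All x \<phi>)
  define x' where "x' = pick x {} (captured \<theta> (fv \<phi> - {x}))"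
  then have "x' \<notin> captured \<theta> (fv \<phi> - {x})"
    by (simp add: pick_notin_right)
  then have "captured (\<theta>(x := Var x')) (fv \<phi>) - {x'} = captured \<theta> (fv \<phi> - {x})"
    by (auto simp: captured_def split: if_splits)
  then show ?case
    by (simp add: Let_def x'_def[symmetric] All.IH del: fun_upd_apply)
next
  case (Ex x \<phi>)
  define x' where "x' = pick x {} (captured \<theta> (fv \<phi> - {x}))"
  then have "x' \<notin> captured \<theta> (fv \<phi> - {x})"
    by (simp add: pick_notin_right)
  then have "captured (\<theta>(x := Var x')) (fv \<phi>) - {x'} = captured \<theta> (fv \<phi> - {x})"
    by (auto simp: captured_def split: if_splits)
  then show ?case
    by (simp add: Let_def x'_def[symmetric] Ex.IH del: fun_upd_apply)
next
  case (RTC x y \<phi> s t)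
  define C where "C = captured \<theta> (fv \<phi> - {x, y})"
  define x' where "x' = pick x {y} C"
  define y' where "y' = pick y {x'} C"
  have "finite C" by (simp add: C_def)
  from pick_pair[OF this x'_def y'_def]
  have "captured (\<theta>(x := Var x', y := Var y')) (fv \<phi>) - {x', y'} = C"
    unfolding C_def by (auto simp: captured_def split: if_splits)
  then show ?case
    by (simp add: RTC.IH Let_def C_def[symmetric] x'_def[symmetric] y'_def[symmetric] fv_subst_tm
        captured_Un del: fun_upd_apply)
qed (simp_all add: fv_subst_tm captured_Un captured_UN)

lemma wf_subst: "(\<And>x. wf_tm S (\<theta> x)) \<Longrightarrow> wf_fm S \<phi> \<Longrightarrow> wf_fm S (subst \<theta> \<phi>)"
proof (induction \<phi> arbitrary: \<theta>)
  case (RTC x y \<phi> s t)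
  define C where "C = captured \<theta> (fv \<phi> - {x, y})"
  define x' where "x' = pick x {y} C"
  define y' where "y' = pick y {x'} C"
  have "finite C" by (simp add: C_def)
  from pick_pair(3)[OF this x'_def y'_def] RTC.prems have "x' \<noteq> y'" by simp
  then show ?case
    using RTC by (simp add: Let_def C_def[symmetric] x'_def[symmetric] y'_def[symmetric]
        wf_subst_tm)
qed (auto simp: Let_def wf_subst_tm list_all_iff)

lemma captured_cong: "(\<And>u. u \<in> V \<Longrightarrow> \<theta> u = \<sigma> u) \<Longrightarrow> captured \<theta> V = captured \<sigma> V"
  by (auto simp: captured_def)

text \<open>The names picked for bound variables depend on \<open>\<theta>\<close> only through
  \<open>captured\<close> on free variables, so both results are syntactically equal.\<close>

lemma subst_cong: "(\<And>u. u \<in> fv \<phi> \<Longrightarrow> \<theta> u = \<sigma> u) \<Longrightarrow> subst \<theta> \<phi> = subst \<sigma> \<phi>"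
proof (induction \<phi> arbitrary: \<theta> \<sigma>)
  case (All x \<phi>)
  then have "captured \<theta> (fv \<phi> - {x}) = captured \<sigma> (fv \<phi> - {x})"
    by (intro captured_cong) auto
  then show ?case
    using All.prems by (simp add: Let_def) (intro All.IH, auto)
next
  case (Ex x \<phi>)
  then have "captured \<theta> (fv \<phi> - {x}) = captured \<sigma> (fv \<phi> - {x})"
    by (intro captured_cong) auto
  then show ?case
    using Ex.prems by (simp add: Let_def) (intro Ex.IH, auto)
next
  case (RTC x y \<phi> s t)
  have "captured \<theta> (fv \<phi> - {x, y}) = captured \<sigma> (fv \<phi> - {x, y})"
    using RTC.prems by (intro captured_cong) auto
  moreover have "subst_tm \<theta> s = subst_tm \<sigma> s" "subst_tm \<theta> t = subst_tm \<sigma> t"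
    using RTC.prems by (auto intro: subst_tm_cong)
  ultimately show ?case
    using RTC.prems by (simp add: Let_def) (intro RTC.IH, auto)
next
  case (Imp \<phi> \<psi>)
  have "subst \<theta> \<phi> = subst \<sigma> \<phi>" "subst \<theta> \<psi> = subst \<sigma> \<psi>"
    by (rule Imp.IH; use Imp.prems in simp)+
  then show ?case by simp
next
  case (Conj \<phi> \<psi>)
  have "subst \<theta> \<phi> = subst \<sigma> \<phi>" "subst \<theta> \<psi> = subst \<sigma> \<psi>"
    by (rule Conj.IH; use Conj.prems in simp)+
  then show ?case by simp
next
  case (Disj \<phi> \<psi>)
  have "subst \<theta> \<phi> = subst \<sigma> \<phi>" "subst \<theta> \<psi> = subst \<sigma> \<psi>"
    by (rule Disj.IH; use Disj.prems in simp)+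
  then show ?case by simp
next
  case (Neg \<phi>)
  have "subst \<theta> \<phi> = subst \<sigma> \<phi>"
    by (rule Neg.IH) (use Neg.prems in simp)
  then show ?case by simp
qed (auto intro: subst_tm_cong)

lemma captured_Var [simp]: "captured Var V = V"
  by (auto simp: captured_def)

lemma subst_Var [simp]: "subst Var \<phi> = \<phi>"
proof (induction \<phi>)
  case (Pred P ts)
  then show ?case by (auto intro: map_idI)
qed (simp_all add: pick_def Let_def)

lemma subst_id: "(\<And>u. u \<in> fv \<phi> \<Longrightarrow> \<theta> u = Var u) \<Longrightarrow> subst \<theta> \<phi> = \<phi>"
  using subst_cong[of \<phi> \<theta> Var] by simp

lemma subst_tm_id: "(\<And>u. u \<in> fv_tm t \<Longrightarrow> \<theta> u = Var u) \<Longrightarrow> subst_tm \<theta> t = t"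
  using subst_tm_cong[of t \<theta> Var] by simp

text \<open>Serves to express that a substitution causes no renaming anywhere: the variables it
  introduces avoid all bound ones.\<close>

primrec bv :: "('f, 'p) fm \<Rightarrow> var set" where
  "bv (Eq s t) = {}"
| "bv (Pred P ts) = {}"
| "bv (Neg \<phi>) = bv \<phi>"
| "bv (Conj \<phi> \<psi>) = bv \<phi> \<union> bv \<psi>"
| "bv (Disj \<phi> \<psi>) = bv \<phi> \<union> bv \<psi>"
| "bv (Imp \<phi> \<psi>) = bv \<phi> \<union> bv \<psi>"
| "bv (All x \<phi>) = insert x (bv \<phi>)"
| "bv (Ex x \<phi>) = insert x (bv \<phi>)"
| "bv (RTC x y \<phi> s t) = insert x (insert y (bv \<phi>))"

lemma finite_bv [simp]: "finite (bv \<phi>)"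
  by (induction \<phi>) auto

lemma captured_captured: "captured \<sigma> (captured \<theta> V) = captured (\<lambda>u. subst_tm \<sigma> (\<theta> u)) V"
  by (auto simp: captured_def fv_subst_tm)

text \<open>The two substitutions compose on the nose, and not just up to renaming of bound variables,
  because the first one cannot cause any renaming.\<close>

lemma subst_subst:
  assumes "\<And>u. u \<in> fv \<phi> \<Longrightarrow> \<theta> u = Var u \<or> fv_tm (\<theta> u) \<inter> bv \<phi> = {}"
  shows "subst \<sigma> (subst \<theta> \<phi>) = subst (\<lambda>x. subst_tm \<sigma> (\<theta> x)) \<phi>"
  using assms
proof (induction \<phi> arbitrary: \<theta> \<sigma>)
  case (All x \<phi>)
  have x: "x \<notin> captured \<theta> (fv \<phi> - {x})"
    using All.prems by (fastforce simp: captured_def)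
  have "captured (\<theta>(x := Var x)) (fv \<phi>) - {x} = captured \<theta> (fv \<phi> - {x})"
    using x by (auto simp: captured_def split: if_splits)
  \<comment> \<open>The sets that govern the choice of the bound name agree for the iterated and for
    the composed substitution, so both pick the same name.\<close>
  then have fv: "captured \<sigma> (fv (subst (\<theta>(x := Var x)) \<phi>) - {x})
      = captured (\<lambda>u. subst_tm \<sigma> (\<theta> u)) (fv \<phi> - {x})"
    by (simp add: fv_subst captured_captured)
  have *: "subst (\<sigma>(x := Var x')) (subst (\<theta>(x := Var x)) \<phi>)
      = subst ((\<lambda>u. subst_tm \<sigma> (\<theta> u))(x := Var x')) \<phi>" for x'
  proof -
    have "subst (\<sigma>(x := Var x')) (subst (\<theta>(x := Var x)) \<phi>)
        = subst (\<lambda>u. subst_tm (\<sigma>(x := Var x')) ((\<theta>(x := Var x)) u)) \<phi>"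
      by (rule All.IH) (use All.prems in auto)
    also have "\<dots> = subst ((\<lambda>u. subst_tm \<sigma> (\<theta> u))(x := Var x')) \<phi>"
      using notin_captured[OF x] by (intro subst_cong) (auto intro!: subst_tm_cong)
    finally show ?thesis .
  qed
  show ?case by (simp add: Let_def pick_same[OF x] fv *)
next
  case (Ex x \<phi>)
  have x: "x \<notin> captured \<theta> (fv \<phi> - {x})"
    using Ex.prems by (fastforce simp: captured_def)
  have "captured (\<theta>(x := Var x)) (fv \<phi>) - {x} = captured \<theta> (fv \<phi> - {x})"
    using x by (auto simp: captured_def split: if_splits)
  then have fv: "captured \<sigma> (fv (subst (\<theta>(x := Var x)) \<phi>) - {x})
      = captured (\<lambda>u. subst_tm \<sigma> (\<theta> u)) (fv \<phi> - {x})"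
    by (simp add: fv_subst captured_captured)
  have *: "subst (\<sigma>(x := Var x')) (subst (\<theta>(x := Var x)) \<phi>)
      = subst ((\<lambda>u. subst_tm \<sigma> (\<theta> u))(x := Var x')) \<phi>" for x'
  proof -
    have "subst (\<sigma>(x := Var x')) (subst (\<theta>(x := Var x)) \<phi>)
        = subst (\<lambda>u. subst_tm (\<sigma>(x := Var x')) ((\<theta>(x := Var x)) u)) \<phi>"
      by (rule Ex.IH) (use Ex.prems in auto)
    also have "\<dots> = subst ((\<lambda>u. subst_tm \<sigma> (\<theta> u))(x := Var x')) \<phi>"
      using notin_captured[OF x] by (intro subst_cong) (auto intro!: subst_tm_cong)
    finally show ?thesis .
  qed
  show ?case by (simp add: Let_def pick_same[OF x] fv *)
next
  case (RTC x y \<phi> s t)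
  have x: "x \<notin> captured \<theta> (fv \<phi> - {x, y})" and y: "y \<notin> captured \<theta> (fv \<phi> - {x, y})"
    using RTC.prems by (fastforce simp: captured_def)+
  have "captured (\<theta>(x := Var x, y := Var y)) (fv \<phi>) - {x, y} = captured \<theta> (fv \<phi> - {x, y})"
    using x y by (auto simp: captured_def split: if_splits)
  then have fv: "captured \<sigma> (fv (subst (\<theta>(x := Var x, y := Var y)) \<phi>) - {x, y})
      = captured (\<lambda>u. subst_tm \<sigma> (\<theta> u)) (fv \<phi> - {x, y})"
    by (simp add: fv_subst captured_captured)
  have *: "subst (\<sigma>(x := Var x', y := Var y')) (subst (\<theta>(x := Var x, y := Var y)) \<phi>)
      = subst ((\<lambda>u. subst_tm \<sigma> (\<theta> u))(x := Var x', y := Var y')) \<phi>" for x' y'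
  proof -
    have "subst (\<sigma>(x := Var x', y := Var y')) (subst (\<theta>(x := Var x, y := Var y)) \<phi>)
        = subst (\<lambda>u. subst_tm (\<sigma>(x := Var x', y := Var y')) ((\<theta>(x := Var x, y := Var y)) u)) \<phi>"
      by (rule RTC.IH) (use RTC.prems in auto)
    also have "\<dots> = subst ((\<lambda>u. subst_tm \<sigma> (\<theta> u))(x := Var x', y := Var y')) \<phi>"
      using notin_captured[OF x] notin_captured[OF y]
      by (intro subst_cong) (auto intro!: subst_tm_cong)
    finally show ?thesis .
  qed
  show ?case
    by (simp add: Let_def pick_same[OF x] pick_same[OF y] fv * subst_tm_subst_tm)
next
  case (Neg \<phi>) then show ?case by simp
next
  case (Conj \<phi> \<psi>)
  have "\<theta> u = Var u \<or> fv_tm (\<theta> u) \<inter> bv \<phi> = {}" if "u \<in> fv \<phi>" for u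
    using Conj.prems[of u] that by auto
  moreover have "\<theta> u = Var u \<or> fv_tm (\<theta> u) \<inter> bv \<psi> = {}" if "u \<in> fv \<psi>" for u
    using Conj.prems[of u] that by auto
  ultimately show ?case by (simp add: Conj.IH)
next
  case (Disj \<phi> \<psi>)
  have "\<theta> u = Var u \<or> fv_tm (\<theta> u) \<inter> bv \<phi> = {}" if "u \<in> fv \<phi>" for u
    using Disj.prems[of u] that by auto
  moreover have "\<theta> u = Var u \<or> fv_tm (\<theta> u) \<inter> bv \<psi> = {}" if "u \<in> fv \<psi>" for u
    using Disj.prems[of u] that by auto
  ultimately show ?case by (simp add: Disj.IH)
next
  case (Imp \<phi> \<psi>)
  have "\<theta> u = Var u \<or> fv_tm (\<theta> u) \<inter> bv \<phi> = {}" if "u \<in> fv \<phi>" for u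
    using Imp.prems[of u] that by auto
  moreover have "\<theta> u = Var u \<or> fv_tm (\<theta> u) \<inter> bv \<psi> = {}" if "u \<in> fv \<psi>" for u
    using Imp.prems[of u] that by auto
  ultimately show ?case by (simp add: Imp.IH)
qed (simp_all add: subst_tm_subst_tm)

section \<open>Semantics\<close>

text \<open>Renaming the two bound variables of \<open>RTC\<close> is invisible semantically: the
  new names do not occur in the terms substituted for the other variables. Shared by the
  substitution lemmas for truth and for the step relation.\<close>

lemma tm_val_rename_pair:
  assumes "C = captured \<theta> (V - {x, y})" "finite V" "x' = pick x {y} C" "y' = pick y {x'} C" "u \<in> V"
  shows "tm_val M (v(x' := a, y' := b)) ((\<theta>(x := Var x', y := Var y')) u)
    = ((\<lambda>u. tm_val M v (\<theta> u))(x := a, y := b)) u"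
proof -
  have "finite C" using assms by simp
  note pp = pick_pair[OF this assms(3,4)]
  consider "u = y" | "u = x" "u \<noteq> y" | "u \<noteq> x" "u \<noteq> y" by blast
  then show ?thesis
  proof cases
    case 3
    then have "x' \<notin> fv_tm (\<theta> u)" "y' \<notin> fv_tm (\<theta> u)"
      using pp(1,2) assms(5) unfolding assms(1) by (auto dest: notin_captured[where u = u])
    with 3 show ?thesis by (auto intro!: tm_val_cong)
  qed (use pp in auto)
qed

lemma hsat_cong: "(\<And>u. u \<in> fv \<phi> \<Longrightarrow> v u = w u) \<Longrightarrow> hsat F v \<phi> = hsat F w \<phi>"
proof (induction \<phi> arbitrary: v w)
  case (Eq s t)
  then have "tm_val (fst F) v s = tm_val (fst F) w s" "tm_val (fst F) v t = tm_val (fst F) w t"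
    by (auto intro!: tm_val_cong)
  then show ?case by simp
next
  case (Pred P ts)
  then have "map (tm_val (fst F) v) ts = map (tm_val (fst F) w) ts"
    by (intro map_cong refl tm_val_cong) auto
  then show ?case by (simp only: hsat.simps)
next
  case (Neg \<phi>)
  have "hsat F v \<phi> = hsat F w \<phi>"
    by (rule Neg.IH) (use Neg.prems in simp)
  then show ?case by simp
next
  case (Conj \<phi> \<psi>)
  have "hsat F v \<phi> = hsat F w \<phi>" "hsat F v \<psi> = hsat F w \<psi>"
    by (rule Conj.IH; use Conj.prems in simp)+
  then show ?case by simp
next
  case (Disj \<phi> \<psi>)
  have "hsat F v \<phi> = hsat F w \<phi>" "hsat F v \<psi> = hsat F w \<psi>"
    by (rule Disj.IH; use Disj.prems in simp)+
  then show ?case by simp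
next
  case (Imp \<phi> \<psi>)
  have "hsat F v \<phi> = hsat F w \<phi>" "hsat F v \<psi> = hsat F w \<psi>"
    by (rule Imp.IH; use Imp.prems in simp)+
  then show ?case by simp
next
  case (All x \<phi>)
  have "hsat F (v(x := a)) \<phi> = hsat F (w(x := a)) \<phi>" for a
    by (rule All.IH) (use All.prems in auto)
  then show ?case by simp
next
  case (Ex x \<phi>)
  have "hsat F (v(x := a)) \<phi> = hsat F (w(x := a)) \<phi>" for a
    by (rule Ex.IH) (use Ex.prems in auto)
  then show ?case by simp
next
  case (RTC x y \<phi> s t)
  have "hsat F (v(x := a, y := b)) \<phi> = hsat F (w(x := a, y := b)) \<phi>" for a b
    by (rule RTC.IH) (use RTC.prems in auto)
  moreover have "tm_val (fst F) v s = tm_val (fst F) w s" "tm_val (fst F) v t = tm_val (fst F) w t"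
    using RTC.prems by (auto intro!: tm_val_cong)
  ultimately show ?case by simp
qed

lemma hsat_subst: "hsat F v (subst \<theta> \<phi>) = hsat F (\<lambda>u. tm_val (fst F) v (\<theta> u)) \<phi>"
proof (induction \<phi> arbitrary: v \<theta>)
  case (Pred P ts)
  have "map (tm_val (fst F) v \<circ> subst_tm \<theta>) ts = map (tm_val (fst F) (\<lambda>u. tm_val (fst F) v (\<theta> u))) ts"
    by (simp add: tm_val_subst)
  then show ?case by (simp only: hsat.simps subst.simps map_map)
next
  case (All x \<phi>)
  define x' where "x' = pick x {} (captured \<theta> (fv \<phi> - {x}))"
  then have x': "x' \<notin> captured \<theta> (fv \<phi> - {x})"
    by (simp add: pick_notin_right)
  have "hsat F (v(x' := a)) (subst (\<theta>(x := Var x')) \<phi>)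
      = hsat F ((\<lambda>u. tm_val (fst F) v (\<theta> u))(x := a)) \<phi>" for a
    unfolding All.IH using notin_captured[OF x'] by (intro hsat_cong) (auto intro!: tm_val_cong)
  then show ?case by (simp add: Let_def x'_def[symmetric])
next
  case (Ex x \<phi>)
  define x' where "x' = pick x {} (captured \<theta> (fv \<phi> - {x}))"
  then have x': "x' \<notin> captured \<theta> (fv \<phi> - {x})"
    by (simp add: pick_notin_right)
  have "hsat F (v(x' := a)) (subst (\<theta>(x := Var x')) \<phi>)
      = hsat F ((\<lambda>u. tm_val (fst F) v (\<theta> u))(x := a)) \<phi>" for a
    unfolding Ex.IH using notin_captured[OF x'] by (intro hsat_cong) (auto intro!: tm_val_cong)
  then show ?case by (simp add: Let_def x'_def[symmetric])
next
  case (RTC x y \<phi> s t)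
  define C where "C = captured \<theta> (fv \<phi> - {x, y})"
  define x' where "x' = pick x {y} C"
  define y' where "y' = pick y {x'} C"
  have "hsat F (v(x' := a, y' := b)) (subst (\<theta>(x := Var x', y := Var y')) \<phi>)
      = hsat F ((\<lambda>u. tm_val (fst F) v (\<theta> u))(x := a, y := b)) \<phi>" for a b
    unfolding RTC.IH by (rule hsat_cong) (rule tm_val_rename_pair[OF C_def _ x'_def y'_def], simp)
  then show ?case
    by (simp add: Let_def C_def[symmetric] x'_def[symmetric] y'_def[symmetric] tm_val_subst)
qed (simp_all add: tm_val_subst)

section \<open>The relation defined by an \<open>RTC\<close> body, and the two semantics of
  \<open>RTC\<close>\<close>

definition step :: "('d, 'f, 'p) frame \<Rightarrow> (var \<Rightarrow> 'd) \<Rightarrow> var \<Rightarrow> var \<Rightarrow> ('f, 'p) fm \<Rightarrow> ('d \<times> 'd) set" where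
  "step F v x y \<phi> = {(a, b). a \<in> univ (fst F) \<and> b \<in> univ (fst F) \<and> hsat F (v(x := a, y := b)) \<phi>}"

lemma step_cong:
  assumes "\<And>u. u \<in> fv \<phi> - {x, y} \<Longrightarrow> v u = w u"
  shows "step F v x y \<phi> = step F w x y \<phi>"
proof -
  have "hsat F (v(x := a, y := b)) \<phi> = hsat F (w(x := a, y := b)) \<phi>" for a b
    by (rule hsat_cong) (use assms in auto)
  then show ?thesis by (simp add: step_def)
qed

lemma step_subst:
  assumes "C = captured \<theta> (fv \<phi> - {x, y})" "x' = pick x {y} C" "y' = pick y {x'} C"
  shows "step F v x' y' (subst (\<theta>(x := Var x', y := Var y')) \<phi>)
    = step F (\<lambda>u. tm_val (fst F) v (\<theta> u)) x y \<phi>"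
proof -
  have "hsat F (v(x' := a, y' := b)) (subst (\<theta>(x := Var x', y := Var y')) \<phi>)
      = hsat F ((\<lambda>u. tm_val (fst F) v (\<theta> u))(x := a, y := b)) \<phi>" for a b
    unfolding hsat_subst
    by (rule hsat_cong) (rule tm_val_rename_pair[OF assms(1) _ assms(2,3)], simp)
  then show ?thesis by (simp add: step_def)
qed

lemma closed_under_iff_Image:
  assumes "A \<subseteq> U"
  shows "(\<forall>a \<in> U. \<forall>b \<in> U. a \<in> A \<and> P a b \<longrightarrow> b \<in> A)
    \<longleftrightarrow> {(a, b). a \<in> U \<and> b \<in> U \<and> P a b} `` A \<subseteq> A"
  using assms by auto

lemma hsat_RTC_step:
  "hsat F v (RTC x y \<phi> s t) \<longleftrightarrow>
    (\<forall>A \<in> snd F. tm_val (fst F) v s \<in> A \<and> step F v x y \<phi> `` A \<subseteq> A \<longrightarrow> tm_val (fst F) v t \<in> A)"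
  if "\<And>A. A \<in> snd F \<Longrightarrow> A \<subseteq> univ (fst F)"
proof -
  have "(\<forall>a \<in> univ (fst F). \<forall>b \<in> univ (fst F). a \<in> A \<and> hsat F (v(x := a, y := b)) \<phi> \<longrightarrow> b \<in> A)
      \<longleftrightarrow> step F v x y \<phi> `` A \<subseteq> A" if "A \<subseteq> univ (fst F)" for A
    unfolding step_def
    by (rule closed_under_iff_Image[OF that, where P = "\<lambda>a b. hsat F (v(x := a, y := b)) \<phi>"])
  then show ?thesis
    unfolding hsat.simps using that by metis
qed

lemma tm_val_univ:
  assumes "fo_struct S M" "v \<in> valuations M" "wf_tm S t"
  shows "tm_val M v t \<in> univ M"
  using assms(3)
proof (induction t)
  case (Var x)
  then show ?case using assms(2) by (simp add: valuations_def)
next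
  case (Fun f ts)
  then have "set (map (tm_val M v) ts) \<subseteq> univ M" by (auto simp: list_all_iff)
  then show ?case using Fun.prems assms(1) by (auto simp: fo_struct_def)
qed

lemma valuations_upd: "v \<in> valuations M \<Longrightarrow> a \<in> univ M \<Longrightarrow> v(x := a) \<in> valuations M"
  by (simp add: valuations_def)

text \<open>With all subsets present, the set of elements reachable from the value of
  \<open>s\<close> is itself a test set. It is the least closed one, so the Henkin clause says
  exactly that the value of \<open>t\<close> is reachable.\<close>

lemma hsat_full_RTC:
  assumes "tm_val M v s \<in> univ M"
  shows "hsat (M, Pow (univ M)) v (RTC x y \<phi> s t) \<longleftrightarrow>
    (tm_val M v s, tm_val M v t) \<in> (step (M, Pow (univ M)) v x y \<phi>)\<^sup>*" (is "?l \<longleftrightarrow> (?a, ?b) \<in> ?R\<^sup>*")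
proof -
  have iff: "?l \<longleftrightarrow> (\<forall>A \<subseteq> univ M. ?a \<in> A \<and> ?R `` A \<subseteq> A \<longrightarrow> ?b \<in> A)"
    using hsat_RTC_step[where F = "(M, Pow (univ M))" and v = v and x = x and y = y and \<phi> = \<phi>
        and s = s and t = t]
    by (simp only: fst_conv snd_conv Pow_iff Ball_def)
  show ?thesis
  proof
    assume ?l
    have "?R\<^sup>* `` {?a} \<subseteq> univ M"
      using assms by (auto simp: step_def elim: rtranclE)
    moreover have "?R `` (?R\<^sup>* `` {?a}) \<subseteq> ?R\<^sup>* `` {?a}"
      by (auto intro: rtrancl_into_rtrancl)
    ultimately have "?b \<in> ?R\<^sup>* `` {?a}"
      using \<open>?l\<close> unfolding iff by blast
    then show "(?a, ?b) \<in> ?R\<^sup>*" by simp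
  next
    assume *: "(?a, ?b) \<in> ?R\<^sup>*"
    have "?b \<in> A" if "?a \<in> A" "?R `` A \<subseteq> A" for A
      using * that by (induction rule: rtrancl_induct) auto
    then show ?l unfolding iff by blast
  qed
qed

text \<open>Standard semantics is Henkin semantics over the full frame. Soundness and the truth
  lemma can thus be carried out for \<open>hsat\<close> alone.\<close>

lemma sat_eq_hsat:
  fixes M :: "('d, 'f, 'p) struct"
  assumes "fo_struct S M" "v \<in> valuations M" "wf_fm S \<phi>"
  shows "sat M v \<phi> = hsat (M, Pow (univ M)) v \<phi>"
  using assms(2,3)
proof (induction \<phi> arbitrary: v)
  case (RTC x y \<phi> s t)
  let ?R = "step (M, Pow (univ M)) v x y \<phi>"
  have s: "tm_val M v s \<in> univ M"
    using assms(1) RTC.prems by (auto intro: tm_val_univ)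
  have "sat M (v(x := a, y := b)) \<phi> = hsat (M, Pow (univ M)) (v(x := a, y := b)) \<phi>"
    if "a \<in> univ M" "b \<in> univ M" for a b
    by (rule RTC.IH) (use that RTC.prems in \<open>simp_all add: valuations_def\<close>)
  then have R: "(a, b) \<in> ?R \<longleftrightarrow> a \<in> univ M \<and> b \<in> univ M \<and> sat M (v(x := a, y := b)) \<phi>" for a b
    by (auto simp: step_def)
  \<comment> \<open>Relational power 0 accounts for the disjunct of \<open>sat\<close> that equates
    the endpoints, since its path clause demands \<open>n > 0\<close>.\<close>
  have "sat M v (RTC x y \<phi> s t) \<longleftrightarrow> (\<exists>n. (tm_val M v s, tm_val M v t) \<in> ?R ^^ n)"
  proof
    assume "sat M v (RTC x y \<phi> s t)"
    then have "tm_val M v s = tm_val M v t \<or> (\<exists>n > 0. \<exists>a :: nat \<Rightarrow> 'd. (\<forall>i \<le> n. a i \<in> univ M) \<and>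
        a 0 = tm_val M v s \<and> a n = tm_val M v t \<and>
        (\<forall>i < n. sat M (v(x := a i, y := a (Suc i))) \<phi>))"
      by (simp only: sat.simps)
    then show "\<exists>n. (tm_val M v s, tm_val M v t) \<in> ?R ^^ n"
    proof (elim disjE exE conjE)
      assume "tm_val M v s = tm_val M v t"
      then have "(tm_val M v s, tm_val M v t) \<in> ?R ^^ 0" by simp
      then show ?thesis by blast
    next
      fix n a
      assume "\<forall>i \<le> n. a i \<in> univ M" "a 0 = tm_val M v s" "a n = tm_val M v t"
        "\<forall>i < n. sat M (v(x := a i, y := a (Suc i))) \<phi>"
      then have "(tm_val M v s, tm_val M v t) \<in> ?R ^^ n"
        unfolding relpow_fun_conv R by (intro exI[of _ a]) auto
      then show ?thesis by blast
    qed
  next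
    assume "\<exists>n. (tm_val M v s, tm_val M v t) \<in> ?R ^^ n"
    then obtain n f where f: "f 0 = tm_val M v s" "f n = tm_val M v t"
      "\<And>i. i < n \<Longrightarrow> (f i, f (Suc i)) \<in> ?R"
      unfolding relpow_fun_conv by blast
    show "sat M v (RTC x y \<phi> s t)"
    proof (cases n)
      case 0
      then show ?thesis using f by simp
    next
      case (Suc m)
      have "f i \<in> univ M" if "i \<le> n" for i
        using that f(3) s f(1) by (cases i) (auto simp: R)
      then show ?thesis
        unfolding sat.simps using f Suc R by (intro disjI2 exI[of _ n] conjI exI[of _ f]) auto
    qed
  qed
  then show ?case
    unfolding hsat_full_RTC[OF s] rtrancl_is_UN_relpow by simp
next
  case (All x \<phi>)
  then have "sat M (v(x := a)) \<phi> = hsat (M, Pow (univ M)) (v(x := a)) \<phi>" if "a \<in> univ M" for a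
    using that by (intro All.IH valuations_upd) auto
  then show ?case by simp
next
  case (Ex x \<phi>)
  then have "sat M (v(x := a)) \<phi> = hsat (M, Pow (univ M)) (v(x := a)) \<phi>" if "a \<in> univ M" for a
    using that by (intro Ex.IH valuations_upd) auto
  then show ?case by simp
next
  case (Neg \<phi>)
  then show ?case by simp
next
  case (Conj \<phi> \<psi>)
  then show ?case by simp
next
  case (Disj \<phi> \<psi>)
  then show ?case by simp
next
  case (Imp \<phi> \<psi>)
  then show ?case by simp
qed simp_all

section \<open>Soundness\<close>

declare hsat.simps(9) [simp del]

definition falsifies :: "('d, 'f, 'p) frame \<Rightarrow> (var \<Rightarrow> 'd) \<Rightarrow> ('f, 'p) seq \<Rightarrow> bool" where
  "falsifies F v \<sigma> \<longleftrightarrow> v \<in> valuations (fst F) \<and>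
    (\<forall>\<phi>. \<phi> |\<in>| fst \<sigma> \<longrightarrow> hsat F v \<phi>) \<and> (\<forall>\<phi>. \<phi> |\<in>| snd \<sigma> \<longrightarrow> \<not> hsat F v \<phi>)"

lemma hvalid_in_iff: "hvalid_in K \<sigma> \<longleftrightarrow> (\<forall>F \<in> K. \<forall>v. \<not> falsifies F v \<sigma>)"
  unfolding hvalid_in_def falsifies_def by blast

lemma falsifies_finsert [simp]:
  "falsifies F v (finsert \<phi> \<Gamma>, \<Delta>) \<longleftrightarrow> hsat F v \<phi> \<and> falsifies F v (\<Gamma>, \<Delta>)"
  "falsifies F v (\<Gamma>, finsert \<phi> \<Delta>) \<longleftrightarrow> \<not> hsat F v \<phi> \<and> falsifies F v (\<Gamma>, \<Delta>)"
  by (auto simp: falsifies_def)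

lemma falsifies_cong:
  assumes "falsifies F v (\<Gamma>, \<Delta>)" "w \<in> valuations (fst F)"
    and "\<And>u. u \<in> fv_set \<Gamma> \<union> fv_set \<Delta> \<Longrightarrow> v u = w u"
  shows "falsifies F w (\<Gamma>, \<Delta>)"
proof -
  have "hsat F v \<phi> = hsat F w \<phi>" if "\<phi> |\<in>| \<Gamma> \<or> \<phi> |\<in>| \<Delta>" for \<phi>
    using that assms(3) by (intro hsat_cong) (auto dest: fv_subset_fv_set)
  then show ?thesis using assms(1,2) by (simp add: falsifies_def)
qed

lemma hsat_subst1:
  "hsat F v (subst (Var(x := t)) \<phi>) = hsat F (v(x := tm_val (fst F) v t)) \<phi>"
  unfolding hsat_subst by (rule hsat_cong) simp

lemma hsat_subst2:
  "hsat F v (subst (Var(x := s, y := t)) \<phi>)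
    = hsat F (v(x := tm_val (fst F) v s, y := tm_val (fst F) v t)) \<phi>"
  unfolding hsat_subst by (rule hsat_cong) simp

text \<open>Traces decrease the length of a shortest path witnessing an \<open>RTC\<close> formula. The value is junk if
  there is no such path.\<close>

fun rank :: "('d, 'f, 'p) frame \<Rightarrow> (var \<Rightarrow> 'd) \<Rightarrow> ('f, 'p) fm \<Rightarrow> nat" where
  "rank F v (RTC x y \<phi> s t) =
    (LEAST n. (tm_val (fst F) v s, tm_val (fst F) v t) \<in> step F v x y \<phi> ^^ n)"
| "rank F v _ = 0"

lemma rank_cong: "(\<And>u. u \<in> fv \<tau> \<Longrightarrow> v u = w u) \<Longrightarrow> rank F v \<tau> = rank F w \<tau>"
proof (cases \<tau>)
  case (RTC x y \<phi> s t)
  assume *: "\<And>u. u \<in> fv \<tau> \<Longrightarrow> v u = w u"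
  have "step F v x y \<phi> = step F w x y \<phi>"
    using * RTC by (intro step_cong) auto
  moreover have "tm_val (fst F) v s = tm_val (fst F) w s" "tm_val (fst F) v t = tm_val (fst F) w t"
    using * RTC by (auto intro!: tm_val_cong)
  ultimately show ?thesis by (simp add: RTC)
qed simp_all

text \<open>This carries traces across (Subst): the premise is evaluated at the substituted
  valuation, where the traced formula has the rank of its instance in the conclusion.\<close>

lemma rank_subst: "rank F v (subst \<theta> \<tau>) = rank F (\<lambda>u. tm_val (fst F) v (\<theta> u)) \<tau>"
  by (cases \<tau>) (simp_all add: Let_def tm_val_subst step_subst del: fun_upd_apply)

text \<open>Local soundness with rank control. One premise and one valuation must serve all trace
  pairs at once, because the path through a proof is built before any trace along it is
  known.\<close>

definition descends :: "('d, 'f, 'p) frame \<Rightarrow> (var \<Rightarrow> 'd) \<Rightarrow> ('f, 'p) inferences" where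
  "descends F v r \<Sigma> \<sigma> \<longleftrightarrow> (\<exists>i < length \<Sigma>. \<exists>w. falsifies F w (\<Sigma> ! i) \<and>
    (\<forall>\<tau> \<tau>'. \<tau> |\<in>| fst \<sigma> \<and> trace_pair r i \<tau> \<tau>' \<longrightarrow> rank F w \<tau>' \<le> rank F v \<tau> \<and>
      (progress_pair r i \<tau> \<tau>' \<longrightarrow> rank F w \<tau>' < rank F v \<tau>)))"

text \<open>Across a \<open>Plain\<close> inference a traced formula is merely repeated, so
  agreement of the valuations on the antecedent of the conclusion keeps its rank.\<close>

lemma descends_PlainI:
  assumes "\<sigma>' \<in> set \<Sigma>" "falsifies F w \<sigma>'" "\<And>u. u \<in> fv_set (fst \<sigma>) \<Longrightarrow> w u = v u"
  shows "descends F v Plain \<Sigma> \<sigma>"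
proof -
  obtain i where i: "i < length \<Sigma>" "\<Sigma> ! i = \<sigma>'"
    using assms(1) by (auto simp: in_set_conv_nth)
  have "rank F w \<tau> = rank F v \<tau>" if "\<tau> |\<in>| fst \<sigma>" for \<tau>
    using assms(3) fv_subset_fv_set[OF that] by (intro rank_cong) auto
  then show ?thesis
    unfolding descends_def using i assms(2) by (intro exI[of _ i] conjI exI[of _ w]) auto
qed

lemma descends_falsifies: "descends F v r \<Sigma> \<sigma> \<Longrightarrow> \<exists>\<sigma>' \<in> set \<Sigma>. \<exists>w. falsifies F w \<sigma>'"
  unfolding descends_def using nth_mem by blast

lemma descends_same: "(\<exists>\<sigma>' \<in> set \<Sigma>. falsifies F v \<sigma>') \<Longrightarrow> descends F v Plain \<Sigma> \<sigma>"
  by (auto intro: descends_PlainI)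

lemma fst_falsifiesD: "falsifies F v \<sigma> \<Longrightarrow> v \<in> valuations (fst F)"
  by (simp add: falsifies_def)

lemma hsat_fresh:
  assumes "z \<notin> fv \<phi> - {x}"
  shows "hsat F (v(z := a)) (subst (Var(x := Var z)) \<phi>) = hsat F (v(x := a)) \<phi>"
  unfolding hsat_subst1 using assms by (intro hsat_cong) auto

text \<open>Only the eigenvariable rules and (Subst) change the valuation. An eigenvariable is not
  free in the antecedent of the conclusion, so ranks are unaffected there; (Subst) is covered by
  \<open>rank_subst\<close>.\<close>

lemma lk_descends:
  assumes "lk_rule S r \<Sigma> \<sigma>" "fo_struct S (fst F)" "falsifies F v \<sigma>"
  shows "descends F v r \<Sigma> \<sigma>"
  using assms(1)
proof cases
  case (AllL t x \<phi> \<Gamma> \<Delta>)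
  have "tm_val (fst F) v t \<in> univ (fst F)"
    using AllL assms fst_falsifiesD tm_val_univ by blast
  then show ?thesis
    using AllL assms(3) by (auto simp: hsat_subst1 intro!: descends_same)
next
  case (ExR t \<Gamma> x \<phi> \<Delta>)
  have "tm_val (fst F) v t \<in> univ (fst F)"
    using ExR assms fst_falsifiesD tm_val_univ by blast
  then show ?thesis
    using ExR assms(3) by (auto simp: hsat_subst1 intro!: descends_same)
next
  case (AllR z \<Gamma> \<Delta> x \<phi>)
  then obtain a where a: "a \<in> univ (fst F)" "\<not> hsat F (v(x := a)) \<phi>" "falsifies F v (\<Gamma>, \<Delta>)"
    using assms(3) by auto
  have "falsifies F (v(z := a)) (\<Gamma>, \<Delta>)"
    by (rule falsifies_cong[OF a(3) valuations_upd[OF fst_falsifiesD[OF assms(3)] a(1)]])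
      (use AllR in auto)
  moreover have "\<not> hsat F (v(z := a)) (subst (Var(x := Var z)) \<phi>)"
    using a AllR by (subst hsat_fresh) auto
  ultimately show ?thesis
    unfolding AllR(1) using AllR
    by (intro descends_PlainI[where w = "v(z := a)"
          and \<sigma>' = "(\<Gamma>, finsert (subst (Var(x := Var z)) \<phi>) \<Delta>)"]) auto
next
  case (ExL z \<Gamma> \<Delta> x \<phi>)
  then obtain a where a: "a \<in> univ (fst F)" "hsat F (v(x := a)) \<phi>" "falsifies F v (\<Gamma>, \<Delta>)"
    using assms(3) by auto
  have "falsifies F (v(z := a)) (\<Gamma>, \<Delta>)"
    by (rule falsifies_cong[OF a(3) valuations_upd[OF fst_falsifiesD[OF assms(3)] a(1)]])
      (use ExL in auto)
  moreover have "hsat F (v(z := a)) (subst (Var(x := Var z)) \<phi>)"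
    using a ExL by (subst hsat_fresh) auto
  ultimately show ?thesis
    unfolding ExL(1) using ExL
    by (intro descends_PlainI[where w = "v(z := a)"
          and \<sigma>' = "(finsert (subst (Var(x := Var z)) \<phi>) \<Gamma>, \<Delta>)"]) auto
next
  case (Subst \<theta> \<Gamma> \<Delta>)
  let ?w = "\<lambda>u. tm_val (fst F) v (\<theta> u)"
  have "?w \<in> valuations (fst F)"
    using Subst tm_val_univ[OF assms(2) fst_falsifiesD[OF assms(3)]] by (simp add: valuations_def)
  then have "falsifies F ?w (\<Gamma>, \<Delta>)"
    using assms(3) Subst by (auto simp: falsifies_def hsat_subst)
  then show ?thesis
    using Subst by (auto simp: descends_def rank_subst intro!: exI[of _ ?w])
qed (use assms(3) in \<open>auto simp: hsat_subst1 intro!: descends_same\<close>)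

text \<open>(Trans) is sound in every frame: a closed set containing the value of \<open>s\<close>
  contains that of \<open>r\<close> by the first premise, hence that of \<open>t\<close> by the
  second. Closure is tested on domain elements only, which is why \<open>r\<close> must be well
  formed; this is read off the premise.\<close>

lemma rtc_rule_descends:
  assumes "rtc_rule r \<Sigma> \<sigma>" "wf_seq S \<sigma>" "fo_struct S (fst F)" "snd F \<subseteq> Pow (univ (fst F))"
    "falsifies F v \<sigma>"
    "\<And>\<sigma>'. \<sigma>' \<in> set \<Sigma> \<Longrightarrow> wf_seq S \<sigma>'"
  shows "descends F v r \<Sigma> \<sigma>"
  using assms(1)
proof cases
  case (Refl \<Gamma> x y \<phi> s \<Delta>)
  then show ?thesis using assms(5) by (simp add: hsat.simps(9))
next
  case (Trans \<Gamma> x y \<phi> s r \<Delta> t)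
  have "wf_tm S r" "wf_tm S t"
    using Trans assms(2) assms(6)[of "(\<Gamma>, finsert (RTC x y \<phi> s r) \<Delta>)"] by (auto simp: wf_seq_def)
  then have u: "tm_val (fst F) v r \<in> univ (fst F)" "tm_val (fst F) v t \<in> univ (fst F)"
    using tm_val_univ[OF assms(3) fst_falsifiesD[OF assms(5)]] by auto
  have "\<not> hsat F v (RTC x y \<phi> s r) \<or> \<not> hsat F v (subst (Var(x := r, y := t)) \<phi>)"
  proof (rule ccontr)
    assume "\<not> ?thesis"
    then have *: "hsat F v (RTC x y \<phi> s r)" "hsat F v (subst (Var(x := r, y := t)) \<phi>)" by auto
    have "hsat F v (RTC x y \<phi> s t)"
      unfolding hsat.simps
    proof (intro ballI impI)
      fix A assume A: "A \<in> snd F" "tm_val (fst F) v s \<in> A \<and> (\<forall>a \<in> univ (fst F). \<forall>b \<in> univ (fst F).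
           a \<in> A \<and> hsat F (v(x := a, y := b)) \<phi> \<longrightarrow> b \<in> A)"
      have "tm_val (fst F) v r \<in> A"
        using bspec[OF *(1)[unfolded hsat.simps] A(1)] A(2) by (rule mp)
      moreover have "hsat F (v(x := tm_val (fst F) v r, y := tm_val (fst F) v t)) \<phi>"
        using *(2) by (simp only: hsat_subst2)
      ultimately show "tm_val (fst F) v t \<in> A"
        by (intro A(2)[THEN conjunct2, rule_format, OF u] conjI)
    qed
    then show False using assms(5) Trans by simp
  qed
  then show ?thesis
    using Trans assms(5) by (auto intro!: descends_same)
qed

lemma pair_rule_descends:
  assumes "pair_rule c pr r \<Sigma> \<sigma>" "admissible c pr (fst F)" "falsifies F v \<sigma>"
  shows "descends F v r \<Sigma> \<sigma>"
proof -
  have "v u \<in> univ (fst F)" for u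
    using assms(3) by (simp add: falsifies_def valuations_def)
  then have adm: "fun_int (fst F) pr [v x, v y] = fun_int (fst F) pr [v u, v w] \<Longrightarrow> v x = v u \<and> v y = v w"
    and adm': "fun_int (fst F) pr [v x, v y] \<noteq> fun_int (fst F) c []" for x y u w
    using assms(2) unfolding admissible_def by blast+
  from assms(1) show ?thesis
    by cases (use assms(3) adm' in \<open>auto intro!: descends_same dest: adm\<close>)
qed

text \<open>Comprehension puts the set defined by \<open>\<psi>\<close> into the second-order part.
  It contains the value of \<open>s\<close> but not that of \<open>t\<close>, so it is not closed
  under \<open>\<phi>\<close>, and a pair \<open>a\<close>, \<open>b\<close> leaving it falsifies
  the premise. Ranks are irrelevant here, as finite proofs carry no trace condition.\<close>

lemma ind_rule_falsifies:
  assumes "ind_rule r \<Sigma> \<sigma>" "wf_seq S \<sigma>" "henkin_struct S F" "falsifies F v \<sigma>"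
    "\<And>\<sigma>'. \<sigma>' \<in> set \<Sigma> \<Longrightarrow> wf_seq S \<sigma>'"
  shows "\<exists>\<sigma>' \<in> set \<Sigma>. \<exists>w. falsifies F w \<sigma>'"
  using assms(1)
proof cases
  case (Ind x \<Gamma> \<Delta> y \<psi> \<phi> s t)
  define A where "A = {a \<in> univ (fst F). hsat F (v(x := a)) \<psi>}"
  have fo: "fo_struct S (fst F)" and v: "v \<in> valuations (fst F)"
    using assms by (auto simp: henkin_struct_def falsifies_def)
  have "wf_fm S \<psi>" using assms(5) Ind by (auto simp: wf_seq_def)
  then have A: "A \<in> snd F" using assms(3) v by (auto simp: henkin_struct_def A_def)
  have wf: "x \<noteq> y" "wf_tm S s" "wf_tm S t" using assms(2) Ind by (auto simp: wf_seq_def)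
  then have u: "tm_val (fst F) v s \<in> univ (fst F)" "tm_val (fst F) v t \<in> univ (fst F)"
    using tm_val_univ[OF fo v] by auto
  have f: "tm_val (fst F) v s \<in> A" "tm_val (fst F) v t \<notin> A" "hsat F v (RTC x y \<phi> s t)"
    "falsifies F v (\<Gamma>, \<Delta>)"
    using u assms(4) unfolding Ind(3) by (auto simp: A_def hsat_subst1)
  then obtain a b where ab: "a \<in> univ (fst F)" "b \<in> univ (fst F)" "a \<in> A" "b \<notin> A"
    "hsat F (v(x := a, y := b)) \<phi>"
    using A unfolding hsat.simps by blast
  let ?w = "v(x := a, y := b)"
  have "falsifies F ?w (\<Gamma>, \<Delta>)"
    using Ind ab v by (intro falsifies_cong[OF f(4)]) (auto intro!: valuations_upd)
  moreover have "hsat F ?w \<psi>"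
  proof -
    have "hsat F ?w \<psi> = hsat F (v(x := a)) \<psi>" using Ind by (intro hsat_cong) auto
    then show ?thesis using ab by (simp add: A_def)
  qed
  moreover have "\<not> hsat F ?w (subst (Var(x := Var y)) \<psi>)"
  proof -
    have "hsat F ?w (subst (Var(x := Var y)) \<psi>) = hsat F (v(x := b)) \<psi>"
      unfolding hsat_subst1 using Ind wf(1) by (intro hsat_cong) auto
    then show ?thesis using ab by (simp add: A_def)
  qed
  ultimately show ?thesis using Ind ab(5) by auto
qed

text \<open>The full frame provides a finite path; take a shortest one. Length 0 falsifies the first
  premise. Otherwise the last edge is split off: its source is assigned to \<open>z\<close>, and the
  rest of the path witnesses the ancestor with a smaller rank.\<close>

lemma case_rule_descends:
  assumes "case_rule r \<Sigma> \<sigma>" "wf_seq S \<sigma>" "fo_struct S M" "falsifies (M, Pow (univ M)) v \<sigma>"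
  shows "descends (M, Pow (univ M)) v r \<Sigma> \<sigma>"
  using assms(1)
proof cases
  case (Case z \<Gamma> \<Delta> x y \<phi> s t)
  let ?F = "(M, Pow (univ M))"
  let ?R = "step ?F v x y \<phi>"
  let ?a = "tm_val M v s" and ?b = "tm_val M v t"
  have v: "v \<in> valuations M" using assms(4) by (auto simp: falsifies_def)
  have "wf_tm S s" using assms(2) Case by (auto simp: wf_seq_def)
  then have s: "?a \<in> univ M" using tm_val_univ assms(3) v by blast
  have f: "falsifies ?F v (\<Gamma>, \<Delta>)" "hsat ?F v (RTC x y \<phi> s t)"
    using assms(4) unfolding Case(3) by (auto)
  define n where "n = rank ?F v (RTC x y \<phi> s t)"
  have n: "(?a, ?b) \<in> ?R ^^ n"
    using f(2) LeastI_ex[of "\<lambda>n. (?a, ?b) \<in> ?R ^^ n"]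
    unfolding hsat_full_RTC[OF s] n_def by (auto simp: rtrancl_is_UN_relpow)
  show ?thesis
  proof (cases n)
    case 0
    then have "hsat ?F v (Eq s t)" using n by simp
    then show ?thesis
      unfolding Case descends_def using f(1) by (intro exI[of _ 0] conjI exI[of _ v]) auto
  next
    case (Suc m)
    then obtain b where b: "(?a, b) \<in> ?R ^^ m" "(b, ?b) \<in> ?R" using n by auto
    then have bu: "b \<in> univ M" by (auto simp: step_def)
    let ?w = "v(z := b)"
    have st: "tm_val M ?w s = ?a" "tm_val M ?w t = ?b"
      using Case by (auto intro!: tm_val_cong)
    have R: "step ?F ?w x y \<phi> = ?R"
      using Case by (intro step_cong) auto
    have "falsifies ?F ?w (\<Gamma>, \<Delta>)"
      using Case bu v by (intro falsifies_cong[OF f(1)]) (auto intro!: valuations_upd)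
    moreover have "hsat ?F ?w (RTC x y \<phi> s (Var z))"
    proof -
      have "(?a, b) \<in> ?R\<^sup>*" using b(1) by (auto simp: rtrancl_is_UN_relpow)
      then show ?thesis
        using s st R hsat_full_RTC[where v = ?w and s = s and t = "Var z" and M = M and x = x
            and y = y and \<phi> = \<phi>] by (simp del: fun_upd_apply add: fun_upd_same)
    qed
    moreover have "hsat ?F ?w (subst (Var(x := Var z, y := t)) \<phi>)"
    proof -
      have "hsat ?F ?w (subst (Var(x := Var z, y := t)) \<phi>) = hsat ?F (v(x := b, y := ?b)) \<phi>"
        unfolding hsat_subst2 using Case st by (intro hsat_cong) auto
      then show ?thesis using b(2) by (simp add: step_def)
    qed
    moreover have "rank ?F ?w (RTC x y \<phi> s (Var z)) < n"
    proof -
      have "rank ?F ?w (RTC x y \<phi> s (Var z)) \<le> m"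
        using b(1) st R by (auto intro: Least_le)
      then show ?thesis using Suc by simp
    qed
    \<comment> \<open>Other traces may pass through this inference too; they keep their rank because
      \<open>z\<close> is fresh for the whole antecedent, principal formula included.\<close>
    moreover have "rank ?F ?w \<tau> = rank ?F v \<tau>" if "\<tau> |\<in>| finsert (RTC x y \<phi> s t) \<Gamma>" for \<tau>
      using Case fv_subset_fv_set[OF that] by (intro rank_cong) auto
    ultimately have fw: "falsifies ?F ?w (\<Sigma> ! 1)"
      and lt: "rank ?F ?w (RTC x y \<phi> s (Var z)) < rank ?F v (RTC x y \<phi> s t)"
      and same: "\<And>\<tau>. \<tau> |\<in>| fst \<sigma> \<Longrightarrow> rank ?F ?w \<tau> = rank ?F v \<tau>"
      unfolding n_def Case(2,3) by (simp_all del: rank.simps)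
    have le: "rank ?F ?w \<tau>' \<le> rank ?F v \<tau> \<and> (progress_pair r 1 \<tau> \<tau>' \<longrightarrow> rank ?F ?w \<tau>' < rank ?F v \<tau>)"
      if "\<tau> |\<in>| fst \<sigma> \<and> trace_pair r 1 \<tau> \<tau>'" for \<tau> \<tau>'
      using that same[of \<tau>] lt unfolding Case(1) by (auto simp del: rank.simps)
    have "1 < length \<Sigma>" by (simp add: Case(2))
    then show ?thesis unfolding descends_def using fw le by blast
  qed
qed

section \<open>Global soundness of the two systems\<close>

lemma fin_provable_wf: "fin_provable S R \<sigma> \<Longrightarrow> wf_seq S \<sigma>"
  by (induction rule: fin_provable.induct)

theorem fin_sound:
  fixes \<sigma> :: "('f, 'p) seq"
  assumes "fin_provable S (pair_RTC_G S c pr) \<sigma>"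
  shows "hvalid_in (admissible_henkin S c pr :: ('d, 'f, 'p) frame set) \<sigma>"
  unfolding hvalid_in_iff
proof (intro ballI allI)
  fix F :: "('d, 'f, 'p) frame" and v
  assume "F \<in> admissible_henkin S c pr"
  then have F: "henkin_struct S F" "fo_struct S (fst F)" "snd F \<subseteq> Pow (univ (fst F))"
    "admissible c pr (fst F)"
    by (auto simp: admissible_henkin_def henkin_struct_def)
  show "\<not> falsifies F v \<sigma>"
    using assms
  proof (induction arbitrary: v rule: fin_provable.induct)
    case (1 r \<Sigma> \<sigma>)
    show ?case
    proof
      assume f: "falsifies F v \<sigma>"
      have wf: "\<And>\<sigma>'. \<sigma>' \<in> set \<Sigma> \<Longrightarrow> wf_seq S \<sigma>'"
        using 1(3) by (auto dest: fin_provable_wf)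
      have "\<exists>\<sigma>' \<in> set \<Sigma>. \<exists>w. falsifies F w \<sigma>'"
        using 1(1) unfolding pair_RTC_G_def RTC_G_def sup_fun_def sup_bool_def
        using lk_descends[OF _ F(2) f] rtc_rule_descends[OF _ 1(2) F(2,3) f wf]
          ind_rule_falsifies[OF _ 1(2) F(1) f wf] pair_rule_descends[OF _ F(4) f]
        by (elim disjE) (blast dest: descends_falsifies)+
      then show False using 1 by auto
    qed
  qed
qed

lemma preproof_Node:
  assumes "preproof S R T"
  shows "R (tag_of T) (map concl (subs T)) (concl T)" "wf_seq S (concl T)"
    "\<And>T'. T' \<in> set (subs T) \<Longrightarrow> preproof S R T'"
  using assms by (auto elim: preproof.cases)

lemma no_infinite_descent:
  fixes f :: "nat \<Rightarrow> nat"
  assumes "\<And>n. n \<ge> k \<Longrightarrow> f (Suc n) \<le> f n"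
  shows "\<exists>m. \<forall>n \<ge> m. \<not> f (Suc n) < f n"
proof (rule ccontr)
  assume "\<not> ?thesis"
  then have inf: "\<And>m. \<exists>n \<ge> m. f (Suc n) < f n" by blast
  have "False" if "n \<ge> k" for n
    using that
  proof (induction "f n" arbitrary: n rule: less_induct)
    case less
    obtain n' where n': "n' \<ge> n" "f (Suc n') < f n'" using inf by blast
    have "f n' \<le> f n"
      using n'(1)
    proof (induction n' rule: dec_induct)
      case (step i)
      then show ?case using assms[of i] less.prems by simp
    qed simp
    then show ?case using less.hyps[of "Suc n'"] n' less.prems by simp
  qed
  then show False by blast
qed

lemma omega_descends:
  assumes "pair_RTC_G_omega S c pr r \<Sigma> \<sigma>" "wf_seq S \<sigma>" "\<And>\<sigma>'. \<sigma>' \<in> set \<Sigma> \<Longrightarrow> wf_seq S \<sigma>'"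
    and "fo_struct S M" "admissible c pr M" "falsifies (M, Pow (univ M)) v \<sigma>"
  shows "descends (M, Pow (univ M)) v r \<Sigma> \<sigma>"
proof -
  let ?F = "(M, Pow (univ M))"
  have F: "fo_struct S (fst ?F)" "snd ?F \<subseteq> Pow (univ (fst ?F))" "admissible c pr (fst ?F)"
    using assms by auto
  show ?thesis
    using assms(1) unfolding pair_RTC_G_omega_def RTC_G_omega_def sup_fun_def sup_bool_def
    using lk_descends[OF _ F(1) assms(6)] rtc_rule_descends[OF _ assms(2) F(1,2) assms(6,3)]
      case_rule_descends[OF _ assms(2,4,6)] pair_rule_descends[OF _ F(3) assms(6)]
    by blast
qed

theorem omega_sound:
  fixes \<sigma> :: "('f, 'p) seq"
  assumes "omega_provable S (pair_RTC_G_omega S c pr) \<sigma>"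
  shows "valid_in (admissible_standard S c pr :: ('d, 'f, 'p) struct set) \<sigma>"
proof -
  let ?R = "pair_RTC_G_omega S c pr"
  obtain T where T: "preproof S ?R T" "concl T = \<sigma>"
    and tr: "\<And>p d. inf_path T p d \<Longrightarrow> \<exists>\<tau>. inf_progressing_trace p d \<tau>"
    using assms by (auto simp: omega_provable_def)
  have "\<not> falsifies (M, Pow (univ M)) v \<sigma>"
    if M: "fo_struct S M" "admissible c pr M" for M :: "('d, 'f, 'p) struct" and v
  proof
    let ?F = "(M, Pow (univ M))"
    assume f: "falsifies ?F v \<sigma>"
    \<comment> \<open>States are subderivations paired with a valuation falsifying their
      conclusion.\<close>
    define P where "P = (\<lambda>n x. preproof S ?R (fst x) \<and> falsifies ?F (snd x) (concl (fst x)) \<and>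
      (n = (0::nat) \<longrightarrow> fst x = T))"
    define G where "G = (\<lambda>i x y. i < length (subs (fst x)) \<and> fst y = subs (fst x) ! i \<and>
      (\<forall>\<tau> \<tau>'. \<tau> |\<in>| fst (concl (fst x)) \<and> trace_pair (tag_of (fst x)) i \<tau> \<tau>' \<longrightarrow>
        rank ?F (snd y) \<tau>' \<le> rank ?F (snd x) \<tau> \<and>
        (progress_pair (tag_of (fst x)) i \<tau> \<tau>' \<longrightarrow> rank ?F (snd y) \<tau>' < rank ?F (snd x) \<tau>)))"
    have "\<exists>f. \<forall>n. P n (f n) \<and> (\<exists>i. G i (f n) (f (Suc n)))"
    proof (rule dependent_nat_choice)
      show "\<exists>x. P 0 x"
        using T f by (intro exI[of _ "(T, v)"]) (simp add: P_def)
      fix x n assume x: "P n x"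
      then have pp: "preproof S ?R (fst x)" by (simp add: P_def)
      have "\<And>\<sigma>'. \<sigma>' \<in> set (map concl (subs (fst x))) \<Longrightarrow> wf_seq S \<sigma>'"
        using preproof_Node(3)[OF pp] preproof_Node(2) by fastforce
      from omega_descends[OF preproof_Node(1,2)[OF pp] this M] x
      have "descends ?F (snd x) (tag_of (fst x)) (map concl (subs (fst x))) (concl (fst x))"
        by (simp add: P_def)
      then obtain i w where iw: "i < length (subs (fst x))" "falsifies ?F w (concl (subs (fst x) ! i))"
        "G i x (subs (fst x) ! i, w)"
        by (auto simp: descends_def G_def)
      then have "P (Suc n) (subs (fst x) ! i, w)"
        using preproof_Node(3)[OF pp] by (simp add: P_def)
      then show "\<exists>y. P (Suc n) y \<and> (\<exists>i. G i x y)" using iw by blast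
    qed
    then obtain g where g: "\<And>n. P n (g n)" "\<And>n. \<exists>i. G i (g n) (g (Suc n))" by blast
    then obtain d where d: "\<And>n. G (d n) (g n) (g (Suc n))" by metis
    have "inf_path T (\<lambda>n. fst (g n)) d"
      using g(1)[of 0] d by (auto simp: inf_path_def P_def G_def)
    \<comment> \<open>Only now, with the infinite path fixed, is there a trace to follow; the bounds
      in \<open>G\<close> were imposed on all candidate formulas in advance.\<close>
    from tr[OF this] obtain \<tau> where "inf_progressing_trace (\<lambda>n. fst (g n)) d \<tau>" by blast
    then obtain k where k: "\<And>n. n \<ge> k \<Longrightarrow> \<tau> n |\<in>| fst (concl (fst (g n))) \<and>
        trace_pair (tag_of (fst (g n))) (d n) (\<tau> n) (\<tau> (Suc n))"
      and pr: "\<And>m. \<exists>n \<ge> m. progress_pair (tag_of (fst (g n))) (d n) (\<tau> n) (\<tau> (Suc n))"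
      unfolding inf_progressing_trace_def by blast
    define h where "h n = rank ?F (snd (g n)) (\<tau> n)" for n
    have h: "h (Suc n) \<le> h n" "progress_pair (tag_of (fst (g n))) (d n) (\<tau> n) (\<tau> (Suc n)) \<Longrightarrow> h (Suc n) < h n"
      if "n \<ge> k" for n
      using d[of n] k[OF that] by (auto simp: G_def h_def)
    obtain m where "\<And>n. n \<ge> m \<Longrightarrow> \<not> h (Suc n) < h n"
      using no_infinite_descent[of k h] h(1) by blast
    then show False
      using pr[of "max k m"] h(2) by (meson max.bounded_iff)
  qed
  then have nf: "\<not> falsifies (M, Pow (univ M)) v \<sigma>"
    if "fo_struct S M" "admissible c pr M" for M :: "('d, 'f, 'p) struct" and v
    using that by blast
  have eq: "sat M v \<phi> = hsat (M, Pow (univ M)) v \<phi>"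
    if "fo_struct S M" "v \<in> valuations M" "\<phi> |\<in>| fst \<sigma> |\<union>| snd \<sigma>"
    for M :: "('d, 'f, 'p) struct" and v \<phi>
    using that preproof_Node(2)[OF T(1)] T(2) by (intro sat_eq_hsat) (auto simp: wf_seq_def)
  show ?thesis
    unfolding valid_in_def
  proof (intro ballI impI)
    fix M :: "('d, 'f, 'p) struct" and v
    assume M: "M \<in> admissible_standard S c pr" and v: "v \<in> valuations M"
      and \<Gamma>: "\<forall>\<phi>. \<phi> |\<in>| fst \<sigma> \<longrightarrow> sat M v \<phi>"
    then have M': "fo_struct S M" "admissible c pr M" by (auto simp: admissible_standard_def)
    show "\<exists>\<phi>. \<phi> |\<in>| snd \<sigma> \<and> sat M v \<phi>"
    proof (rule ccontr)
      assume "\<not> ?thesis"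
      with \<Gamma> eq[OF M'(1) v] have "falsifies (M, Pow (univ M)) v \<sigma>"
        using v unfolding falsifies_def by auto
      then show False using nf[OF M'] by blast
    qed
  qed
qed

section \<open>Infinitary derivations\<close>

text \<open>The trace condition concerns tails only. Below \<open>m\<close> the truncated difference
  repeats \<open>\<tau> 0\<close>, a junk value that the threshold \<open>k + m\<close>
  skips.\<close>

lemma inf_progressing_trace_shift:
  assumes "inf_progressing_trace (\<lambda>n. p (n + m)) (\<lambda>n. d (n + m)) \<tau>"
  shows "inf_progressing_trace p d (\<lambda>n. \<tau> (n - m))"
proof -
  let ?t = "\<lambda>n. \<tau> (n - m)"
  obtain k where k: "\<And>n. n \<ge> k \<Longrightarrow> (\<exists>x y \<phi> s t. \<tau> n = RTC x y \<phi> s t) \<and>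
      \<tau> n |\<in>| fst (concl (p (n + m))) \<and> trace_pair (tag_of (p (n + m))) (d (n + m)) (\<tau> n) (\<tau> (Suc n))"
    and pr: "\<And>j. \<exists>n \<ge> j. progress_pair (tag_of (p (n + m))) (d (n + m)) (\<tau> n) (\<tau> (Suc n))"
    using assms unfolding inf_progressing_trace_def by blast
  have "(\<exists>x y \<phi> s t. ?t n = RTC x y \<phi> s t) \<and> ?t n |\<in>| fst (concl (p n)) \<and>
      trace_pair (tag_of (p n)) (d n) (?t n) (?t (Suc n))" if "n \<ge> k + m" for n
    using k[of "n - m"] that by (simp add: Suc_diff_le)
  moreover have "\<exists>n \<ge> j. progress_pair (tag_of (p n)) (d n) (?t n) (?t (Suc n))" for j
  proof -
    obtain n where "n \<ge> j" "progress_pair (tag_of (p (n + m))) (d (n + m)) (\<tau> n) (\<tau> (Suc n))"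
      using pr by blast
    then show ?thesis by (intro exI[of _ "n + m"]) (simp add: Suc_diff_le)
  qed
  ultimately show ?thesis unfolding inf_progressing_trace_def by blast
qed

lemma inf_path_shift:
  assumes "inf_path T p d"
  shows "inf_path (p m) (\<lambda>n. p (n + m)) (\<lambda>n. d (n + m))"
  using assms by (simp add: inf_path_def)

lemma omega_provable_wf: "omega_provable S R \<sigma> \<Longrightarrow> wf_seq S \<sigma>"
  using preproof_Node(2) by (auto simp: omega_provable_def)

text \<open>Grafting a root onto proofs of the premises is harmless: every infinite path lies in one
  of these proofs after one step, and the trace found there is shifted back.\<close>

lemma omega_provable_rule:
  assumes "R r \<Sigma> \<sigma>" "wf_seq S \<sigma>" "\<And>\<sigma>'. \<sigma>' \<in> set \<Sigma> \<Longrightarrow> omega_provable S R \<sigma>'"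
  shows "omega_provable S R \<sigma>"
proof -
  have "\<forall>\<sigma>' \<in> set \<Sigma>. \<exists>T. preproof S R T \<and> concl T = \<sigma>' \<and>
        (\<forall>p d. inf_path T p d \<longrightarrow> (\<exists>\<tau>. inf_progressing_trace p d \<tau>))"
    using assms(3) by (simp add: omega_provable_def)
  then obtain f where f: "\<And>\<sigma>'. \<sigma>' \<in> set \<Sigma> \<Longrightarrow> preproof S R (f \<sigma>')"
    "\<And>\<sigma>'. \<sigma>' \<in> set \<Sigma> \<Longrightarrow> concl (f \<sigma>') = \<sigma>'"
    "\<And>\<sigma>' p d. \<sigma>' \<in> set \<Sigma> \<Longrightarrow> inf_path (f \<sigma>') p d \<Longrightarrow> \<exists>\<tau>. inf_progressing_trace p d \<tau>"
    by metis
  define T where "T = Node \<sigma> r (map f \<Sigma>)"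
  have "map concl (map f \<Sigma>) = \<Sigma>" using f(2) by (simp add: map_idI)
  then have "preproof S R T"
    unfolding T_def using assms(1,2) f(1) by (intro preproof.intros) (auto simp del: map_map)
  moreover have "\<exists>\<tau>. inf_progressing_trace p d \<tau>" if "inf_path T p d" for p d
  proof -
    have "p 0 = T" "d 0 < length (subs (p 0))" "p 1 = subs (p 0) ! d 0"
      using that by (auto simp: inf_path_def)
    then have "p 1 = f (\<Sigma> ! d 0)" "d 0 < length \<Sigma>"
      by (auto simp: T_def)
    then show ?thesis
      using f(3)[of "\<Sigma> ! d 0"] inf_path_shift[OF that, of 1] inf_progressing_trace_shift[of p 1 d]
      by (metis nth_mem)
  qed
  ultimately show ?thesis by (auto simp: omega_provable_def T_def)
qed

text \<open>An infinite rightmost branch with a side derivation \<open>T k\<close> at each node.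
  Mapping over a list of two flags yields the two children while keeping the corecursive call
  guarded.\<close>

primcorec spine :: "(nat \<Rightarrow> ('f, 'p) seq) \<Rightarrow> (nat \<Rightarrow> ('f, 'p) tag) \<Rightarrow> (nat \<Rightarrow> ('f, 'p) deriv) \<Rightarrow>
    nat \<Rightarrow> ('f, 'p) deriv" where
  "concl (spine \<sigma> r T k) = \<sigma> k"
| "tag_of (spine \<sigma> r T k) = r k"
| "subs (spine \<sigma> r T k) =
    map (\<lambda>b. if b then T k else spine \<sigma> r T (Suc k)) [True, False]"

text \<open>An \<open>\<omega>\<close>-rule for \<open>RTC\<close>: unfolding the formula on the rightmost branch forever is legitimate,
  since its only new infinite path makes progress at every step.\<close>

lemma omega_provable_unfold:
  fixes G :: "nat \<Rightarrow> ('f, 'p) fm fset"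
  assumes case_R: "\<And>r \<Sigma> \<sigma>. case_rule r \<Sigma> \<sigma> \<Longrightarrow> R r \<Sigma> \<sigma>"
    and wf: "\<And>k. wf_seq S (finsert (RTC x y \<phi> s (u k)) (G k), \<Delta>)"
    and u: "\<And>k. u (Suc k) = Var (z k)"
    and G: "\<And>k. G (Suc k) = finsert (subst (Var(x := Var (z k), y := u k)) \<phi>) (G k)"
    and z: "\<And>k. z k \<notin> fv_set (G k) \<union> fv_set \<Delta> \<union> fv (RTC x y \<phi> s (u k))"
    and side: "\<And>k. omega_provable S R (finsert (Eq s (u k)) (G k), \<Delta>)"
  shows "omega_provable S R (finsert (RTC x y \<phi> s (u 0)) (G 0), \<Delta>)"
proof -
  have "\<forall>k. \<exists>T. preproof S R T \<and> concl T = (finsert (Eq s (u k)) (G k), \<Delta>) \<and>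
        (\<forall>p d. inf_path T p d \<longrightarrow> (\<exists>\<tau>. inf_progressing_trace p d \<tau>))"
    using side by (simp add: omega_provable_def)
  then obtain T where T: "\<And>k. preproof S R (T k)"
    "\<And>k. concl (T k) = (finsert (Eq s (u k)) (G k), \<Delta>)"
    "\<And>k p d. inf_path (T k) p d \<Longrightarrow> \<exists>\<tau>. inf_progressing_trace p d \<tau>"
    by metis
  define \<tau> where "\<tau> k = RTC x y \<phi> s (u k)" for k
  define \<sigma> where "\<sigma> k = (finsert (\<tau> k) (G k), \<Delta>)" for k
  define r where "r k = CaseSplit (\<tau> k) (\<tau> (Suc k))" for k
  define P where "P = spine \<sigma> r T"
  have P: "concl (P k) = \<sigma> k" "tag_of (P k) = r k" "subs (P k) = [T k, P (Suc k)]" for k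
    by (simp_all add: P_def)
  have rule: "R (r k) (map concl [T k, P (Suc k)]) (\<sigma> k)" for k
  proof -
    have "case_rule (r k) [(finsert (Eq s (u k)) (G k), \<Delta>),
        (finsert (RTC x y \<phi> s (Var (z k))) (finsert (subst (Var(x := Var (z k), y := u k)) \<phi>) (G k)), \<Delta>)]
        (\<sigma> k)"
      unfolding r_def \<sigma>_def \<tau>_def u by (rule case_rule.Case) (use z in simp)
    then show ?thesis by (intro case_R) (simp add: T P \<sigma>_def \<tau>_def u G)
  qed
  have "preproof S R T'" if "(\<exists>k. T' = P k) \<or> preproof S R T'" for T'
    using that
  proof (coinduction arbitrary: T' rule: preproof.coinduct)
    case preproof
    then show ?case
    proof
      assume "\<exists>k. T' = P k"
      then obtain k where k: "T' = P k" by blast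
      show ?thesis
      proof (intro exI conjI)
        show "T' = Node (\<sigma> k) (r k) [T k, P (Suc k)]"
          using k by (intro deriv.expand) (simp add: P)
        show "R (r k) (map concl [T k, P (Suc k)]) (\<sigma> k)" by (rule rule)
        show "wf_seq S (\<sigma> k)" using wf by (simp add: \<sigma>_def \<tau>_def)
      qed (use T(1) in auto)
    next
      assume "preproof S R T'"
      then show ?thesis by cases blast
    qed
  qed
  then have "preproof S R (P 0)" by blast
  moreover have "\<exists>\<rho>. inf_progressing_trace p d \<rho>" if path: "inf_path (P 0) p d" for p d
  \<comment> \<open>Child 1 continues the spine. A path either stays there, where every step is a
    progress point, or leaves for good at its first other choice, entering a side proof whose own
    trace can be used.\<close>
  proof (cases "\<forall>n. d n = 1")
    case True
    have p: "p n = P n" for n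
      by (induction n) (use path True P in \<open>auto simp: inf_path_def\<close>)
    have "inf_progressing_trace p d \<tau>"
      unfolding inf_progressing_trace_def using True
      by (auto simp: p P r_def \<sigma>_def \<tau>_def)
    then show ?thesis by blast
  next
    case False
    then obtain n where n: "d n \<noteq> 1" "\<And>j. j < n \<Longrightarrow> d j = 1"
      using exists_least_iff[of "\<lambda>n. d n \<noteq> 1"] by blast
    have p: "j \<le> n \<Longrightarrow> p j = P j" for j
      by (induction j) (use path n(2) P in \<open>auto simp: inf_path_def\<close>)
    have "d n < length (subs (p n))" "p (Suc n) = subs (p n) ! d n"
      using path by (auto simp: inf_path_def)
    then have "p (Suc n) = T n" using p[of n] n(1) by (auto simp: P less_Suc_eq)
    then show ?thesis
      using T(3)[of n] inf_path_shift[OF path, of "Suc n"] inf_progressing_trace_shift[of p "Suc n" d]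
      by metis
  qed
  ultimately show ?thesis
    unfolding omega_provable_def using P(1)[of 0] by (auto simp: \<sigma>_def \<tau>_def)
qed

section \<open>Deductively closed sets of sequents\<close>

lemma wf_seq_finsert [simp]:
  "wf_seq S (finsert \<phi> \<Gamma>, \<Delta>) \<longleftrightarrow> wf_fm S \<phi> \<and> wf_seq S (\<Gamma>, \<Delta>)"
  "wf_seq S (\<Gamma>, finsert \<phi> \<Delta>) \<longleftrightarrow> wf_fm S \<phi> \<and> wf_seq S (\<Gamma>, \<Delta>)"
  by (auto simp: wf_seq_def)

lemma wf_seq_empty [simp]: "wf_seq S ({||}, {||})"
  by (simp add: wf_seq_def)

text \<open>Interface common to both calculi, so that saturation and the term model are developed
  once. The rules for \<open>RTC\<close> antecedents, in which the calculi differ, enter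
  later.\<close>

locale prover =
  fixes S :: "('f, 'p) signature" and c pr :: 'f and prov :: "('f, 'p) seq \<Rightarrow> bool"
  assumes c: "c \<in> funs S" "fun_ar S c = 0"
    and pr: "pr \<in> funs S" "fun_ar S pr = 2"
    and prov_wf: "prov \<sigma> \<Longrightarrow> wf_seq S \<sigma>"
    and prov_lk: "lk_rule S r \<Sigma> \<sigma> \<Longrightarrow> wf_seq S \<sigma> \<Longrightarrow> (\<And>\<sigma>'. \<sigma>' \<in> set \<Sigma> \<Longrightarrow> prov \<sigma>') \<Longrightarrow> prov \<sigma>"
    and prov_rtc: "rtc_rule r \<Sigma> \<sigma> \<Longrightarrow> wf_seq S \<sigma> \<Longrightarrow> (\<And>\<sigma>'. \<sigma>' \<in> set \<Sigma> \<Longrightarrow> prov \<sigma>') \<Longrightarrow> prov \<sigma>"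
    and prov_pair: "pair_rule c pr r \<Sigma> \<sigma> \<Longrightarrow> wf_seq S \<sigma> \<Longrightarrow> (\<And>\<sigma>'. \<sigma>' \<in> set \<Sigma> \<Longrightarrow> prov \<sigma>') \<Longrightarrow> prov \<sigma>"
begin

lemma prov_weaken:
  assumes "prov (\<Gamma>, \<Delta>)" "\<Gamma> |\<subseteq>| \<Gamma>'" "\<Delta> |\<subseteq>| \<Delta>'" "wf_seq S (\<Gamma>', \<Delta>')"
  shows "prov (\<Gamma>', \<Delta>')"
proof -
  have 1: "wf_seq S (\<Gamma> |\<union>| A, \<Delta>) \<Longrightarrow> prov (\<Gamma> |\<union>| A, \<Delta>)" for A
  proof (induction A)
    case (insert \<phi> A)
    then show ?case using prov_lk[OF lk_rule.WL[of S "\<Gamma> |\<union>| A" \<Delta> \<phi>]] by simp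
  qed (use assms in simp)
  have 2: "wf_seq S (\<Gamma> |\<union>| A, \<Delta> |\<union>| B) \<Longrightarrow> prov (\<Gamma> |\<union>| A, \<Delta> |\<union>| B)" for A B
  proof (induction B)
    case empty
    then show ?case using 1 by simp
  next
    case (insert \<phi> B)
    then show ?case using prov_lk[OF lk_rule.WR[of S "\<Gamma> |\<union>| A" "\<Delta> |\<union>| B" \<phi>]] by simp
  qed
  show ?thesis using 2[of \<Gamma>' \<Delta>'] assms by (simp add: sup.absorb2)
qed

lemma prov_ax:
  assumes "wf_seq S (\<Gamma>, \<Delta>)" "\<phi> |\<in>| \<Gamma>" "\<phi> |\<in>| \<Delta>"
  shows "prov (\<Gamma>, \<Delta>)"
proof -
  have "wf_fm S \<phi>" using assms by (auto simp: wf_seq_def)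
  then have "prov ({|\<phi>|}, {|\<phi>|})"
    by (intro prov_lk[OF lk_rule.Ax]) simp_all
  then show ?thesis by (rule prov_weaken) (use assms in auto)
qed

text \<open>The pairing rules are formulated for variables; (Subst) lifts them to terms.
  Substitution is simultaneous, so the terms may contain the variables 0 to 3 themselves.\<close>

lemma prov_pair_inj:
  assumes "wf_tm S a" "wf_tm S b" "wf_tm S a'" "wf_tm S b'"
  shows "prov ({|Eq (Fun pr [a, b]) (Fun pr [a', b'])|}, {|Conj (Eq a a') (Eq b b')|})"
proof -
  define \<theta> where "\<theta> = Var(0 := a, Suc 0 := b, 2 := a', 3 := b')"
  let ?e = "Eq (Fun pr [Var 0, Var (Suc 0)]) (Fun pr [Var 2, Var 3]) :: ('f, 'p) fm"
  let ?c = "Conj (Eq (Var 0) (Var 2)) (Eq (Var (Suc 0)) (Var 3)) :: ('f, 'p) fm"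
  have "prov ({|?e|}, {|?e|})" using pr by (intro prov_ax) simp_all
  then have "prov ({|?e|}, {|?c|})"
    by (intro prov_pair[OF pair_rule.PairInj]) (use pr in auto)
  moreover have "wf_tm S (\<theta> x)" for x using assms by (simp add: \<theta>_def)
  moreover have "subst \<theta> ?e = Eq (Fun pr [a, b]) (Fun pr [a', b'])" "subst \<theta> ?c = Conj (Eq a a') (Eq b b')"
    by (simp_all add: \<theta>_def)
  ultimately show ?thesis
    using prov_lk[OF lk_rule.Subst[of S \<theta> "{|?e|}" "{|?c|}"]] assms pr
    by (simp add: numeral_2_eq_2 del: subst.simps)
qed

lemma prov_pair_const:
  assumes "wf_tm S a" "wf_tm S b"
  shows "prov ({|Eq (Fun pr [a, b]) (Fun c [])|}, {||})"
proof -
  define \<theta> where "\<theta> = Var(0 := a, Suc 0 := b)"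
  let ?e = "Eq (Fun pr [Var 0, Var (Suc 0)]) (Fun c []) :: ('f, 'p) fm"
  have "prov ({|?e|}, {||})"
    by (intro prov_pair[OF pair_rule.PairConst]) (use pr c in auto)
  moreover have "wf_tm S (\<theta> x)" for x using assms by (simp add: \<theta>_def)
  moreover have "subst \<theta> ?e = Eq (Fun pr [a, b]) (Fun c [])"
    by (simp add: \<theta>_def)
  ultimately show ?thesis
    using prov_lk[OF lk_rule.Subst[of S \<theta> "{|?e|}" "{||}"]] assms pr c
    by (simp add: numeral_2_eq_2 del: subst.simps)
qed

end

definition sub_signature :: "('f, 'p) signature \<Rightarrow> ('f, 'p) signature \<Rightarrow> bool" where
  "sub_signature S\<^sub>0 S \<longleftrightarrow> funs S\<^sub>0 \<subseteq> funs S \<and> preds S\<^sub>0 \<subseteq> preds S \<and>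
    fun_ar S\<^sub>0 = fun_ar S \<and> pred_ar S\<^sub>0 = pred_ar S"

lemma wf_tm_sub: "sub_signature S\<^sub>0 S \<Longrightarrow> wf_tm S\<^sub>0 t \<Longrightarrow> wf_tm S t"
  by (induction t) (auto simp: sub_signature_def list_all_iff)

lemma wf_fm_sub: "sub_signature S\<^sub>0 S \<Longrightarrow> wf_fm S\<^sub>0 \<phi> \<Longrightarrow> wf_fm S \<phi>"
  by (induction \<phi>) (auto simp: wf_tm_sub list_all_iff, auto simp: sub_signature_def)

text \<open>A substitution touching only the endpoints goes through without renaming. This lets
  \<open>RTC\<close> formulas with a variable endpoint act as contexts for equality reasoning and as
  induction formulas.\<close>

lemma subst_RTC_id:
  assumes "\<And>u. u \<in> fv \<phi> - {x, y} \<Longrightarrow> \<theta> u = Var u"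
  shows "subst \<theta> (RTC x y \<phi> s t) = RTC x y \<phi> (subst_tm \<theta> s) (subst_tm \<theta> t)"
proof -
  have "captured \<theta> (fv \<phi> - {x, y}) = fv \<phi> - {x, y}"
    using captured_cong[of "fv \<phi> - {x, y}" \<theta> Var] assms by simp
  moreover have "subst (\<theta>(x := Var x, y := Var y)) \<phi> = \<phi>"
    using assms by (intro subst_id) auto
  ultimately show ?thesis by (simp add: pick_def)
qed

section \<open>Saturated sets and their term models\<close>

text \<open>Derivability refers to the full signature \<open>S\<close>, whereas \<open>L\<close> and
  \<open>R\<close> contain only formulas over \<open>S\<^sub>0\<close> and decide all of
  them.\<close>

locale saturated = prover S c pr prov
  for S :: "('f, 'p) signature" and c pr :: 'f and prov :: "('f, 'p) seq \<Rightarrow> bool" +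
  fixes S\<^sub>0 :: "('f, 'p) signature" and L R :: "('f, 'p) fm set"
  assumes sub: "sub_signature S\<^sub>0 S" and c0: "c \<in> funs S\<^sub>0" and pr0: "pr \<in> funs S\<^sub>0"
    and consistent: "fset \<Gamma> \<subseteq> L \<Longrightarrow> fset \<Delta> \<subseteq> R \<Longrightarrow> \<not> prov (\<Gamma>, \<Delta>)"
    and wf_LR: "L \<union> R \<subseteq> {\<phi>. wf_fm S\<^sub>0 \<phi>}"
    and total: "wf_fm S\<^sub>0 \<phi> \<Longrightarrow> \<phi> \<in> L \<or> \<phi> \<in> R"
    and All_wit: "All x \<phi> \<in> R \<Longrightarrow> \<exists>z. subst (Var(x := Var z)) \<phi> \<in> R"
    and Ex_wit: "Ex x \<phi> \<in> L \<Longrightarrow> \<exists>z. subst (Var(x := Var z)) \<phi> \<in> L"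
begin

section \<open>Closure properties of a saturated pair\<close>

lemma L_wf0: "\<phi> \<in> L \<Longrightarrow> wf_fm S\<^sub>0 \<phi>" and R_wf0: "\<phi> \<in> R \<Longrightarrow> wf_fm S\<^sub>0 \<phi>"
  using wf_LR by auto

lemmas wf_tm_S = wf_tm_sub[OF sub] and wf_fm_S = wf_fm_sub[OF sub]

text \<open>If \<phi> were in \<open>R\<close>, the given sequent would be a provable part of the
  pair. Most closure properties of \<open>L\<close> are obtained from this by a short
  derivation.\<close>

lemma in_L: "prov (\<Gamma>, finsert \<phi> \<Delta>) \<Longrightarrow> fset \<Gamma> \<subseteq> L \<Longrightarrow> fset \<Delta> \<subseteq> R \<Longrightarrow> wf_fm S\<^sub>0 \<phi> \<Longrightarrow> \<phi> \<in> L"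
  using consistent[of \<Gamma> "finsert \<phi> \<Delta>"] total by auto

lemma in_R_iff: "wf_fm S\<^sub>0 \<phi> \<Longrightarrow> \<phi> \<in> R \<longleftrightarrow> \<phi> \<notin> L"
  using consistent[of "{|\<phi>|}" "{|\<phi>|}"] total prov_ax[of "{|\<phi>|}" "{|\<phi>|}"] wf_fm_S by auto

lemma L_Neg: "wf_fm S\<^sub>0 (Neg \<phi>) \<Longrightarrow> Neg \<phi> \<in> L \<longleftrightarrow> \<phi> \<notin> L"
proof -
  assume wf: "wf_fm S\<^sub>0 (Neg \<phi>)"
  then have ax: "prov ({|\<phi>|}, {|\<phi>|})" using wf_fm_S by (intro prov_ax) auto
  have "prov ({|Neg \<phi>, \<phi>|}, {||})"
    using ax wf wf_fm_S[OF wf] by (intro prov_lk[OF lk_rule.NegL]) auto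
  moreover have "prov ({||}, {|Neg \<phi>, \<phi>|})"
    using ax wf wf_fm_S[OF wf] by (intro prov_lk[OF lk_rule.NegR]) auto
  ultimately show ?thesis
    using consistent[of "{|Neg \<phi>, \<phi>|}" "{||}"] consistent[of "{||}" "{|Neg \<phi>, \<phi>|}"]
      total[of \<phi>] total[of "Neg \<phi>"] wf by auto
qed

lemma L_Conj: "wf_fm S\<^sub>0 (Conj \<phi> \<psi>) \<Longrightarrow> Conj \<phi> \<psi> \<in> L \<longleftrightarrow> \<phi> \<in> L \<and> \<psi> \<in> L"
proof -
  assume wf: "wf_fm S\<^sub>0 (Conj \<phi> \<psi>)"
  have "prov ({|Conj \<phi> \<psi>|}, {|\<phi>|})" "prov ({|Conj \<phi> \<psi>|}, {|\<psi>|})"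
    by (intro prov_lk[OF lk_rule.ConjL]; use wf_fm_S[OF wf] in \<open>auto intro: prov_ax\<close>)+
  moreover have "prov ({|\<phi>, \<psi>|}, {|Conj \<phi> \<psi>|})"
    by (intro prov_lk[OF lk_rule.ConjR]) (use wf_fm_S[OF wf] in \<open>auto intro: prov_ax\<close>)
  ultimately show ?thesis
    using wf by (auto intro: in_L)
qed

lemma L_Disj: "wf_fm S\<^sub>0 (Disj \<phi> \<psi>) \<Longrightarrow> Disj \<phi> \<psi> \<in> L \<longleftrightarrow> \<phi> \<in> L \<or> \<psi> \<in> L"
proof -
  assume wf: "wf_fm S\<^sub>0 (Disj \<phi> \<psi>)"
  have "prov ({|\<phi>|}, {|Disj \<phi> \<psi>|})" "prov ({|\<psi>|}, {|Disj \<phi> \<psi>|})"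
    by (intro prov_lk[OF lk_rule.DisjR]; use wf_fm_S[OF wf] in \<open>auto intro: prov_ax\<close>)+
  moreover have "prov ({|Disj \<phi> \<psi>|}, {|\<phi>, \<psi>|})"
    by (intro prov_lk[OF lk_rule.DisjL]) (use wf_fm_S[OF wf] in \<open>auto intro: prov_ax\<close>)
  ultimately show ?thesis
    using wf consistent[of "{|Disj \<phi> \<psi>|}" "{|\<phi>, \<psi>|}"] in_R_iff by (auto intro: in_L)
qed

lemma L_Imp: "wf_fm S\<^sub>0 (Imp \<phi> \<psi>) \<Longrightarrow> Imp \<phi> \<psi> \<in> L \<longleftrightarrow> (\<phi> \<in> L \<longrightarrow> \<psi> \<in> L)"
proof -
  assume wf: "wf_fm S\<^sub>0 (Imp \<phi> \<psi>)"
  have 1: "prov ({|\<psi>|}, {|Imp \<phi> \<psi>|})" "prov ({||}, {|Imp \<phi> \<psi>, \<phi>|})"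
    by (intro prov_lk[OF lk_rule.ImpR]; use wf_fm_S[OF wf] in \<open>auto intro: prov_ax\<close>)+
  have 2: "prov ({|Imp \<phi> \<psi>, \<phi>|}, {|\<psi>|})"
    by (intro prov_lk[OF lk_rule.ImpL]) (use wf_fm_S[OF wf] in \<open>auto intro: prov_ax\<close>)
  show ?thesis
    using wf in_R_iff in_L[OF 2] in_L[OF 1(1)] in_L[OF 1(2)] by auto
qed

lemma wf_subst1: "wf_fm S\<^sub>0 \<phi> \<Longrightarrow> wf_tm S\<^sub>0 t \<Longrightarrow> wf_fm S\<^sub>0 (subst (Var(x := t)) \<phi>)"
  by (rule wf_subst) auto

lemma wf_subst2:
  "wf_fm S\<^sub>0 \<phi> \<Longrightarrow> wf_tm S\<^sub>0 s \<Longrightarrow> wf_tm S\<^sub>0 t \<Longrightarrow> wf_fm S\<^sub>0 (subst (Var(x := s, y := t)) \<phi>)"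
  by (rule wf_subst) auto

lemma L_All:
  assumes wf: "wf_fm S\<^sub>0 (All x \<phi>)"
  shows "All x \<phi> \<in> L \<longleftrightarrow> (\<forall>t. wf_tm S\<^sub>0 t \<longrightarrow> subst (Var(x := t)) \<phi> \<in> L)"
proof -
  have "prov ({|All x \<phi>|}, {|subst (Var(x := t)) \<phi>|})" if "wf_tm S\<^sub>0 t" for t
    by (intro prov_lk[OF lk_rule.AllL[where t = t]])
      (use wf_fm_S[OF wf] wf_fm_S[OF wf_subst1] wf that wf_tm_S in \<open>auto intro: prov_ax\<close>)
  moreover have "\<exists>t. wf_tm S\<^sub>0 t \<and> subst (Var(x := t)) \<phi> \<notin> L" if "All x \<phi> \<notin> L"
    using that All_wit[of x \<phi>] in_R_iff wf R_wf0 by (metis wf_tm.simps(1))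
  ultimately show ?thesis
    using wf wf_subst1 by (fastforce intro: in_L)
qed

lemma L_Ex:
  assumes wf: "wf_fm S\<^sub>0 (Ex x \<phi>)"
  shows "Ex x \<phi> \<in> L \<longleftrightarrow> (\<exists>t. wf_tm S\<^sub>0 t \<and> subst (Var(x := t)) \<phi> \<in> L)"
proof -
  have "prov ({|subst (Var(x := t)) \<phi>|}, {|Ex x \<phi>|})" if "wf_tm S\<^sub>0 t" for t
    by (intro prov_lk[OF lk_rule.ExR[where t = t]])
      (use wf_fm_S[OF wf] wf_fm_S[OF wf_subst1] wf that wf_tm_S in \<open>auto intro: prov_ax\<close>)
  then have "Ex x \<phi> \<in> L" if "wf_tm S\<^sub>0 t" "subst (Var(x := t)) \<phi> \<in> L" for t
    using that wf in_L[of "{|subst (Var(x := t)) \<phi>|}" "Ex x \<phi>" "{||}"] by auto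
  moreover have "\<exists>t. wf_tm S\<^sub>0 t \<and> subst (Var(x := t)) \<phi> \<in> L" if "Ex x \<phi> \<in> L"
    using that Ex_wit[of x \<phi>] by (metis wf_tm.simps(1))
  ultimately show ?thesis by blast
qed

lemma L_Eq_refl: "wf_tm S\<^sub>0 t \<Longrightarrow> Eq t t \<in> L"
  using prov_lk[OF lk_rule.EqR[of S t]] wf_tm_S by (intro in_L[of "{||}" _ "{||}"]) auto

lemma L_Eq_subst:
  assumes "Eq s t \<in> L" "subst (Var(x := s)) \<phi> \<in> L" "wf_fm S\<^sub>0 \<phi>"
  shows "subst (Var(x := t)) \<phi> \<in> L"
proof -
  have wf: "wf_tm S\<^sub>0 s" "wf_tm S\<^sub>0 t" using L_wf0[OF assms(1)] by auto
  let ?s = "subst (Var(x := s)) \<phi>" and ?t = "subst (Var(x := t)) \<phi>"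
  have wfs: "wf_fm S ?s" "wf_fm S ?t" "wf_fm S (Eq s t)"
    using wf assms(3) wf_fm_S wf_subst1 wf_tm_S by auto
  have "prov ({|?s|}, {|?s|})" using wfs by (intro prov_ax) auto
  then have "prov ({|Eq s t, ?s|}, {|?t|})"
    using wfs wf_fm_S assms(3) by (intro prov_lk[OF lk_rule.EqL1[where s = s]]) auto
  then show ?thesis
    using assms wf wf_subst1 by (intro in_L) auto
qed

text \<open>Leibniz in the context \<open>Eq (Var x) s\<close>, starting from \<open>Eq s s\<close>;
  freshness of \<open>x\<close> leaves the right-hand side alone.\<close>

lemma L_Eq_sym: "Eq s t \<in> L \<Longrightarrow> Eq t s \<in> L"
proof -
  assume st: "Eq s t \<in> L"
  then have wf: "wf_tm S\<^sub>0 s" "wf_tm S\<^sub>0 t" using L_wf0 by fastforce+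
  obtain x where "x \<notin> fv_tm s" using ex_fresh_var[OF finite_fv_tm] by blast
  then have "subst_tm (Var(x := r)) s = s" for r by (intro subst_tm_id) auto
  then show ?thesis
    using L_Eq_subst[OF st, of x "Eq (Var x) s"] L_Eq_refl[OF wf(1)] wf by simp
qed

lemma L_Eq_trans: "Eq s t \<in> L \<Longrightarrow> Eq t r \<in> L \<Longrightarrow> Eq s r \<in> L"
proof -
  assume st: "Eq s t \<in> L" and tr: "Eq t r \<in> L"
  then have wf: "wf_tm S\<^sub>0 s" using L_wf0 by fastforce
  obtain x where "x \<notin> fv_tm s" using ex_fresh_var[OF finite_fv_tm] by blast
  then have "subst_tm (Var(x := r)) s = s" for r by (intro subst_tm_id) auto
  then show ?thesis
    using L_Eq_subst[OF tr, of x "Eq s (Var x)"] st wf by simp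
qed

text \<open>Arguments are exchanged one at a time from the left; \<open>as\<close> accumulates those
  already exchanged. The context \<open>K\<close> covers both predicates and equations between
  function terms.\<close>

lemma list_replace:
  assumes "list_all2 (\<lambda>s t. Eq s t \<in> L) ss ts" "K (as @ ss) \<in> L"
    and "\<And>as s t bs. Eq s t \<in> L \<Longrightarrow> K (as @ s # bs) \<in> L \<Longrightarrow> K (as @ t # bs) \<in> L"
  shows "K (as @ ts) \<in> L"
  using assms(1,2)
proof (induction arbitrary: as rule: list_all2_induct)
  case (Cons s ss t ts)
  then have "K ((as @ [t]) @ ss) \<in> L" using assms(3) by simp
  then show ?case using Cons.IH[of "as @ [t]"] by simp
qed simp

lemma map_subst_fresh:
  "x \<notin> \<Union> (fv_tm ` set ts) \<Longrightarrow> map (subst_tm (Var(x := r))) ts = ts"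
  by (intro map_idI subst_tm_id) auto

lemma L_Pred_cong:
  assumes "list_all2 (\<lambda>s t. Eq s t \<in> L) ss ts" "Pred P ss \<in> L"
  shows "Pred P ts \<in> L"
proof -
  have "Pred P (as @ t # bs) \<in> L" if "Eq s t \<in> L" "Pred P (as @ s # bs) \<in> L" for as s t bs
  proof -
    obtain x where x: "x \<notin> \<Union> (fv_tm ` set (as @ bs))" using ex_fresh_var by (metis finite_UN finite_fv_tm finite_set)
    then have "map (subst_tm (Var(x := r))) as = as" "map (subst_tm (Var(x := r))) bs = bs" for r
      by (auto intro!: map_subst_fresh)
    then show ?thesis
      using L_Eq_subst[OF that(1), of x "Pred P (as @ Var x # bs)"] that(2) L_wf0[OF that(2)] by simp
  qed
  from list_replace[where K = "Pred P" and as = "[]", OF assms(1) _ this] assms(2) show ?thesis by simp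
qed

lemma L_Fun_cong:
  assumes "list_all2 (\<lambda>s t. Eq s t \<in> L) ss ts" "wf_tm S\<^sub>0 (Fun f ss)"
  shows "Eq (Fun f ss) (Fun f ts) \<in> L"
proof -
  let ?K = "\<lambda>ts. Eq (Fun f ss) (Fun f ts)"
  have "?K (as @ t # bs) \<in> L" if "Eq s t \<in> L" "?K (as @ s # bs) \<in> L" for as s t bs
  proof -
    obtain x where x: "x \<notin> \<Union> (fv_tm ` set (ss @ as @ bs))" using ex_fresh_var by (metis finite_UN finite_fv_tm finite_set)
    then have "map (subst_tm (Var(x := r))) as = as" "map (subst_tm (Var(x := r))) bs = bs"
      "map (subst_tm (Var(x := r))) ss = ss" for r
      by (auto intro!: map_subst_fresh)
    then show ?thesis
      using L_Eq_subst[OF that(1), of x "?K (as @ Var x # bs)"] that(2) L_wf0[OF that(2)] by simp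
  qed
  from list_replace[where K = ?K and as = "[]", OF assms(1) _ this] assms(2)
  show ?thesis using L_Eq_refl by simp
qed

lemma L_RTC_refl: "wf_fm S\<^sub>0 (RTC x y \<phi> s s) \<Longrightarrow> RTC x y \<phi> s s \<in> L"
proof -
  assume wf: "wf_fm S\<^sub>0 (RTC x y \<phi> s s)"
  have "prov ({||}, {|RTC x y \<phi> s s|})"
    by (intro prov_rtc[OF rtc_rule.Refl]) (use wf_fm_S[OF wf] in auto)
  then show ?thesis using wf by (intro in_L) auto
qed

lemma L_RTC_trans:
  assumes "RTC x y \<phi> s r \<in> L" "subst (Var(x := r, y := t)) \<phi> \<in> L" "wf_tm S\<^sub>0 t"
  shows "RTC x y \<phi> s t \<in> L"
proof -
  let ?\<Gamma> = "{|RTC x y \<phi> s r, subst (Var(x := r, y := t)) \<phi>|}"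
  have wf: "wf_fm S\<^sub>0 (RTC x y \<phi> s t)" using L_wf0[OF assms(1)] assms(3) by simp
  have "prov (?\<Gamma>, {|RTC x y \<phi> s t|})"
    by (intro prov_rtc[OF rtc_rule.Trans[where r = r]])
      (use wf_fm_S[OF wf] wf_fm_S[OF L_wf0[OF assms(1)]] wf_fm_S[OF L_wf0[OF assms(2)]]
        in \<open>auto intro: prov_ax\<close>)
  then show ?thesis using wf assms by (intro in_L) auto
qed

text \<open>Leibniz at the target position. The placeholder \<open>z\<close> avoids \<phi> and
  \<open>s\<close>, so that only the target is replaced.\<close>

lemma L_RTC_eq:
  assumes "RTC x y \<phi> s r \<in> L" "Eq r t \<in> L"
  shows "RTC x y \<phi> s t \<in> L"
proof -
  obtain z where z: "z \<notin> fv \<phi> \<union> fv_tm s" using ex_fresh_var[of "fv \<phi> \<union> fv_tm s"] by auto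
  have "subst (Var(z := q)) (RTC x y \<phi> s (Var z)) = RTC x y \<phi> s q" for q
    using z by (subst subst_RTC_id) (auto intro: subst_tm_id)
  then show ?thesis
    using L_Eq_subst[OF assms(2), of z "RTC x y \<phi> s (Var z)"] assms(1) L_wf0[OF assms(1)] by simp
qed

lemma L_pair_inj:
  assumes "Eq (Fun pr [a, b]) (Fun pr [a', b']) \<in> L"
  shows "Eq a a' \<in> L \<and> Eq b b' \<in> L"
proof -
  have wf: "wf_tm S\<^sub>0 a" "wf_tm S\<^sub>0 b" "wf_tm S\<^sub>0 a'" "wf_tm S\<^sub>0 b'" using L_wf0[OF assms] by auto
  then have "Conj (Eq a a') (Eq b b') \<in> L"
    using in_L[OF prov_pair_inj] assms wf_tm_S by auto
  then show ?thesis using L_Conj wf by simp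
qed

lemma L_pair_const: "Eq (Fun pr [a, b]) (Fun c []) \<notin> L"
  using prov_pair_const[of a b] consistent[of "{|Eq (Fun pr [a, b]) (Fun c [])|}" "{||}"]
    wf_tm_S L_wf0[of "Eq (Fun pr [a, b]) (Fun c [])"] by auto

end

section \<open>The term model and the truth lemma\<close>

primrec depth :: "('f, 'p) fm \<Rightarrow> nat" where
  "depth (Eq s t) = 0"
| "depth (Pred P ts) = 0"
| "depth (Neg \<phi>) = Suc (depth \<phi>)"
| "depth (Conj \<phi> \<psi>) = Suc (depth \<phi> + depth \<psi>)"
| "depth (Disj \<phi> \<psi>) = Suc (depth \<phi> + depth \<psi>)"
| "depth (Imp \<phi> \<psi>) = Suc (depth \<phi> + depth \<psi>)"
| "depth (All x \<phi>) = Suc (depth \<phi>)"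
| "depth (Ex x \<phi>) = Suc (depth \<phi>)"
| "depth (RTC x y \<phi> s t) = Suc (depth \<phi>)"

text \<open>Terms do not count towards \<open>depth\<close>, so every instance of a subformula is
  smaller than the formula. The truth lemma recurses on instances at a fixed valuation.\<close>

lemma depth_subst [simp]: "depth (subst \<theta> \<phi>) = depth \<phi>"
  by (induction \<phi> arbitrary: \<theta>) (simp_all add: Let_def)

text \<open>\<open>e\<close> plays the role of the quotient map by provable equality, but takes its
  values in the prescribed type; all that matters is its kernel.\<close>

locale term_model = saturated S c pr prov S\<^sub>0 L R
  for S :: "('f, 'p) signature" and c pr :: 'f and prov :: "('f, 'p) seq \<Rightarrow> bool"
    and S\<^sub>0 :: "('f, 'p) signature" and L R :: "('f, 'p) fm set" +
  fixes e :: "'f tm \<Rightarrow> 'd"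
  assumes e_eq_iff: "wf_tm S\<^sub>0 s \<Longrightarrow> wf_tm S\<^sub>0 t \<Longrightarrow> e s = e t \<longleftrightarrow> Eq s t \<in> L"
begin

definition U :: "'d set" where "U = e ` {t. wf_tm S\<^sub>0 t}"

definition rep :: "'d \<Rightarrow> 'f tm" where "rep a = (SOME t. wf_tm S\<^sub>0 t \<and> e t = a)"

lemma rep: "a \<in> U \<Longrightarrow> wf_tm S\<^sub>0 (rep a) \<and> e (rep a) = a"
  unfolding rep_def by (rule someI_ex) (auto simp: U_def)

lemma e_in_U [simp]: "wf_tm S\<^sub>0 t \<Longrightarrow> e t \<in> U"
  by (simp add: U_def)

lemma c_arity [simp]: "c \<in> funs S\<^sub>0" "fun_ar S\<^sub>0 c = 0"
  using c0 c sub by (simp_all add: sub_signature_def)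

lemma wf_c: "wf_tm S\<^sub>0 (Fun c [])"
  by simp

text \<open>Symbols outside \<open>S\<^sub>0\<close> get a trivial interpretation that formulas over \<open>S\<^sub>0\<close> can express.\<close>

definition M :: "('d, 'f, 'p) struct" where
  "M = \<lparr>univ = U,
    fun_int = (\<lambda>f as. if f \<in> funs S\<^sub>0 \<and> length as = fun_ar S\<^sub>0 f \<and> set as \<subseteq> U
      then e (Fun f (map rep as)) else e (Fun c [])),
    pred_int = (\<lambda>P as. P \<in> preds S\<^sub>0 \<and> length as = pred_ar S\<^sub>0 P \<and> set as \<subseteq> U \<and>
      Pred P (map rep as) \<in> L)\<rparr>"

lemma univ_M [simp]: "univ M = U"
  by (simp add: M_def)

lemma fun_int_foreign: "f \<notin> funs S\<^sub>0 \<Longrightarrow> fun_int M f as = e (Fun c [])"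
  by (simp add: M_def)

lemma pred_int_foreign: "P \<notin> preds S\<^sub>0 \<Longrightarrow> \<not> pred_int M P as"
  by (simp add: M_def)

lemma rep_e:
  assumes "wf_tm S\<^sub>0 t"
  shows "wf_tm S\<^sub>0 (rep (e t))" "Eq t (rep (e t)) \<in> L" "Eq (rep (e t)) t \<in> L"
  using rep[of "e t"] e_eq_iff[of t "rep (e t)"] e_eq_iff[of "rep (e t)" t] assms by auto

text \<open>\<open>M\<close> computes with arbitrarily chosen representatives; congruence of
  equality in \<open>L\<close> makes the result independent of the choice.\<close>

lemma fun_int_e:
  assumes "wf_tm S\<^sub>0 (Fun f ts)"
  shows "fun_int M f (map e ts) = e (Fun f ts)"
proof -
  have ts: "\<And>t. t \<in> set ts \<Longrightarrow> wf_tm S\<^sub>0 t" using assms by (auto simp: list_all_iff)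
  then have wf: "wf_tm S\<^sub>0 (Fun f (map (rep \<circ> e) ts))"
    using assms rep_e by (auto simp: list_all_iff)
  have "list_all2 (\<lambda>s t. Eq s t \<in> L) (map (rep \<circ> e) ts) ts"
    using ts rep_e by (auto simp: list_all2_conv_all_nth)
  then have "e (Fun f (map (rep \<circ> e) ts)) = e (Fun f ts)"
    using L_Fun_cong[OF _ wf] e_eq_iff wf assms by blast
  then show ?thesis
    using assms ts by (auto simp: M_def)
qed

lemma pred_int_e:
  assumes "wf_fm S\<^sub>0 (Pred P ts)"
  shows "pred_int M P (map e ts) \<longleftrightarrow> Pred P ts \<in> L"
proof -
  have ts: "\<And>t. t \<in> set ts \<Longrightarrow> wf_tm S\<^sub>0 t" using assms by (auto simp: list_all_iff)
  have "list_all2 (\<lambda>s t. Eq s t \<in> L) (map (rep \<circ> e) ts) ts"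
    "list_all2 (\<lambda>s t. Eq s t \<in> L) ts (map (rep \<circ> e) ts)"
    using ts rep_e by (auto simp: list_all2_conv_all_nth)
  then have "Pred P (map (rep \<circ> e) ts) \<in> L \<longleftrightarrow> Pred P ts \<in> L"
    using L_Pred_cong by blast
  then show ?thesis
    using assms ts by (auto simp: M_def)
qed

lemma tm_val_M:
  assumes "\<And>u. wf_tm S\<^sub>0 (\<theta> u)" "wf_tm S\<^sub>0 t"
  shows "tm_val M (\<lambda>u. e (\<theta> u)) t = e (subst_tm \<theta> t)"
  using assms(2)
proof (induction t)
  case (Fun f ts)
  have "map (tm_val M (\<lambda>u. e (\<theta> u))) ts = map e (map (subst_tm \<theta>) ts)"
    using Fun by (auto simp: list_all_iff)
  moreover have "wf_tm S\<^sub>0 (Fun f (map (subst_tm \<theta>) ts))"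
    using wf_subst_tm[OF assms(1) Fun.prems] by simp
  ultimately show ?case by (simp only: tm_val.simps subst_tm.simps fun_int_e)
qed simp

definition v\<^sub>0 :: "var \<Rightarrow> 'd" where "v\<^sub>0 u = e (Var u)"

lemma tm_val_v0: "wf_tm S\<^sub>0 t \<Longrightarrow> tm_val M v\<^sub>0 t = e t"
  using tm_val_M[of Var t] by (simp add: v\<^sub>0_def[abs_def])

lemma v0_valuation: "v\<^sub>0 \<in> valuations M"
  by (simp add: valuations_def v\<^sub>0_def)

lemma fo_struct_M: "fo_struct S M"
proof -
  have "fun_int M f as \<in> U" if "set as \<subseteq> U" for f as
  proof (cases "f \<in> funs S\<^sub>0 \<and> length as = fun_ar S\<^sub>0 f")
    case True
    then have "wf_tm S\<^sub>0 (Fun f (map rep as))" using that rep by (auto simp: list_all_iff)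
    then show ?thesis using True that by (auto simp: M_def intro!: e_in_U)
  qed (auto simp: M_def intro!: e_in_U)
  moreover have "U \<noteq> {}" using e_in_U[OF wf_c] by blast
  ultimately show ?thesis by (simp add: fo_struct_def)
qed

lemma admissible_M: "admissible c pr M"
proof -
  have ar: "fun_ar S\<^sub>0 pr = 2" using pr sub by (simp add: sub_signature_def)
  have pr_int: "fun_int M pr [e s, e t] = e (Fun pr [s, t])" if "wf_tm S\<^sub>0 s" "wf_tm S\<^sub>0 t" for s t
    using fun_int_e[of pr "[s, t]"] that pr0 ar by simp
  have c_int: "fun_int M c [] = e (Fun c [])" using fun_int_e[of c "[]"] by simp
  show ?thesis
    unfolding admissible_def univ_M
  proof (intro conjI ballI impI)
    fix a b a' b'
    assume ab: "a \<in> U" "b \<in> U" "a' \<in> U" "b' \<in> U" "fun_int M pr [a, b] = fun_int M pr [a', b']"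
    then obtain s t s' t' where st: "a = e s" "b = e t" "a' = e s'" "b' = e t'"
      "wf_tm S\<^sub>0 s" "wf_tm S\<^sub>0 t" "wf_tm S\<^sub>0 s'" "wf_tm S\<^sub>0 t'" unfolding U_def by blast
    then have "Eq (Fun pr [s, t]) (Fun pr [s', t']) \<in> L"
      using ab(5) pr_int e_eq_iff pr0 ar by simp
    then show "a = a'" "b = b'"
      using L_pair_inj[of s t s' t'] st e_eq_iff[of s s'] e_eq_iff[of t t'] by simp_all
  next
    fix a b assume "a \<in> U" "b \<in> U"
    then obtain s t where st: "a = e s" "b = e t" "wf_tm S\<^sub>0 s" "wf_tm S\<^sub>0 t" unfolding U_def by blast
    have "e (Fun pr [s, t]) \<noteq> e (Fun c [])"
      using L_pair_const[of s t] st e_eq_iff[of "Fun pr [s, t]" "Fun c []"] pr0 ar wf_c by simp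
    then show "fun_int M pr [a, b] \<noteq> fun_int M c []"
      unfolding c_int st(1,2) pr_int[OF st(3,4)] .
  qed
qed

text \<open>The second-order part \<open>D\<close> of a frame over \<open>M\<close> only has to contain enough sets to refute the
  \<open>RTC\<close> formulas outside \<open>L\<close>, and no set that would refute one in \<open>L\<close>.\<close>

lemma truth:
  assumes D: "D \<subseteq> Pow U"
    and definable: "\<And>\<psi> z. wf_fm S\<^sub>0 \<psi> \<Longrightarrow> {e r |r. wf_tm S\<^sub>0 r \<and> subst (Var(z := r)) \<psi> \<in> L} \<in> D"
    and closed: "\<And>x y \<phi> s t A. RTC x y \<phi> s t \<in> L \<Longrightarrow> A \<in> D \<Longrightarrow> e s \<in> A \<Longrightarrow>
      (\<And>a b. wf_tm S\<^sub>0 a \<Longrightarrow> wf_tm S\<^sub>0 b \<Longrightarrow> e a \<in> A \<Longrightarrow> subst (Var(x := a, y := b)) \<phi> \<in> L \<Longrightarrow> e b \<in> A)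
      \<Longrightarrow> e t \<in> A"
    and "wf_fm S\<^sub>0 \<phi>"
  shows "hsat (M, D) v\<^sub>0 \<phi> \<longleftrightarrow> \<phi> \<in> L"
  using assms(4)
proof (induction "depth \<phi>" arbitrary: \<phi> rule: less_induct)
  case less
  \<comment> \<open>Every domain element is the value of a term, so updating the valuation amounts
    to passing to an instance, to which the induction hypothesis applies.\<close>
  have sub1: "hsat (M, D) (v\<^sub>0(x := e t)) \<psi> \<longleftrightarrow> subst (Var(x := t)) \<psi> \<in> L"
    if "depth \<psi> < depth \<phi>" "wf_fm S\<^sub>0 \<psi>" "wf_tm S\<^sub>0 t" for x t \<psi>
    using less.hyps[of "subst (Var(x := t)) \<psi>"] that wf_subst1 by (simp add: hsat_subst1 tm_val_v0)
  have sub2: "hsat (M, D) (v\<^sub>0(x := e s, y := e t)) \<psi> \<longleftrightarrow> subst (Var(x := s, y := t)) \<psi> \<in> L"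
    if "depth \<psi> < depth \<phi>" "wf_fm S\<^sub>0 \<psi>" "wf_tm S\<^sub>0 s" "wf_tm S\<^sub>0 t" for x y s t \<psi>
    using less.hyps[of "subst (Var(x := s, y := t)) \<psi>"] that wf_subst2
    by (simp add: hsat_subst2 tm_val_v0)
  show ?case
  proof (cases \<phi>)
    case (Eq s t)
    then show ?thesis using less.prems by (simp add: tm_val_v0 e_eq_iff)
  next
    case (Pred P ts)
    then have "map (tm_val M v\<^sub>0) ts = map e ts"
      using less.prems by (auto simp: tm_val_v0 list_all_iff)
    then have "pred_int M P (map (tm_val M v\<^sub>0) ts) = pred_int M P (map e ts)" by (rule arg_cong)
    then show ?thesis using Pred less.prems pred_int_e[of P ts] by simp
  next
    case (Neg \<psi>)
    then show ?thesis using less.hyps[of \<psi>] less.prems L_Neg[of \<psi>] by simp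
  next
    case (Conj \<psi> \<chi>)
    then show ?thesis using less.hyps[of \<psi>] less.hyps[of \<chi>] less.prems L_Conj[of \<psi> \<chi>] by simp
  next
    case (Disj \<psi> \<chi>)
    then show ?thesis using less.hyps[of \<psi>] less.hyps[of \<chi>] less.prems L_Disj[of \<psi> \<chi>] by simp
  next
    case (Imp \<psi> \<chi>)
    then show ?thesis using less.hyps[of \<psi>] less.hyps[of \<chi>] less.prems L_Imp[of \<psi> \<chi>] by simp
  next
    case (All x \<psi>)
    then show ?thesis using sub1[of \<psi>] less.prems L_All[of x \<psi>] by (simp add: U_def)
  next
    case (Ex x \<psi>)
    then show ?thesis using sub1[of \<psi>] less.prems L_Ex[of x \<psi>] by (auto simp add: U_def)
  next
    case (RTC x y \<psi> s t)
    have wf: "x \<noteq> y" "wf_fm S\<^sub>0 \<psi>" "wf_tm S\<^sub>0 s" "wf_tm S\<^sub>0 t" using less.prems RTC by auto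
    have d: "depth \<psi> < depth \<phi>" by (simp add: RTC)
    note step = sub2[OF d wf(2)]
    show ?thesis
    proof
      assume "\<phi> \<in> L"
      show "hsat (M, D) v\<^sub>0 \<phi>"
        unfolding RTC hsat.simps
      proof (intro ballI impI, elim conjE)
        fix A assume A: "A \<in> snd (M, D)" "tm_val (fst (M, D)) v\<^sub>0 s \<in> A"
          and cl: "\<forall>a \<in> univ (fst (M, D)). \<forall>b \<in> univ (fst (M, D)).
            a \<in> A \<and> hsat (M, D) (v\<^sub>0(x := a, y := b)) \<psi> \<longrightarrow> b \<in> A"
        have "e t \<in> A"
        proof (rule closed)
          show "RTC x y \<psi> s t \<in> L" using \<open>\<phi> \<in> L\<close> RTC by simp
          show "A \<in> D" "e s \<in> A" using A wf by (simp_all add: tm_val_v0)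
          fix a b assume "wf_tm S\<^sub>0 a" "wf_tm S\<^sub>0 b" "e a \<in> A" "subst (Var(x := a, y := b)) \<psi> \<in> L"
          then show "e b \<in> A" using bspec[OF bspec[OF cl, of "e a"], of "e b"] step by simp
        qed
        then show "tm_val (fst (M, D)) v\<^sub>0 t \<in> A" using wf by (simp add: tm_val_v0)
      qed
    next
      assume h: "hsat (M, D) v\<^sub>0 \<phi>"
      obtain z where z: "z \<notin> fv \<psi> \<union> fv_tm s" using ex_fresh_var[of "fv \<psi> \<union> fv_tm s"] by auto
      have sub_z: "subst (Var(z := q)) (RTC x y \<psi> s (Var z)) = RTC x y \<psi> s q" for q
        using z by (subst subst_RTC_id) (auto intro: subst_tm_id)
      \<comment> \<open>The test set is what \<open>L\<close> itself considers reachable from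
        \<open>s\<close>. It is definable by an \<open>RTC\<close> formula with variable target,
        contains \<open>s\<close> by (Refl) and is closed by (Trans); hence it must contain
        \<open>t\<close>.\<close>
      define A where "A = {e r |r. wf_tm S\<^sub>0 r \<and> RTC x y \<psi> s r \<in> L}"
      have "A \<in> D"
        using definable[of "RTC x y \<psi> s (Var z)" z] wf unfolding sub_z A_def by simp
      moreover have "e s \<in> A" using L_RTC_refl[of x y \<psi> s] wf by (auto simp: A_def)
      moreover have "b \<in> A" if ab: "a \<in> U" "b \<in> U" "a \<in> A" "hsat (M, D) (v\<^sub>0(x := a, y := b)) \<psi>" for a b
      proof -
        obtain r q where r: "a = e r" "wf_tm S\<^sub>0 r" "RTC x y \<psi> s r \<in> L" "b = e q" "wf_tm S\<^sub>0 q"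
          using ab(2,3) by (auto simp: A_def U_def)
        then show ?thesis using ab(4) step[of r q] L_RTC_trans[of x y \<psi> s r q] by (auto simp: A_def)
      qed
      ultimately have "e t \<in> A"
        using h wf unfolding RTC hsat.simps fst_conv snd_conv univ_M tm_val_v0[OF wf(3)] tm_val_v0[OF wf(4)]
        by blast
      then obtain r where "e t = e r" "wf_tm S\<^sub>0 r" "RTC x y \<psi> s r \<in> L" by (auto simp: A_def)
      then show "\<phi> \<in> L" using RTC wf e_eq_iff[of r t] L_RTC_eq[of x y \<psi> s r t] by simp
    qed
  qed
qed

text \<open>A closed set containing \<open>s\<close> is followed along the explicit path in
  \<open>L\<close>. The path is indexed from its target, with \<open>u 0 = t\<close> and
  \<open>u k\<close> equal to \<open>s\<close>, so induction on \<open>k\<close> moves forward from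
  source to target.\<close>

lemma truth_standard:
  assumes chain: "\<And>x y \<phi> s t. RTC x y \<phi> s t \<in> L \<Longrightarrow> \<exists>u k. u 0 = t \<and> (\<forall>j \<le> k. wf_tm S\<^sub>0 (u j)) \<and>
      Eq s (u k) \<in> L \<and> (\<forall>j < k. subst (Var(x := u (Suc j), y := u j)) \<phi> \<in> L)"
    and "wf_fm S\<^sub>0 \<phi>"
  shows "hsat (M, Pow U) v\<^sub>0 \<phi> \<longleftrightarrow> \<phi> \<in> L"
proof (rule truth[OF order_refl _ _ assms(2)])
  fix x y \<phi> s t A
  assume RTC: "RTC x y \<phi> s t \<in> L" and s: "e s \<in> A"
    and cl: "\<And>a b. wf_tm S\<^sub>0 a \<Longrightarrow> wf_tm S\<^sub>0 b \<Longrightarrow> e a \<in> A \<Longrightarrow> subst (Var(x := a, y := b)) \<phi> \<in> L \<Longrightarrow> e b \<in> A"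
  obtain u k where u: "u 0 = t" "\<And>j. j \<le> k \<Longrightarrow> wf_tm S\<^sub>0 (u j)" "Eq s (u k) \<in> L"
    "\<And>j. j < k \<Longrightarrow> subst (Var(x := u (Suc j), y := u j)) \<phi> \<in> L"
    using chain[OF RTC] by blast
  have "e s = e (u k)" using u(2)[of k] u(3) L_wf0[OF u(3)] e_eq_iff by simp
  then have "e (u k) \<in> A" using s by simp
  then have "e (u 0) \<in> A"
    using u(2,4)
  proof (induction k)
    case (Suc k)
    have "e (u k) \<in> A"
      by (rule cl[of "u (Suc k)"]) (use Suc.prems in \<open>simp_all del: fun_upd_apply\<close>)
    then show ?case
      by (rule Suc.IH) (use Suc.prems(2,3) in \<open>simp_all del: fun_upd_apply\<close>)
  qed simp
  then show "e t \<in> A" by (simp add: u(1))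
qed (auto simp: U_def)

text \<open>Parameters of definitions are absorbed into the terms occurring in
  \<open>\<psi>\<close>, since each element of \<open>U\<close> is named by a term.\<close>

definition D\<^sub>0 :: "'d set set" where
  "D\<^sub>0 = {{e r |r. wf_tm S\<^sub>0 r \<and> subst (Var(z := r)) \<psi> \<in> L} |\<psi> z. wf_fm S\<^sub>0 \<psi>}"

text \<open>Were \<open>e t\<close> outside a definable \<open>A\<close>, the induction property of
  the pair would supply variables forming a \<phi>-edge that leaves \<open>A\<close>, contradicting
  closedness.\<close>

lemma truth_henkin:
  assumes ind: "\<And>x y \<phi> s t z \<psi>. RTC x y \<phi> s t \<in> L \<Longrightarrow> wf_fm S\<^sub>0 \<psi> \<Longrightarrow> subst (Var(z := s)) \<psi> \<in> L \<Longrightarrow>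
      subst (Var(z := t)) \<psi> \<in> R \<Longrightarrow> \<exists>a b. subst (Var(z := Var a)) \<psi> \<in> L \<and>
        subst (Var(x := Var a, y := Var b)) \<phi> \<in> L \<and> subst (Var(z := Var b)) \<psi> \<in> R"
    and "wf_fm S\<^sub>0 \<phi>"
  shows "hsat (M, D\<^sub>0) v\<^sub>0 \<phi> \<longleftrightarrow> \<phi> \<in> L"
proof (rule truth[OF _ _ _ assms(2)])
  fix x y \<phi> s t A
  assume RTC: "RTC x y \<phi> s t \<in> L" and s: "e s \<in> A" and "A \<in> D\<^sub>0"
    and cl: "\<And>a b. wf_tm S\<^sub>0 a \<Longrightarrow> wf_tm S\<^sub>0 b \<Longrightarrow> e a \<in> A \<Longrightarrow> subst (Var(x := a, y := b)) \<phi> \<in> L \<Longrightarrow> e b \<in> A"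
  then obtain \<psi> z where A: "A = {e r |r. wf_tm S\<^sub>0 r \<and> subst (Var(z := r)) \<psi> \<in> L}" and \<psi>: "wf_fm S\<^sub>0 \<psi>"
    unfolding D\<^sub>0_def by blast
  \<comment> \<open>Leibniz for \<psi>: any single name of an element decides whether it belongs to
    \<open>A\<close>.\<close>
  have in_A: "e r \<in> A \<longleftrightarrow> subst (Var(z := r)) \<psi> \<in> L" if "wf_tm S\<^sub>0 r" for r
  proof
    assume "e r \<in> A"
    then obtain q where "e r = e q" "wf_tm S\<^sub>0 q" "subst (Var(z := q)) \<psi> \<in> L" unfolding A by blast
    then show "subst (Var(z := r)) \<psi> \<in> L" using that \<psi> L_Eq_subst[of q r z \<psi>] e_eq_iff[of q r] by simp
  qed (use that A in blast)
  have wf: "wf_tm S\<^sub>0 s" "wf_tm S\<^sub>0 t" using L_wf0[OF RTC] by auto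
  show "e t \<in> A"
  proof (rule ccontr)
    assume "e t \<notin> A"
    then have "subst (Var(z := t)) \<psi> \<in> R" using in_A wf \<psi> in_R_iff wf_subst1 by blast
    then obtain a b where ab: "subst (Var(z := Var a)) \<psi> \<in> L"
        "subst (Var(x := Var a, y := Var b)) \<phi> \<in> L" "subst (Var(z := Var b)) \<psi> \<in> R"
      using ind[OF RTC \<psi>] s in_A wf by blast
    then have "e (Var b) \<in> A" using cl[of "Var a" "Var b"] in_A[of "Var a"] by simp
    then show False using ab(3) in_A[of "Var b"] in_R_iff \<psi> wf_subst1 by simp
  qed
qed (auto simp: D\<^sub>0_def U_def)

end

section \<open>Comprehension for formulas over the full signature\<close>

primrec translate_tm :: "('f, 'p) signature \<Rightarrow> 'f \<Rightarrow> 'f tm \<Rightarrow> 'f tm" where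
  "translate_tm S c (Var x) = Var x"
| "translate_tm S c (Fun f ts) =
    (if f \<in> funs S then Fun f (map (translate_tm S c) ts) else Fun c [])"

text \<open>Eliminates foreign symbols in the way \<open>M\<close> interprets them: function terms
  collapse to the constant, and atoms become a contradiction. Truth in \<open>M\<close> is
  preserved, and the result lies in the language decided by \<open>L\<close>.\<close>

primrec translate :: "('f, 'p) signature \<Rightarrow> 'f \<Rightarrow> ('f, 'p) fm \<Rightarrow> ('f, 'p) fm" where
  "translate S c (Eq s t) = Eq (translate_tm S c s) (translate_tm S c t)"
| "translate S c (Pred P ts) =
    (if P \<in> preds S then Pred P (map (translate_tm S c) ts) else Neg (Eq (Fun c []) (Fun c [])))"
| "translate S c (Neg \<phi>) = Neg (translate S c \<phi>)"
| "translate S c (Conj \<phi> \<psi>) = Conj (translate S c \<phi>) (translate S c \<psi>)"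
| "translate S c (Disj \<phi> \<psi>) = Disj (translate S c \<phi>) (translate S c \<psi>)"
| "translate S c (Imp \<phi> \<psi>) = Imp (translate S c \<phi>) (translate S c \<psi>)"
| "translate S c (All x \<phi>) = All x (translate S c \<phi>)"
| "translate S c (Ex x \<phi>) = Ex x (translate S c \<phi>)"
| "translate S c (RTC x y \<phi> s t) =
    RTC x y (translate S c \<phi>) (translate_tm S c s) (translate_tm S c t)"

context term_model
begin

lemma wf_translate_tm: "wf_tm S t \<Longrightarrow> wf_tm S\<^sub>0 (translate_tm S\<^sub>0 c t)"
proof (induction t)
  case (Fun f ts)
  then show ?case using c(2) sub by (auto simp: list_all_iff sub_signature_def)
qed simp

lemma wf_translate: "wf_fm S \<phi> \<Longrightarrow> wf_fm S\<^sub>0 (translate S\<^sub>0 c \<phi>)"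
proof (induction \<phi>)
  case (Pred P ts)
  then show ?case using c(2) sub wf_translate_tm by (auto simp: list_all_iff sub_signature_def)
qed (simp_all add: wf_translate_tm)

lemma tm_val_translate: "tm_val M v (translate_tm S\<^sub>0 c t) = tm_val M v t"
proof (induction t)
  case (Fun f ts)
  have "map (tm_val M v \<circ> translate_tm S\<^sub>0 c) ts = map (tm_val M v) ts"
    using Fun by simp
  then have "fun_int M f (map (tm_val M v \<circ> translate_tm S\<^sub>0 c) ts) = fun_int M f (map (tm_val M v) ts)"
    by (rule arg_cong)
  moreover have "fun_int M c [] = e (Fun c [])" using fun_int_e[of c "[]"] by simp
  ultimately show ?case by (simp add: fun_int_foreign)
qed simp

lemma hsat_translate: "hsat (M, D) v (translate S\<^sub>0 c \<phi>) = hsat (M, D) v \<phi>"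
proof (induction \<phi> arbitrary: v)
  case (Pred P ts)
  have "map (tm_val M v \<circ> translate_tm S\<^sub>0 c) ts = map (tm_val M v) ts"
    by (simp add: tm_val_translate)
  then have "pred_int M P (map (tm_val M v \<circ> translate_tm S\<^sub>0 c) ts) = pred_int M P (map (tm_val M v) ts)"
    by (rule arg_cong)
  then show ?case by (simp add: pred_int_foreign)
qed (simp_all add: tm_val_translate hsat.simps(9))

text \<open>After translation, every free variable other than \<open>x\<close> is replaced by a term
  naming its value under \<open>v\<close>, and \<open>x\<close> by a fresh \<open>z\<close>. The
  resulting formula over \<open>S\<^sub>0\<close> defines the required set in the canonical
  valuation.\<close>

lemma henkin_struct_M:
  assumes truth: "\<And>\<phi>. wf_fm S\<^sub>0 \<phi> \<Longrightarrow> hsat (M, D\<^sub>0) v\<^sub>0 \<phi> \<longleftrightarrow> \<phi> \<in> L"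
  shows "henkin_struct S (M, D\<^sub>0)"
proof -
  have "{a \<in> U. hsat (M, D\<^sub>0) (v(x := a)) \<phi>} \<in> D\<^sub>0" if "wf_fm S \<phi>" "v \<in> valuations M" for \<phi> x v
  proof -
    define \<phi>' where "\<phi>' = translate S\<^sub>0 c \<phi>"
    have \<phi>': "wf_fm S\<^sub>0 \<phi>'" using that(1) by (simp add: \<phi>'_def wf_translate)
    define \<theta> where "\<theta> u = rep (v u)" for u
    have \<theta>: "wf_tm S\<^sub>0 (\<theta> u)" "e (\<theta> u) = v u" for u
      using rep that(2) by (auto simp: \<theta>_def valuations_def)
    \<comment> \<open>Freshness of \<open>z\<close> for all naming terms ensures that varying its
      value does not disturb the parameters.\<close>
    obtain z where z: "z \<notin> captured \<theta> (fv \<phi>')" using ex_fresh_var[of "captured \<theta> (fv \<phi>')"] by auto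
    define \<psi> where "\<psi> = subst (\<theta>(x := Var z)) \<phi>'"
    have \<psi>: "wf_fm S\<^sub>0 \<psi>" unfolding \<psi>_def using \<phi>' \<theta> by (intro wf_subst) auto
    have "subst (Var(z := r)) \<psi> \<in> L \<longleftrightarrow> hsat (M, D\<^sub>0) (v(x := e r)) \<phi>" if "wf_tm S\<^sub>0 r" for r
    proof -
      have "subst (Var(z := r)) \<psi> \<in> L \<longleftrightarrow> hsat (M, D\<^sub>0) (v\<^sub>0(z := e r)) \<psi>"
        using truth[OF wf_subst1[OF \<psi> that, of z]] that by (simp add: hsat_subst1 tm_val_v0)
      also have "\<dots> \<longleftrightarrow> hsat (M, D\<^sub>0) (v(x := e r)) \<phi>'"
        unfolding \<psi>_def hsat_subst
      proof (rule hsat_cong)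
        fix u assume "u \<in> fv \<phi>'"
        then have "z \<notin> fv_tm (\<theta> u)" using z notin_captured by blast
        then have "tm_val M (v\<^sub>0(z := e r)) (\<theta> u) = tm_val M v\<^sub>0 (\<theta> u)" by (auto intro: tm_val_cong)
        then show "tm_val (fst (M, D\<^sub>0)) (v\<^sub>0(z := e r)) ((\<theta>(x := Var z)) u) = (v(x := e r)) u"
          using \<theta> by (simp add: tm_val_v0)
      qed
      finally show ?thesis by (simp add: \<phi>'_def hsat_translate)
    qed
    then have "{a \<in> U. hsat (M, D\<^sub>0) (v(x := a)) \<phi>} = {e r |r. wf_tm S\<^sub>0 r \<and> subst (Var(z := r)) \<psi> \<in> L}"
      by (auto simp: U_def)
    then show ?thesis using \<psi> unfolding D\<^sub>0_def by blast
  qed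
  moreover have "D\<^sub>0 \<subseteq> Pow U" by (auto simp: D\<^sub>0_def)
  ultimately show ?thesis by (simp add: henkin_struct_def fo_struct_M)
qed

end

section \<open>Generic saturation\<close>

instance tm :: (countable) countable
  by countable_datatype

instance fm :: (countable, countable) countable
  by countable_datatype

lemma set_tm_wf: "wf_tm S t \<Longrightarrow> set_tm t \<subseteq> funs S"
  by (induction t) (auto simp: list_all_iff)

lemma set_fm_wf: "wf_fm S \<phi> \<Longrightarrow> set1_fm \<phi> \<subseteq> funs S \<and> set2_fm \<phi> \<subseteq> preds S"
proof (induction \<phi>)
  case (Pred P ts)
  then have "set_tm t \<subseteq> funs S" if "t \<in> set ts" for t
    using that set_tm_wf by (auto simp: list_all_iff)
  then show ?case using Pred by auto
qed (auto dest!: set_tm_wf)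

text \<open>The type of symbols may be uncountable. Coding the symbols of the signature by numbers
  is injective on well-formed terms, and terms over numbers are countable.\<close>

lemma countable_wf_tm:
  assumes "countable (funs S)"
  shows "countable {t. wf_tm S t}"
proof -
  let ?f = "map_tm (to_nat_on (funs S))"
  have "inj_on ?f {t. wf_tm S t}"
  proof (rule inj_onI)
    fix s t assume "s \<in> {t. wf_tm S t}" "t \<in> {t. wf_tm S t}" and eq: "?f s = ?f t"
    then have "set_tm s \<subseteq> funs S" "set_tm t \<subseteq> funs S" using set_tm_wf by auto
    then show "s = t"
      using assms by (intro tm.inj_map_strong[OF _ eq]) (auto simp: subset_iff)
  qed
  then show ?thesis
    using countable_image_inj_on[of ?f] by blast
qed

lemma countable_wf_fm:
  assumes "countable (funs S)" "countable (preds S)"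
  shows "countable {\<phi>. wf_fm S \<phi>}"
proof -
  let ?f = "map_fm (to_nat_on (funs S)) (to_nat_on (preds S))"
  have "inj_on ?f {\<phi>. wf_fm S \<phi>}"
  proof (rule inj_onI)
    fix \<phi> \<psi> assume "\<phi> \<in> {\<phi>. wf_fm S \<phi>}" "\<psi> \<in> {\<phi>. wf_fm S \<phi>}" and eq: "?f \<phi> = ?f \<psi>"
    then have "set1_fm \<phi> \<subseteq> funs S" "set1_fm \<psi> \<subseteq> funs S" "set2_fm \<phi> \<subseteq> preds S" "set2_fm \<psi> \<subseteq> preds S"
      using set_fm_wf by auto
    then show "\<phi> = \<psi>"
      using assms by (intro fm.inj_map_strong[OF _ _ eq]) (auto simp: subset_iff)
  qed
  then show ?thesis
    using countable_image_inj_on[of ?f] by blast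
qed

section \<open>Dense conditions and generic chains\<close>

definition seq_le :: "('f, 'p) seq \<Rightarrow> ('f, 'p) seq \<Rightarrow> bool" where
  "seq_le \<sigma> \<sigma>' \<longleftrightarrow> fst \<sigma> |\<subseteq>| fst \<sigma>' \<and> snd \<sigma> |\<subseteq>| snd \<sigma>'"

definition dense :: "(('f, 'p) seq \<Rightarrow> bool) \<Rightarrow> (('f, 'p) seq \<Rightarrow> bool) \<Rightarrow> bool" where
  "dense G C \<longleftrightarrow> (\<forall>\<sigma>. G \<sigma> \<longrightarrow> (\<exists>\<sigma>'. seq_le \<sigma> \<sigma>' \<and> G \<sigma>' \<and> C \<sigma>'))"

lemma seq_le_refl: "seq_le \<sigma> \<sigma>"
  by (simp add: seq_le_def)

lemma seq_le_trans: "seq_le \<sigma> \<sigma>' \<Longrightarrow> seq_le \<sigma>' \<sigma>'' \<Longrightarrow> seq_le \<sigma> \<sigma>''"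
  by (auto simp: seq_le_def)

lemma dense_True: "dense G (\<lambda>_. True)" "dense G (\<lambda>(\<Gamma>, \<Delta>). True)"
  unfolding dense_def using seq_le_refl by fastforce+

text \<open>The Rasiowa-Sikorski argument: conditions are enumerated, and the condition with index
  \<open>n\<close> is met in passing to stage \<open>Suc n\<close>.\<close>

lemma generic_chain:
  assumes "countable \<C>" "\<And>C. C \<in> \<C> \<Longrightarrow> dense G C" "G \<sigma>\<^sub>0"
  shows "\<exists>f. f 0 = \<sigma>\<^sub>0 \<and> (\<forall>n. G (f n) \<and> seq_le (f n) (f (Suc n))) \<and> (\<forall>C \<in> \<C>. \<exists>n. C (f n))"
proof -
  \<comment> \<open>The trivial condition makes the family nonempty, so that it can be
    enumerated.\<close>
  define \<D> where "\<D> = insert (\<lambda>_. True) \<C>"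
  have \<D>: "countable \<D>" "\<D> \<noteq> {}" "\<And>C. C \<in> \<D> \<Longrightarrow> dense G C"
    using assms(1,2) dense_True by (auto simp: \<D>_def)
  define e where "e = from_nat_into \<D>"
  have "\<exists>f. \<forall>n :: nat. (G (f n) \<and> (n = 0 \<longrightarrow> f n = \<sigma>\<^sub>0)) \<and> (seq_le (f n) (f (Suc n)) \<and> e n (f (Suc n)))"
  proof (rule dependent_nat_choice)
    show "\<exists>\<sigma>. G \<sigma> \<and> ((0::nat) = 0 \<longrightarrow> \<sigma> = \<sigma>\<^sub>0)" using assms(3) by blast
    fix \<sigma> and n :: nat assume "G \<sigma> \<and> (n = 0 \<longrightarrow> \<sigma> = \<sigma>\<^sub>0)"
    moreover have "dense G (e n)"
      using \<D>(3) from_nat_into[OF \<D>(2)] by (simp add: e_def)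
    ultimately show "\<exists>\<sigma>'. (G \<sigma>' \<and> (Suc n = 0 \<longrightarrow> \<sigma>' = \<sigma>\<^sub>0)) \<and> (seq_le \<sigma> \<sigma>' \<and> e n \<sigma>')"
      unfolding dense_def by blast
  qed
  then obtain f where f: "\<And>n. G (f n)" "f 0 = \<sigma>\<^sub>0" "\<And>n. seq_le (f n) (f (Suc n))" "\<And>n. e n (f (Suc n))"
    by blast
  have "\<exists>n. C (f n)" if "C \<in> \<C>" for C
  proof -
    have "C \<in> \<D>" using that by (simp add: \<D>_def)
    then obtain n where "e n = C" using from_nat_into_surj[OF \<D>(1)] by (auto simp: e_def)
    then show ?thesis using f(4)[of n] by blast
  qed
  then show ?thesis using f by blast
qed

locale generic = prover S c pr prov
  for S :: "('f, 'p) signature" and c pr :: 'f and prov :: "('f, 'p) seq \<Rightarrow> bool" +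
  fixes S\<^sub>0 :: "('f, 'p) signature"
  assumes sub: "sub_signature S\<^sub>0 S" and c0: "c \<in> funs S\<^sub>0" and pr0: "pr \<in> funs S\<^sub>0"
    and countable_fm: "countable {\<phi>. wf_fm S\<^sub>0 \<phi>}"
begin

definition good :: "('f, 'p) seq \<Rightarrow> bool" where
  "good \<sigma> \<longleftrightarrow> wf_seq S\<^sub>0 \<sigma> \<and> \<not> prov \<sigma>"

lemma wf_seq_S: "wf_seq S\<^sub>0 \<sigma> \<Longrightarrow> wf_seq S \<sigma>"
  using wf_fm_sub[OF sub] by (auto simp: wf_seq_def)

text \<open>(Cut) read backwards.\<close>

lemma good_decide:
  assumes "good (\<Gamma>, \<Delta>)" "wf_fm S\<^sub>0 \<phi>"
  shows "good (finsert \<phi> \<Gamma>, \<Delta>) \<or> good (\<Gamma>, finsert \<phi> \<Delta>)"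
proof (rule ccontr)
  assume "\<not> ?thesis"
  then have "prov (finsert \<phi> \<Gamma>, \<Delta>)" "prov (\<Gamma>, finsert \<phi> \<Delta>)"
    using assms by (auto simp: good_def)
  then have "prov (\<Gamma>, \<Delta>)"
    using assms(1) wf_seq_S by (intro prov_lk[OF lk_rule.Cut[where \<phi> = \<phi>]]) (auto simp: good_def)
  then show False using assms(1) by (simp add: good_def)
qed

lemma dense_decide:
  assumes "wf_fm S\<^sub>0 \<phi>"
  shows "dense good (\<lambda>(\<Gamma>, \<Delta>). \<phi> |\<in>| \<Gamma> \<or> \<phi> |\<in>| \<Delta>)"
  unfolding dense_def
proof (intro allI impI)
  fix \<sigma> assume \<sigma>: "good \<sigma>"
  obtain \<Gamma> \<Delta> where [simp]: "\<sigma> = (\<Gamma>, \<Delta>)" by (cases \<sigma>)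
  have "seq_le \<sigma> (finsert \<phi> \<Gamma>, \<Delta>)" "seq_le \<sigma> (\<Gamma>, finsert \<phi> \<Delta>)" by (auto simp: seq_le_def)
  then show "\<exists>\<sigma>'. seq_le \<sigma> \<sigma>' \<and> good \<sigma>' \<and> (case \<sigma>' of (\<Gamma>, \<Delta>) \<Rightarrow> \<phi> |\<in>| \<Gamma> \<or> \<phi> |\<in>| \<Delta>)"
    using good_decide[of \<Gamma> \<Delta> \<phi>] \<sigma> assms by fastforce
qed

lemma decide:
  assumes "good \<sigma>" "wf_fm S\<^sub>0 \<phi>"
  obtains \<Gamma> \<Delta> where "seq_le \<sigma> (\<Gamma>, \<Delta>)" "good (\<Gamma>, \<Delta>)" "\<phi> |\<in>| \<Gamma> \<or> \<phi> |\<in>| \<Delta>"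
  using dense_decide[OF assms(2)] assms(1) unfolding dense_def by fastforce

text \<open>A finite sequent always leaves a fresh eigenvariable, so (AllR) read backwards adds a
  variable witness without making the sequent provable.\<close>

lemma dense_All:
  assumes wf: "wf_fm S\<^sub>0 (All x \<phi>)"
  shows "dense good (\<lambda>(\<Gamma>, \<Delta>). All x \<phi> |\<in>| \<Gamma> \<or> (\<exists>z. subst (Var(x := Var z)) \<phi> |\<in>| \<Delta>))"
  unfolding dense_def
proof (intro allI impI)
  fix \<sigma> assume "good \<sigma>"
  then obtain \<Gamma> \<Delta> where \<sigma>: "seq_le \<sigma> (\<Gamma>, \<Delta>)" "good (\<Gamma>, \<Delta>)" "All x \<phi> |\<in>| \<Gamma> \<or> All x \<phi> |\<in>| \<Delta>"
    by (rule decide[OF _ wf])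
  show "\<exists>\<sigma>'. seq_le \<sigma> \<sigma>' \<and> good \<sigma>' \<and>
      (case \<sigma>' of (\<Gamma>, \<Delta>) \<Rightarrow> All x \<phi> |\<in>| \<Gamma> \<or> (\<exists>z. subst (Var(x := Var z)) \<phi> |\<in>| \<Delta>))"
  proof (cases "All x \<phi> |\<in>| \<Gamma>")
    case False
    \<comment> \<open>Succedents are sets: the universal formula can be principal and still remain
      in the premise, so the sequent only grows.\<close>
    then have \<Delta>: "finsert (All x \<phi>) \<Delta> = \<Delta>" using \<sigma>(3) by auto
    obtain z where z: "z \<notin> fv_set \<Gamma> \<union> fv_set \<Delta> \<union> fv (All x \<phi>)"
      using ex_fresh_var[of "fv_set \<Gamma> \<union> fv_set \<Delta> \<union> fv (All x \<phi>)"] by auto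
    let ?\<Delta> = "finsert (subst (Var(x := Var z)) \<phi>) \<Delta>"
    have "\<not> prov (\<Gamma>, ?\<Delta>)"
      using prov_lk[OF lk_rule.AllR[OF z]] \<sigma>(2) wf_seq_S unfolding \<Delta> good_def by auto
    moreover have "wf_fm S\<^sub>0 (subst (Var(x := Var z)) \<phi>)" using wf by (intro wf_subst) auto
    ultimately have "good (\<Gamma>, ?\<Delta>)" using \<sigma>(2) by (simp add: good_def)
    moreover have "seq_le \<sigma> (\<Gamma>, ?\<Delta>)" using \<sigma>(1) by (auto simp: seq_le_def)
    ultimately show ?thesis by blast
  qed (use \<sigma> in blast)
qed

lemma dense_Ex:
  assumes wf: "wf_fm S\<^sub>0 (Ex x \<phi>)"
  shows "dense good (\<lambda>(\<Gamma>, \<Delta>). Ex x \<phi> |\<in>| \<Delta> \<or> (\<exists>z. subst (Var(x := Var z)) \<phi> |\<in>| \<Gamma>))"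
  unfolding dense_def
proof (intro allI impI)
  fix \<sigma> assume "good \<sigma>"
  then obtain \<Gamma> \<Delta> where \<sigma>: "seq_le \<sigma> (\<Gamma>, \<Delta>)" "good (\<Gamma>, \<Delta>)" "Ex x \<phi> |\<in>| \<Gamma> \<or> Ex x \<phi> |\<in>| \<Delta>"
    by (rule decide[OF _ wf])
  show "\<exists>\<sigma>'. seq_le \<sigma> \<sigma>' \<and> good \<sigma>' \<and>
      (case \<sigma>' of (\<Gamma>, \<Delta>) \<Rightarrow> Ex x \<phi> |\<in>| \<Delta> \<or> (\<exists>z. subst (Var(x := Var z)) \<phi> |\<in>| \<Gamma>))"
  proof (cases "Ex x \<phi> |\<in>| \<Delta>")
    case False
    then have \<Gamma>: "finsert (Ex x \<phi>) \<Gamma> = \<Gamma>" using \<sigma>(3) by auto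
    obtain z where z: "z \<notin> fv_set \<Gamma> \<union> fv_set \<Delta> \<union> fv (Ex x \<phi>)"
      using ex_fresh_var[of "fv_set \<Gamma> \<union> fv_set \<Delta> \<union> fv (Ex x \<phi>)"] by auto
    let ?\<Gamma> = "finsert (subst (Var(x := Var z)) \<phi>) \<Gamma>"
    have "\<not> prov (?\<Gamma>, \<Delta>)"
      using prov_lk[OF lk_rule.ExL[OF z]] \<sigma>(2) wf_seq_S unfolding \<Gamma> good_def by auto
    moreover have "wf_fm S\<^sub>0 (subst (Var(x := Var z)) \<phi>)" using wf by (intro wf_subst) auto
    ultimately have "good (?\<Gamma>, \<Delta>)" using \<sigma>(2) by (simp add: good_def)
    moreover have "seq_le \<sigma> (?\<Gamma>, \<Delta>)" using \<sigma>(1) by (auto simp: seq_le_def)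
    ultimately show ?thesis by blast
  qed (use \<sigma> in blast)
qed

text \<open>A condition is met at some stage and may fail at later ones; what is passed on is a pair
  of finite parts of \<open>L\<close> and \<open>R\<close> that satisfies it.\<close>

lemma saturation:
  assumes "good (\<Gamma>\<^sub>0, \<Delta>\<^sub>0)" "countable \<C>" "\<And>C. C \<in> \<C> \<Longrightarrow> dense good C"
  shows "\<exists>L R. saturated S c pr prov S\<^sub>0 L R \<and> fset \<Gamma>\<^sub>0 \<subseteq> L \<and> fset \<Delta>\<^sub>0 \<subseteq> R \<and>
    (\<forall>C \<in> \<C>. \<exists>\<Gamma> \<Delta>. fset \<Gamma> \<subseteq> L \<and> fset \<Delta> \<subseteq> R \<and> C (\<Gamma>, \<Delta>))"
proof -
  define dec where "dec \<phi> = (\<lambda>(\<Gamma>, \<Delta>). \<phi> |\<in>| \<Gamma> \<or> \<phi> |\<in>| \<Delta>)" for \<phi> :: "('f, 'p) fm"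
  \<comment> \<open>Vacuous unless \<psi> is universal, so these conditions can be indexed by the
    countable set of all formulas over \<open>S\<^sub>0\<close>.\<close>
  define al where "al \<psi> = (\<lambda>(\<Gamma>, \<Delta>). \<forall>x \<phi>. \<psi> = All x \<phi> \<longrightarrow>
    All x \<phi> |\<in>| \<Gamma> \<or> (\<exists>z. subst (Var(x := Var z)) \<phi> |\<in>| \<Delta>))" for \<psi> :: "('f, 'p) fm"
  define ex where "ex \<psi> = (\<lambda>(\<Gamma>, \<Delta>). \<forall>x \<phi>. \<psi> = Ex x \<phi> \<longrightarrow>
    Ex x \<phi> |\<in>| \<Delta> \<or> (\<exists>z. subst (Var(x := Var z)) \<phi> |\<in>| \<Gamma>))" for \<psi> :: "('f, 'p) fm"
  define \<D> where "\<D> = \<C> \<union> dec ` {\<phi>. wf_fm S\<^sub>0 \<phi>} \<union> al ` {\<phi>. wf_fm S\<^sub>0 \<phi>} \<union> ex ` {\<phi>. wf_fm S\<^sub>0 \<phi>}"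
  have "dense good (dec \<phi>)" if "wf_fm S\<^sub>0 \<phi>" for \<phi>
    using dense_decide[OF that] by (simp add: dec_def)
  moreover have "dense good (al \<psi>)" if "wf_fm S\<^sub>0 \<psi>" for \<psi>
    using that dense_All dense_True by (cases \<psi>) (auto simp: al_def)
  moreover have "dense good (ex \<psi>)" if "wf_fm S\<^sub>0 \<psi>" for \<psi>
    using that dense_Ex dense_True by (cases \<psi>) (auto simp: ex_def)
  ultimately have "C \<in> \<D> \<Longrightarrow> dense good C" for C
    using assms(3) unfolding \<D>_def by blast
  moreover have "countable \<D>" using assms(2) countable_fm by (simp add: \<D>_def)
  ultimately obtain f where f: "f 0 = (\<Gamma>\<^sub>0, \<Delta>\<^sub>0)" "\<And>n. good (f n)" "\<And>n. seq_le (f n) (f (Suc n))"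
    "\<And>C. C \<in> \<D> \<Longrightarrow> \<exists>n. C (f n)"
    using generic_chain[of \<D> good "(\<Gamma>\<^sub>0, \<Delta>\<^sub>0)"] assms(1) by blast
  define L where "L = (\<Union>n. fset (fst (f n)))"
  define R where "R = (\<Union>n. fset (snd (f n)))"
  have mono: "seq_le (f m) (f n)" if "m \<le> n" for m n
    using that by (induction rule: dec_induct) (auto intro: seq_le_refl seq_le_trans f(3))
  have sub_n: "fset (fst (f n)) \<subseteq> L" "fset (snd (f n)) \<subseteq> R" for n
    by (auto simp: L_def R_def)
  have meets: "\<exists>\<Gamma> \<Delta>. fset \<Gamma> \<subseteq> L \<and> fset \<Delta> \<subseteq> R \<and> C (\<Gamma>, \<Delta>)" if "C \<in> \<D>" for C
    using f(4)[OF that] sub_n by (metis prod.collapse)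
  \<comment> \<open>Consistency of the limit reduces to that of the stages: a finite part of the
    union lies within a single stage.\<close>
  have absorb: "\<exists>n. \<Gamma> |\<subseteq>| fst (f n)" if "fset \<Gamma> \<subseteq> L" for \<Gamma>
    using that
  proof (induction \<Gamma>)
    case (insert \<phi> \<Gamma>)
    then obtain m n where "\<Gamma> |\<subseteq>| fst (f m)" "\<phi> |\<in>| fst (f n)" by (auto simp: L_def)
    then have "finsert \<phi> \<Gamma> |\<subseteq>| fst (f (max m n))"
      using mono[of m "max m n"] mono[of n "max m n"] by (auto simp: seq_le_def)
    then show ?case by blast
  qed auto
  have absorb': "\<exists>n. \<Delta> |\<subseteq>| snd (f n)" if "fset \<Delta> \<subseteq> R" for \<Delta>
    using that
  proof (induction \<Delta>)
    case (insert \<phi> \<Delta>)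
    then obtain m n where "\<Delta> |\<subseteq>| snd (f m)" "\<phi> |\<in>| snd (f n)" by (auto simp: R_def)
    then have "finsert \<phi> \<Delta> |\<subseteq>| snd (f (max m n))"
      using mono[of m "max m n"] mono[of n "max m n"] by (auto simp: seq_le_def)
    then show ?case by blast
  qed auto
  have cons: "\<not> prov (\<Gamma>, \<Delta>)" if LR: "fset \<Gamma> \<subseteq> L" "fset \<Delta> \<subseteq> R" for \<Gamma> \<Delta>
  proof
    assume p: "prov (\<Gamma>, \<Delta>)"
    obtain m n where "\<Gamma> |\<subseteq>| fst (f m)" "\<Delta> |\<subseteq>| snd (f n)"
      using absorb[OF LR(1)] absorb'[OF LR(2)] by blast
    then have "\<Gamma> |\<subseteq>| fst (f (max m n))" "\<Delta> |\<subseteq>| snd (f (max m n))"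
      using mono[of m "max m n"] mono[of n "max m n"] by (auto simp: seq_le_def)
    then have "prov (f (max m n))"
      using prov_weaken[OF p, of "fst (f (max m n))" "snd (f (max m n))"] f(2) wf_seq_S
      by (auto simp: good_def)
    then show False using f(2) by (simp add: good_def)
  qed
  have tot: "\<phi> \<in> L \<or> \<phi> \<in> R" if "wf_fm S\<^sub>0 \<phi>" for \<phi>
  proof -
    have "dec \<phi> \<in> \<D>" using that by (simp add: \<D>_def)
    from meets[OF this] show ?thesis by (auto simp: dec_def)
  qed
  have wf: "wf_fm S\<^sub>0 \<phi>" if LR: "\<phi> \<in> L \<union> R" for \<phi>
  proof -
    obtain n where "\<phi> |\<in>| fst (f n) |\<union>| snd (f n)" using LR by (auto simp: L_def R_def)
    then show ?thesis using f(2)[of n] by (auto simp: good_def wf_seq_def)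
  qed
  \<comment> \<open>Rules out the trivial alternative in the quantifier conditions, leaving the
    witness.\<close>
  have disj: "\<phi> \<notin> R" if "\<phi> \<in> L" for \<phi>
    using cons[of "{|\<phi>|}" "{|\<phi>|}"] prov_ax[of "{|\<phi>|}" "{|\<phi>|}" \<phi>] that wf[of \<phi>] wf_fm_sub[OF sub]
    by auto
  have "saturated S c pr prov S\<^sub>0 L R"
  proof (unfold_locales)
    show "sub_signature S\<^sub>0 S" "c \<in> funs S\<^sub>0" "pr \<in> funs S\<^sub>0" by (fact sub c0 pr0)+
    show "L \<union> R \<subseteq> {\<phi>. wf_fm S\<^sub>0 \<phi>}" using wf by blast
    show "\<exists>z. subst (Var(x := Var z)) \<phi> \<in> R" if "All x \<phi> \<in> R" for x \<phi>
    proof -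
      have "wf_fm S\<^sub>0 (All x \<phi>)" using wf that by blast
      then have "al (All x \<phi>) \<in> \<D>" unfolding \<D>_def by blast
      from meets[OF this] show ?thesis using disj that by (auto simp: al_def)
    qed
    show "\<exists>z. subst (Var(x := Var z)) \<phi> \<in> L" if "Ex x \<phi> \<in> L" for x \<phi>
    proof -
      have "wf_fm S\<^sub>0 (Ex x \<phi>)" using wf that by blast
      then have "ex (Ex x \<phi>) \<in> \<D>" unfolding \<D>_def by blast
      from meets[OF this] show ?thesis using disj that by (auto simp: ex_def)
    qed
  qed (use cons tot in auto)
  moreover have "fset \<Gamma>\<^sub>0 \<subseteq> L" "fset \<Delta>\<^sub>0 \<subseteq> R" using sub_n[of 0] by (simp_all add: f(1))
  moreover have "\<forall>C \<in> \<C>. \<exists>\<Gamma> \<Delta>. fset \<Gamma> \<subseteq> L \<and> fset \<Delta> \<subseteq> R \<and> C (\<Gamma>, \<Delta>)"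
    using meets by (simp add: \<D>_def)
  ultimately show ?thesis by blast
qed

end

text \<open>An infinite type contains a copy of the natural numbers. A term is sent to the copy of
  the least index at which the enumeration of terms has a term provably equal to it, so equal values
  mean provable equality.\<close>

lemma (in saturated) ex_naming:
  assumes "infinite (UNIV :: 'd set)" "countable (funs S\<^sub>0)"
  shows "\<exists>e :: 'f tm \<Rightarrow> 'd. term_model S c pr prov S\<^sub>0 L R e"
proof -
  obtain g :: "nat \<Rightarrow> 'd" where g: "inj g"
    using infinite_countable_subset[OF assms(1)] by blast
  define d where "d = from_nat_into {t. wf_tm S\<^sub>0 t}"
  have d: "\<exists>n. Eq t (d n) \<in> L" if "wf_tm S\<^sub>0 t" for t
    using from_nat_into_surj[OF countable_wf_tm[OF assms(2)], of t] L_Eq_refl[OF that] that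
    by (auto simp: d_def)
  define k where "k t = (LEAST n. Eq t (d n) \<in> L)" for t
  have k: "Eq t (d (k t)) \<in> L" if "wf_tm S\<^sub>0 t" for t
    unfolding k_def using d[OF that] by (rule LeastI_ex)
  have "g (k s) = g (k t) \<longleftrightarrow> Eq s t \<in> L" if "wf_tm S\<^sub>0 s" "wf_tm S\<^sub>0 t" for s t
  proof
    assume "g (k s) = g (k t)"
    then have "k s = k t" using g by (simp add: inj_eq)
    then show "Eq s t \<in> L" using k[OF that(1)] k[OF that(2)] L_Eq_sym L_Eq_trans by metis
  next
    assume "Eq s t \<in> L"
    then have "Eq s (d n) \<in> L \<longleftrightarrow> Eq t (d n) \<in> L" for n using L_Eq_sym L_Eq_trans by metis
    then show "g (k s) = g (k t)" by (simp add: k_def)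
  qed
  then have "term_model S c pr prov S\<^sub>0 L R (\<lambda>t. g (k t))" by unfold_locales
  then show ?thesis by blast
qed

section \<open>Restriction to finitely many symbols\<close>

lemma finite_set_tm: "finite (set_tm t)"
  by (induction t) auto

lemma finite_set_fm: "finite (set1_fm \<phi>)" "finite (set2_fm \<phi>)"
  by (induction \<phi>) (auto simp: finite_set_tm)

lemma wf_tm_restrict:
  "wf_tm S t \<Longrightarrow> set_tm t \<subseteq> F \<Longrightarrow> wf_tm (S\<lparr>funs := F, preds := P\<rparr>) t"
  by (induction t) (auto simp: list_all_iff)

lemma wf_fm_restrict:
  "wf_fm S \<phi> \<Longrightarrow> set1_fm \<phi> \<subseteq> F \<Longrightarrow> set2_fm \<phi> \<subseteq> P \<Longrightarrow> wf_fm (S\<lparr>funs := F, preds := P\<rparr>) \<phi>"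
proof (induction \<phi>)
  case (Pred Q ts)
  then have "wf_tm (S\<lparr>funs := F, preds := P\<rparr>) t" if "t \<in> set ts" for t
    using that by (intro wf_tm_restrict) (auto simp: list_all_iff)
  then show ?case using Pred by (auto simp: list_all_iff)
qed (auto intro: wf_tm_restrict)

lemma ex_finite_sub_signature:
  assumes "wf_seq S \<sigma>" "c \<in> funs S" "pr \<in> funs S"
  obtains S\<^sub>0 where "sub_signature S\<^sub>0 S" "finite (funs S\<^sub>0)" "finite (preds S\<^sub>0)" "c \<in> funs S\<^sub>0"
    "pr \<in> funs S\<^sub>0" "wf_seq S\<^sub>0 \<sigma>"
proof -
  let ?A = "fset (fst \<sigma> |\<union>| snd \<sigma>)"
  \<comment> \<open>The constant and the pairing symbol are added even if the sequent does not
    mention them: the model must interpret both as intended, and the constant is also the default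
    value.\<close>
  define F where "F = insert c (insert pr (\<Union> (set1_fm ` ?A)))"
  define P where "P = \<Union> (set2_fm ` ?A)"
  have wf: "wf_fm S \<phi>" if "\<phi> \<in> ?A" for \<phi> using assms(1) that by (auto simp: wf_seq_def)
  then have "F \<subseteq> funs S" "P \<subseteq> preds S" using assms(2,3) set_fm_wf by (fastforce simp: F_def P_def)+
  moreover have "finite F" "finite P" by (auto simp: F_def P_def finite_set_fm)
  moreover have "wf_fm (S\<lparr>funs := F, preds := P\<rparr>) \<phi>" if "\<phi> \<in> ?A" for \<phi>
    using wf[OF that] that by (intro wf_fm_restrict) (auto simp: F_def P_def)
  ultimately show thesis
    using that[of "S\<lparr>funs := F, preds := P\<rparr>"]
    by (auto simp: sub_signature_def wf_seq_def F_def)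
qed

section \<open>Completeness for the standard semantics\<close>

text \<open>Paths run backwards from the target because (Case) keeps the source and replaces the
  target. For formulas other than \<open>RTC\<close> the condition is vacuous.\<close>

definition chain_condition :: "('f, 'p) signature \<Rightarrow> ('f, 'p) fm \<Rightarrow> ('f, 'p) seq \<Rightarrow> bool" where
  "chain_condition S \<tau> = (\<lambda>(\<Gamma>, \<Delta>). \<forall>x y \<phi> s t. \<tau> = RTC x y \<phi> s t \<longrightarrow> \<tau> |\<in>| \<Delta> \<or>
    (\<exists>u k. u 0 = t \<and> (\<forall>j \<le> k. wf_tm S (u j)) \<and> Eq s (u k) |\<in>| \<Gamma> \<and>
      (\<forall>j < k. subst (Var(x := u (Suc j), y := u j)) \<phi> |\<in>| \<Gamma>)))"

text \<open>The \<omega>-rule, assumed as \<open>unfold\<close>, is used contrapositively: when the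
  \<open>RTC\<close> formula stands on the left of an unprovable sequent, one of its finite
  unfoldings closed off by an equation is unprovable as well.\<close>

lemma (in generic) dense_chain_condition:
  assumes unfold: "\<And>x y \<phi> s u z G \<Delta>.
      (\<And>k. wf_seq S (finsert (RTC x y \<phi> s (u k)) (G k), \<Delta>)) \<Longrightarrow> (\<And>k. u (Suc k) = Var (z k)) \<Longrightarrow>
      (\<And>k. G (Suc k) = finsert (subst (Var(x := Var (z k), y := u k)) \<phi>) (G k)) \<Longrightarrow>
      (\<And>k. z k \<notin> fv_set (G k) \<union> fv_set \<Delta> \<union> fv (RTC x y \<phi> s (u k))) \<Longrightarrow>
      (\<And>k. prov (finsert (Eq s (u k)) (G k), \<Delta>)) \<Longrightarrow> prov (finsert (RTC x y \<phi> s (u 0)) (G 0), \<Delta>)"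
    and "wf_fm S\<^sub>0 \<tau>"
  shows "dense good (chain_condition S\<^sub>0 \<tau>)"
proof (cases "\<exists>x y \<phi> s t. \<tau> = RTC x y \<phi> s t")
  case False
  then have "chain_condition S\<^sub>0 \<tau> = (\<lambda>_. True)" by (auto simp: chain_condition_def)
  then show ?thesis by (simp add: dense_True)
next
  case True
  then obtain x y \<phi> s t where \<tau>: "\<tau> = RTC x y \<phi> s t" by blast
  then have wf: "wf_fm S\<^sub>0 \<phi>" "wf_tm S\<^sub>0 s" "wf_tm S\<^sub>0 t" "x \<noteq> y" using assms(2) by auto
  show ?thesis
    unfolding dense_def
  proof (intro allI impI)
    fix \<sigma> assume "good \<sigma>"
    then obtain \<Gamma> \<Delta> where \<sigma>: "seq_le \<sigma> (\<Gamma>, \<Delta>)" "good (\<Gamma>, \<Delta>)" "\<tau> |\<in>| \<Gamma> \<or> \<tau> |\<in>| \<Delta>"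
      by (rule decide[OF _ assms(2)])
    show "\<exists>\<sigma>'. seq_le \<sigma> \<sigma>' \<and> good \<sigma>' \<and> chain_condition S\<^sub>0 \<tau> \<sigma>'"
    proof (cases "\<tau> |\<in>| \<Delta>")
      case True
      then have "chain_condition S\<^sub>0 \<tau> (\<Gamma>, \<Delta>)" by (auto simp: chain_condition_def)
      then show ?thesis using \<sigma> by blast
    next
      case False
      then have \<Gamma>: "finsert \<tau> \<Gamma> = \<Gamma>" using \<sigma>(3) by auto
      \<comment> \<open>All variables from \<open>N\<close> on are fresh, which gives one
        eigenvariable \<open>N + k\<close> for each unfolding step.\<close>
      obtain N where N: "fv_set \<Gamma> \<union> fv_set \<Delta> \<union> fv \<tau> \<subseteq> {..<N}"
        using finite_nat_set_iff_bounded[of "fv_set \<Gamma> \<union> fv_set \<Delta> \<union> fv \<tau>"] by auto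
      define u :: "nat \<Rightarrow> 'f tm" where "u = case_nat t (\<lambda>k. Var (N + k))"
      define G where "G = rec_nat \<Gamma> (\<lambda>k. finsert (subst (Var(x := Var (N + k), y := u k)) \<phi>))"
      have u: "u 0 = t" "u (Suc k) = Var (N + k)" for k by (simp_all add: u_def)
      have G: "G 0 = \<Gamma>" "G (Suc k) = finsert (subst (Var(x := Var (N + k), y := u k)) \<phi>) (G k)" for k
        by (simp_all add: G_def)
      have wf_u: "wf_tm S\<^sub>0 (u k)" for k using wf by (cases k) (simp_all add: u)
      have fv_u: "fv_tm (u k) \<subseteq> {..<N + k}" for k using N \<tau> by (cases k) (auto simp: u)
      have fv_G: "fv_set (G k) \<subseteq> {..<N + k}" for k
      proof (induction k)
        case (Suc k)
        have "captured (Var(x := Var (N + k), y := u k)) (fv \<phi>) \<subseteq> {..<N + Suc k}"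
          using fv_u[of k] N \<tau> by (fastforce simp: captured_def split: if_splits)
        then show ?case using Suc by (auto simp: G fv_subst)
      qed (use N in \<open>auto simp: G\<close>)
      have wf_G: "wf_seq S\<^sub>0 (G k, \<Delta>)" for k
      proof (induction k)
        case (Suc k)
        then show ?case using wf wf_u by (auto simp: G intro!: wf_subst)
      qed (use \<sigma>(2) in \<open>simp add: G good_def\<close>)
      \<comment> \<open>At depth \<open>k\<close> the antecedent \<open>G k\<close> holds the last
        \<open>k\<close> edges of the path, and the added equation identifies \<open>s\<close> with
        the point reached.\<close>
      have "\<exists>k. \<not> prov (finsert (Eq s (u k)) (G k), \<Delta>)"
      proof (rule ccontr)
        assume "\<not> ?thesis"
        then have "prov (finsert (RTC x y \<phi> s (u 0)) (G 0), \<Delta>)"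
        proof (intro unfold[where z = "\<lambda>k. N + k"])
          fix k
          show "wf_seq S (finsert (RTC x y \<phi> s (u k)) (G k), \<Delta>)"
            using wf_G[of k] wf wf_u[of k] by (intro wf_seq_S) simp
          show "N + k \<notin> fv_set (G k) \<union> fv_set \<Delta> \<union> fv (RTC x y \<phi> s (u k))"
            using fv_G[of k] fv_u[of k] N \<tau> by auto
        qed (auto simp: u G)
        then show False using \<sigma>(2) \<Gamma> \<tau> by (simp add: u G good_def)
      qed
      then obtain k where k: "\<not> prov (finsert (Eq s (u k)) (G k), \<Delta>)" by blast
      let ?\<sigma> = "(finsert (Eq s (u k)) (G k), \<Delta>)"
      have mono: "\<Gamma> |\<subseteq>| G k" "j < k \<Longrightarrow> subst (Var(x := u (Suc j), y := u j)) \<phi> |\<in>| G k" for j k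
        by (induction k) (auto simp: G u less_Suc_eq)
      have "good ?\<sigma>" using k wf_G[of k] wf wf_u[of k] by (simp add: good_def)
      moreover have "seq_le \<sigma> ?\<sigma>" using \<sigma>(1) mono(1)[of k] by (auto simp: seq_le_def)
      moreover have "chain_condition S\<^sub>0 \<tau> ?\<sigma>"
        unfolding chain_condition_def \<tau> using u(1) wf_u mono(2)[of _ k]
        by (auto intro!: exI[of _ u] exI[of _ k])
      ultimately show ?thesis by blast
    qed
  qed
qed

lemma prover_omega:
  assumes "c \<in> funs S" "fun_ar S c = 0" "pr \<in> funs S" "fun_ar S pr = 2"
  shows "prover S c pr (omega_provable S (pair_RTC_G_omega S c pr))"
proof
  fix r \<Sigma> \<sigma>
  assume *: "wf_seq S \<sigma>" "\<And>\<sigma>'. \<sigma>' \<in> set \<Sigma> \<Longrightarrow> omega_provable S (pair_RTC_G_omega S c pr) \<sigma>'"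
  have "pair_RTC_G_omega S c pr r \<Sigma> \<sigma> \<Longrightarrow> omega_provable S (pair_RTC_G_omega S c pr) \<sigma>"
    by (rule omega_provable_rule[OF _ *])
  then show "lk_rule S r \<Sigma> \<sigma> \<Longrightarrow> omega_provable S (pair_RTC_G_omega S c pr) \<sigma>"
    "rtc_rule r \<Sigma> \<sigma> \<Longrightarrow> omega_provable S (pair_RTC_G_omega S c pr) \<sigma>"
    "pair_rule c pr r \<Sigma> \<sigma> \<Longrightarrow> omega_provable S (pair_RTC_G_omega S c pr) \<sigma>"
    by (simp_all add: pair_RTC_G_omega_def RTC_G_omega_def)
qed (use assms omega_provable_wf in auto)

theorem omega_complete:
  fixes \<Gamma> \<Delta> :: "('f, 'p) fm fset"
  assumes "c \<in> funs S" "fun_ar S c = 0" "pr \<in> funs S" "fun_ar S pr = 2"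
    and inf: "infinite (UNIV :: 'd set)" and wf: "wf_seq S (\<Gamma>, \<Delta>)"
    and valid: "valid_in (admissible_standard S c pr :: ('d, 'f, 'p) struct set) (\<Gamma>, \<Delta>)"
  shows "omega_provable S (pair_RTC_G_omega S c pr) (\<Gamma>, \<Delta>)"
proof (rule ccontr)
  let ?prov = "omega_provable S (pair_RTC_G_omega S c pr)"
  assume not_prov: "\<not> ?prov (\<Gamma>, \<Delta>)"
  obtain S\<^sub>0 where S0: "sub_signature S\<^sub>0 S" "finite (funs S\<^sub>0)" "finite (preds S\<^sub>0)" "c \<in> funs S\<^sub>0"
    "pr \<in> funs S\<^sub>0" "wf_seq S\<^sub>0 (\<Gamma>, \<Delta>)"
    using ex_finite_sub_signature[OF wf assms(1,3)] by blast
  have fms: "countable {\<phi>. wf_fm S\<^sub>0 \<phi>}"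
    using S0 by (intro countable_wf_fm countable_finite)
  interpret prover S c pr ?prov using assms by (intro prover_omega)
  interpret generic S c pr ?prov S\<^sub>0 using S0 fms by unfold_locales
  define \<C> where "\<C> = chain_condition S\<^sub>0 ` {\<phi>. wf_fm S\<^sub>0 \<phi>}"
  have "good (\<Gamma>, \<Delta>)" using S0 not_prov by (simp add: good_def)
  moreover have "countable \<C>" using fms by (simp add: \<C>_def)
  moreover have "dense good C" if C: "C \<in> \<C>" for C
  proof -
    obtain \<tau> where \<tau>: "C = chain_condition S\<^sub>0 \<tau>" "wf_fm S\<^sub>0 \<tau>" using C unfolding \<C>_def by blast
    show ?thesis
      unfolding \<tau>(1)
    proof (rule dense_chain_condition[OF _ \<tau>(2)], goal_cases)
      case (1 x y \<phi> s u z G \<Delta>)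
      show ?case
        by (rule omega_provable_unfold[where x = x and y = y and \<phi> = \<phi> and s = s and u = u
              and z = z and G = G and \<Delta> = \<Delta>, OF _ 1])
          (simp add: pair_RTC_G_omega_def RTC_G_omega_def)
    qed
  qed
  ultimately obtain L R where LR: "saturated S c pr ?prov S\<^sub>0 L R" "fset \<Gamma> \<subseteq> L" "fset \<Delta> \<subseteq> R"
    "\<forall>C \<in> \<C>. \<exists>\<Gamma> \<Delta>. fset \<Gamma> \<subseteq> L \<and> fset \<Delta> \<subseteq> R \<and> C (\<Gamma>, \<Delta>)"
    by (rule exE[OF saturation[of \<Gamma> \<Delta> \<C>]]) blast+
  interpret saturated S c pr ?prov S\<^sub>0 L R by (rule LR(1))
  obtain e :: "'f tm \<Rightarrow> 'd" where "term_model S c pr ?prov S\<^sub>0 L R e"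
    using ex_naming[OF inf] S0 countable_finite by blast
  then interpret term_model S c pr ?prov S\<^sub>0 L R e .
  have truth: "hsat (M, Pow U) v\<^sub>0 \<phi> \<longleftrightarrow> \<phi> \<in> L" if "wf_fm S\<^sub>0 \<phi>" for \<phi>
  proof (rule truth_standard[OF _ that])
    fix x y \<phi> s t assume RTC: "RTC x y \<phi> s t \<in> L"
    have "chain_condition S\<^sub>0 (RTC x y \<phi> s t) \<in> \<C>"
      using L_wf0[OF RTC] unfolding \<C>_def by blast
    from bspec[OF LR(4) this] obtain \<Gamma>' \<Delta>' where GD: "fset \<Gamma>' \<subseteq> L" "fset \<Delta>' \<subseteq> R"
      "chain_condition S\<^sub>0 (RTC x y \<phi> s t) (\<Gamma>', \<Delta>')" by blast
    \<comment> \<open>Being in \<open>L\<close>, the formula cannot meet its condition in the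
      trivial way, so the path alternative holds.\<close>
    have "RTC x y \<phi> s t |\<notin>| \<Delta>'" using GD(2) RTC in_R_iff[OF L_wf0[OF RTC]] by auto
    then obtain u k where "u 0 = t" "\<forall>j \<le> k. wf_tm S\<^sub>0 (u j)" "Eq s (u k) |\<in>| \<Gamma>'"
      "\<forall>j < k. subst (Var(x := u (Suc j), y := u j)) \<phi> |\<in>| \<Gamma>'"
      using GD(3) unfolding chain_condition_def by auto
    then show "\<exists>u k. u 0 = t \<and> (\<forall>j \<le> k. wf_tm S\<^sub>0 (u j)) \<and> Eq s (u k) \<in> L \<and>
        (\<forall>j < k. subst (Var(x := u (Suc j), y := u j)) \<phi> \<in> L)"
      using GD(1) by (intro exI[of _ u] exI[of _ k]) auto
  qed
  have sat_iff: "sat M v\<^sub>0 \<phi> \<longleftrightarrow> \<phi> \<in> L" if "wf_fm S\<^sub>0 \<phi>" for \<phi>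
    using truth[OF that] sat_eq_hsat[OF fo_struct_M v0_valuation wf_fm_S[OF that]] by simp
  have "M \<in> admissible_standard S c pr"
    using fo_struct_M admissible_M by (simp add: admissible_standard_def)
  moreover have "\<forall>\<phi>. \<phi> |\<in>| \<Gamma> \<longrightarrow> sat M v\<^sub>0 \<phi>"
    using LR(2) sat_iff L_wf0 by blast
  ultimately obtain \<phi> where "\<phi> |\<in>| \<Delta>" "sat M v\<^sub>0 \<phi>"
    using valid v0_valuation unfolding valid_in_def by fastforce
  then show False using LR(3) sat_iff R_wf0 in_R_iff by blast
qed

section \<open>Completeness for the Henkin semantics\<close>

locale ind_prover = prover S c pr prov
  for S :: "('f, 'p) signature" and c pr :: 'f and prov :: "('f, 'p) seq \<Rightarrow> bool" +
  assumes prov_ind: "ind_rule r \<Sigma> \<sigma> \<Longrightarrow> wf_seq S \<sigma> \<Longrightarrow> (\<And>\<sigma>'. \<sigma>' \<in> set \<Sigma> \<Longrightarrow> prov \<sigma>') \<Longrightarrow> prov \<sigma>"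
begin

text \<open>Induction along the original relation, with the renamed \<open>RTC\<close> formula as
  induction formula: (Refl) is the base and (Trans) the step.\<close>

lemma prov_RTC_rename:
  assumes wf: "wf_fm S (RTC x y \<phi> s t)"
    and ab: "a \<noteq> b" "a \<notin> fv \<phi> \<union> bv \<phi> \<union> {x, y}" "b \<notin> fv \<phi> \<union> bv \<phi> \<union> {x, y}"
  shows "prov ({|RTC x y \<phi> s t|}, {|RTC a b (subst (Var(x := Var a, y := Var b)) \<phi>) s t|})"
proof -
  define \<phi>' where "\<phi>' = subst (Var(x := Var a, y := Var b)) \<phi>"
  have wfs: "wf_fm S \<phi>" "wf_tm S s" "wf_tm S t" "x \<noteq> y" using wf by auto
  have wf': "wf_fm S \<phi>'" unfolding \<phi>'_def using wfs by (intro wf_subst) auto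
  have fv': "fv \<phi>' \<subseteq> fv \<phi> - {x, y} \<union> {a, b}"
    by (auto simp: \<phi>'_def fv_subst captured_def split: if_splits)
  \<comment> \<open>(Trans) for the renamed body asks for exactly \<phi>, so the renaming must be
    undone literally; avoiding the bound variables of \<phi> ensures this.\<close>
  have inverse: "subst (Var(a := Var x, b := Var y)) \<phi>' = \<phi>"
  proof -
    have "subst (Var(a := Var x, b := Var y)) \<phi>'
        = subst (\<lambda>u. subst_tm (Var(a := Var x, b := Var y)) ((Var(x := Var a, y := Var b)) u)) \<phi>"
      unfolding \<phi>'_def using ab by (intro subst_subst) auto
    also have "\<dots> = \<phi>" using ab by (intro subst_id) auto
    finally show ?thesis .
  qed
  \<comment> \<open>The source \<open>s\<close> may contain \<open>x\<close> or \<open>y\<close>,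
    which would violate the side condition of (Ind) or alter the source under substitution. A
    variable stands in for it until (Subst) restores \<open>s\<close> at the end.\<close>
  obtain u where u: "u \<notin> {x, y, a, b} \<union> fv \<phi> \<union> fv_tm t"
    using ex_fresh_var[of "{x, y, a, b} \<union> fv \<phi> \<union> fv_tm t"] by auto
  let ?\<psi> = "RTC a b \<phi>' (Var u) (Var x)"
  have \<psi>: "subst (Var(x := q)) ?\<psi> = RTC a b \<phi>' (Var u) q" for q
    using u fv' by (subst subst_RTC_id) auto
  have "prov ({|?\<psi>, \<phi>|}, {|RTC a b \<phi>' (Var u) (Var y)|})"
    by (intro prov_rtc[OF rtc_rule.Trans[where r = "Var x"]])
      (use wfs wf' ab in \<open>auto simp: inverse intro: prov_ax\<close>)
  then have "prov (finsert (subst (Var(x := Var u)) ?\<psi>) (finsert (RTC x y \<phi> (Var u) t) {||}),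
      finsert (subst (Var(x := t)) ?\<psi>) {||})"
    using wfs wf' ab u fv' by (intro prov_ind[OF ind_rule.Ind]) (auto simp del: subst.simps simp: \<psi>)
  moreover have "prov ({|RTC x y \<phi> (Var u) t|},
      finsert (RTC a b \<phi>' (Var u) (Var u)) {|RTC a b \<phi>' (Var u) t|})"
    by (intro prov_rtc[OF rtc_rule.Refl]) (use wfs wf' ab in auto)
  ultimately have "prov ({|RTC x y \<phi> (Var u) t|}, {|RTC a b \<phi>' (Var u) t|})"
    using wfs wf' ab unfolding \<psi>
    by (intro prov_lk[OF lk_rule.Cut[where \<phi> = "RTC a b \<phi>' (Var u) (Var u)"]]) auto
  moreover have "subst (Var(u := s)) (RTC x y \<phi> (Var u) t) = RTC x y \<phi> s t"
    using u by (subst subst_RTC_id) (auto intro: subst_tm_id)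
  moreover have "subst (Var(u := s)) (RTC a b \<phi>' (Var u) t) = RTC a b \<phi>' s t"
    using u fv' by (subst subst_RTC_id) (auto intro: subst_tm_id)
  ultimately show ?thesis
    using prov_lk[OF lk_rule.Subst[of S "Var(u := s)" "{|RTC x y \<phi> (Var u) t|}" "{|RTC a b \<phi>' (Var u) t|}"]]
      wfs wf' ab by (simp add: \<phi>'_def del: subst.simps)
qed

text \<open>(Ind) ties its eigenvariables to the variables bound by the principal \<open>RTC\<close>
  formula, and these may occur free in the context. The rule is applied to a variant with fresh
  \<open>a\<close>, \<open>b\<close> instead, and a cut against the renaming lemma returns to the
  original formula.\<close>

lemma prov_ind_fresh:
  assumes wf: "wf_fm S \<psi>" "wf_seq S (finsert (subst (Var(z := s)) \<psi>) (finsert (RTC x y \<phi> s t) \<Gamma>),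
      finsert (subst (Var(z := t)) \<psi>) \<Delta>)"
    and ab: "a \<noteq> b" "a \<notin> A" "b \<notin> A"
    and A: "A = fv \<phi> \<union> bv \<phi> \<union> {x, y} \<union> fv \<psi> \<union> bv \<psi> \<union> {z} \<union> fv_set \<Gamma> \<union> fv_set \<Delta>"
    and prem: "prov (finsert (subst (Var(z := Var a)) \<psi>)
      (finsert (subst (Var(x := Var a, y := Var b)) \<phi>) \<Gamma>), finsert (subst (Var(z := Var b)) \<psi>) \<Delta>)"
  shows "prov (finsert (subst (Var(z := s)) \<psi>) (finsert (RTC x y \<phi> s t) \<Gamma>),
    finsert (subst (Var(z := t)) \<psi>) \<Delta>)"
proof -
  let ?\<phi> = "subst (Var(x := Var a, y := Var b)) \<phi>" and ?\<psi> = "subst (Var(z := Var a)) \<psi>"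
  let ?s = "subst (Var(z := s)) \<psi>" and ?t = "subst (Var(z := t)) \<psi>"
  \<comment> \<open>Replacing \<open>z\<close> by \<open>a\<close> first and \<open>a\<close> by
    \<open>q\<close> afterwards gives literally the instance at \<open>q\<close>, because
    \<open>a\<close> is neither free nor bound in \<psi>.\<close>
  have \<psi>: "subst (Var(a := q)) ?\<psi> = subst (Var(z := q)) \<psi>" for q
  proof -
    have "subst (Var(a := q)) ?\<psi> = subst (\<lambda>u. subst_tm (Var(a := q)) ((Var(z := Var a)) u)) \<psi>"
      using ab A by (intro subst_subst) auto
    also have "\<dots> = subst (Var(z := q)) \<psi>" using ab A by (intro subst_cong) auto
    finally show ?thesis .
  qed
  have "fv ?\<psi> \<subseteq> fv \<psi> \<union> {a}" by (auto simp: fv_subst captured_def split: if_splits)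
  then have b: "b \<notin> fv ?\<psi>" using ab A by auto
  have wfs: "wf_fm S ?\<phi>" "wf_fm S ?s" "wf_fm S ?t" "wf_fm S (RTC x y \<phi> s t)" "wf_seq S (\<Gamma>, \<Delta>)"
    using wf(2) by (auto intro: wf_subst)
  have "prov (finsert (subst (Var(a := s)) ?\<psi>) (finsert (RTC a b ?\<phi> s t) \<Gamma>),
      finsert (subst (Var(a := t)) ?\<psi>) \<Delta>)"
    by (intro prov_ind[OF ind_rule.Ind]) (use prem ab A b wfs in \<open>auto simp: \<psi>\<close>)
  then have 1: "prov (finsert (RTC a b ?\<phi> s t) (finsert ?s (finsert (RTC x y \<phi> s t) \<Gamma>)), finsert ?t \<Delta>)"
    unfolding \<psi> by (rule prov_weaken) (use wfs ab in auto)
  have "prov ({|RTC x y \<phi> s t|}, {|RTC a b ?\<phi> s t|})"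
    by (rule prov_RTC_rename) (use wfs ab A in auto)
  then have 2: "prov (finsert ?s (finsert (RTC x y \<phi> s t) \<Gamma>), finsert (RTC a b ?\<phi> s t) (finsert ?t \<Delta>))"
    by (rule prov_weaken) (use wfs ab in auto)
  show ?thesis
    by (rule prov_lk[OF lk_rule.Cut[where \<phi> = "RTC a b ?\<phi> s t"]]) (use 1 2 wfs in auto)
qed

end

text \<open>The triple is the index: the induction formula \<psi> and its variable \<open>z\<close>
  are independent of the \<open>RTC\<close> formula \<tau>. The first three disjuncts are the cases
  in which induction has nothing to refute.\<close>

definition ind_condition ::
  "('f, 'p) fm \<times> ('f, 'p) fm \<times> var \<Rightarrow> ('f, 'p) seq \<Rightarrow> bool" where
  "ind_condition = (\<lambda>(\<tau>, \<psi>, z) (\<Gamma>, \<Delta>). \<forall>x y \<phi> s t. \<tau> = RTC x y \<phi> s t \<longrightarrow> \<tau> |\<in>| \<Delta> \<or>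
    subst (Var(z := s)) \<psi> |\<in>| \<Delta> \<or> subst (Var(z := t)) \<psi> |\<in>| \<Gamma> \<or>
    (\<exists>a b. subst (Var(z := Var a)) \<psi> |\<in>| \<Gamma> \<and> subst (Var(x := Var a, y := Var b)) \<phi> |\<in>| \<Gamma> \<and>
      subst (Var(z := Var b)) \<psi> |\<in>| \<Delta>))"

locale ind_generic = ind_prover S c pr prov + generic S c pr prov S\<^sub>0
  for S :: "('f, 'p) signature" and c pr :: 'f and prov :: "('f, 'p) seq \<Rightarrow> bool"
    and S\<^sub>0 :: "('f, 'p) signature"
begin

text \<open>Once the \<open>RTC\<close> formula and both endpoint instances are decided, either a
  trivial disjunct holds or the sequent is the conclusion of a fresh-variable induction. In the
  latter case unprovability passes to the premise, which contains the required edge.\<close>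

lemma dense_ind_condition:
  assumes "wf_fm S\<^sub>0 \<tau>" "wf_fm S\<^sub>0 \<psi>"
  shows "dense good (ind_condition (\<tau>, \<psi>, z))"
proof (cases "\<exists>x y \<phi> s t. \<tau> = RTC x y \<phi> s t")
  case False
  then have "ind_condition (\<tau>, \<psi>, z) = (\<lambda>_. True)" by (auto simp: ind_condition_def)
  then show ?thesis by (simp add: dense_True)
next
  case True
  then obtain x y \<phi> s t where \<tau>: "\<tau> = RTC x y \<phi> s t" by blast
  then have wf: "wf_fm S\<^sub>0 \<phi>" "wf_tm S\<^sub>0 s" "wf_tm S\<^sub>0 t" "x \<noteq> y" using assms by auto
  let ?s = "subst (Var(z := s)) \<psi>" and ?t = "subst (Var(z := t)) \<psi>"
  have wf_st: "wf_fm S\<^sub>0 ?s" "wf_fm S\<^sub>0 ?t" using wf assms by (auto intro!: wf_subst)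
  show ?thesis
    unfolding dense_def
  proof (intro allI impI)
    fix \<sigma> assume "good \<sigma>"
    \<comment> \<open>Three formulas are decided in turn; earlier decisions persist because sequents
      only grow.\<close>
    then obtain \<Gamma>1 \<Delta>1 where 1: "seq_le \<sigma> (\<Gamma>1, \<Delta>1)" "good (\<Gamma>1, \<Delta>1)" "\<tau> |\<in>| \<Gamma>1 \<or> \<tau> |\<in>| \<Delta>1"
      by (rule decide[OF _ assms(1)])
    obtain \<Gamma>2 \<Delta>2 where 2: "seq_le (\<Gamma>1, \<Delta>1) (\<Gamma>2, \<Delta>2)" "good (\<Gamma>2, \<Delta>2)" "?s |\<in>| \<Gamma>2 \<or> ?s |\<in>| \<Delta>2"
      by (rule decide[OF 1(2) wf_st(1)])
    obtain \<Gamma> \<Delta> where 3: "seq_le (\<Gamma>2, \<Delta>2) (\<Gamma>, \<Delta>)" "good (\<Gamma>, \<Delta>)" "?t |\<in>| \<Gamma> \<or> ?t |\<in>| \<Delta>"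
      by (rule decide[OF 2(2) wf_st(2)])
    have le: "seq_le \<sigma> (\<Gamma>, \<Delta>)" using 1(1) 2(1) 3(1) seq_le_trans by blast
    have mem: "\<tau> |\<in>| \<Gamma> \<or> \<tau> |\<in>| \<Delta>" "?s |\<in>| \<Gamma> \<or> ?s |\<in>| \<Delta>"
      using 1(3) 2(1,3) 3(1) by (auto simp: seq_le_def)
    show "\<exists>\<sigma>'. seq_le \<sigma> \<sigma>' \<and> good \<sigma>' \<and> ind_condition (\<tau>, \<psi>, z) \<sigma>'"
    proof (cases "\<tau> |\<in>| \<Delta> \<or> ?s |\<in>| \<Delta> \<or> ?t |\<in>| \<Gamma>")
      case True
      then have "ind_condition (\<tau>, \<psi>, z) (\<Gamma>, \<Delta>)" by (auto simp: ind_condition_def \<tau>)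
      then show ?thesis using le 3(2) by blast
    next
      case False
      then have \<Gamma>\<Delta>: "finsert ?s (finsert \<tau> \<Gamma>) = \<Gamma>" "finsert ?t \<Delta> = \<Delta>" using mem 3(3) by auto
      define A where "A = fv \<phi> \<union> bv \<phi> \<union> {x, y} \<union> fv \<psi> \<union> bv \<psi> \<union> {z} \<union> fv_set \<Gamma> \<union> fv_set \<Delta>"
      have "finite A" by (simp add: A_def)
      then obtain a where a: "a \<notin> A" using ex_fresh_var by blast
      obtain b where b: "b \<notin> insert a A" using ex_fresh_var[of "insert a A"] \<open>finite A\<close> by auto
      let ?\<Gamma> = "finsert (subst (Var(z := Var a)) \<psi>) (finsert (subst (Var(x := Var a, y := Var b)) \<phi>) \<Gamma>)"
        and ?\<Delta> = "finsert (subst (Var(z := Var b)) \<psi>) \<Delta>"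
      have "\<not> prov (?\<Gamma>, ?\<Delta>)"
      proof
        assume p: "prov (?\<Gamma>, ?\<Delta>)"
        have "prov (finsert ?s (finsert (RTC x y \<phi> s t) \<Gamma>), finsert ?t \<Delta>)"
        proof (rule prov_ind_fresh[OF _ _ _ a _ A_def p])
          show "wf_fm S \<psi>" using assms(2) wf_fm_sub[OF sub] by blast
          show "wf_seq S (finsert ?s (finsert (RTC x y \<phi> s t) \<Gamma>), finsert ?t \<Delta>)"
            using \<Gamma>\<Delta> 3(2) wf_seq_S unfolding \<tau> by (simp add: good_def)
        qed (use b in auto)
        then show False using \<Gamma>\<Delta> 3(2) unfolding \<tau> by (simp add: good_def)
      qed
      moreover have "wf_seq S\<^sub>0 (?\<Gamma>, ?\<Delta>)"
        using 3(2) wf assms by (auto simp: good_def intro!: wf_subst)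
      ultimately have "good (?\<Gamma>, ?\<Delta>)" by (simp add: good_def)
      moreover have "seq_le \<sigma> (?\<Gamma>, ?\<Delta>)" using le by (auto simp: seq_le_def)
      moreover have "ind_condition (\<tau>, \<psi>, z) (?\<Gamma>, ?\<Delta>)" unfolding ind_condition_def \<tau> by auto
      ultimately show ?thesis by blast
    qed
  qed
qed

end

lemma ind_prover_fin:
  assumes "c \<in> funs S" "fun_ar S c = 0" "pr \<in> funs S" "fun_ar S pr = 2"
  shows "ind_prover S c pr (fin_provable S (pair_RTC_G S c pr))"
proof
  fix r \<Sigma> \<sigma>
  assume *: "wf_seq S \<sigma>" "\<And>\<sigma>'. \<sigma>' \<in> set \<Sigma> \<Longrightarrow> fin_provable S (pair_RTC_G S c pr) \<sigma>'"
  have "pair_RTC_G S c pr r \<Sigma> \<sigma> \<Longrightarrow> fin_provable S (pair_RTC_G S c pr) \<sigma>"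
    by (rule fin_provable.intros[OF _ *])
  then show "lk_rule S r \<Sigma> \<sigma> \<Longrightarrow> fin_provable S (pair_RTC_G S c pr) \<sigma>"
    "rtc_rule r \<Sigma> \<sigma> \<Longrightarrow> fin_provable S (pair_RTC_G S c pr) \<sigma>"
    "pair_rule c pr r \<Sigma> \<sigma> \<Longrightarrow> fin_provable S (pair_RTC_G S c pr) \<sigma>"
    "ind_rule r \<Sigma> \<sigma> \<Longrightarrow> fin_provable S (pair_RTC_G S c pr) \<sigma>"
    by (simp_all add: pair_RTC_G_def RTC_G_def)
qed (use assms fin_provable_wf in auto)

theorem fin_complete:
  fixes \<Gamma> \<Delta> :: "('f, 'p) fm fset"
  assumes "c \<in> funs S" "fun_ar S c = 0" "pr \<in> funs S" "fun_ar S pr = 2"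
    and inf: "infinite (UNIV :: 'd set)" and wf: "wf_seq S (\<Gamma>, \<Delta>)"
    and valid: "hvalid_in (admissible_henkin S c pr :: ('d, 'f, 'p) frame set) (\<Gamma>, \<Delta>)"
  shows "fin_provable S (pair_RTC_G S c pr) (\<Gamma>, \<Delta>)"
proof (rule ccontr)
  let ?prov = "fin_provable S (pair_RTC_G S c pr)"
  assume not_prov: "\<not> ?prov (\<Gamma>, \<Delta>)"
  obtain S\<^sub>0 where S0: "sub_signature S\<^sub>0 S" "finite (funs S\<^sub>0)" "finite (preds S\<^sub>0)" "c \<in> funs S\<^sub>0"
    "pr \<in> funs S\<^sub>0" "wf_seq S\<^sub>0 (\<Gamma>, \<Delta>)"
    using ex_finite_sub_signature[OF wf assms(1,3)] by blast
  have fms: "countable {\<phi>. wf_fm S\<^sub>0 \<phi>}"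
    using S0 by (intro countable_wf_fm countable_finite)
  interpret ind_prover S c pr ?prov using assms by (intro ind_prover_fin)
  interpret ind_generic S c pr ?prov S\<^sub>0 using S0 fms by unfold_locales
  \<comment> \<open>One condition for each pair of formulas over \<open>S\<^sub>0\<close> and each
    variable, hence countably many.\<close>
  define \<C> where "\<C> = ind_condition ` ({\<phi>. wf_fm S\<^sub>0 \<phi>} \<times> {\<phi>. wf_fm S\<^sub>0 \<phi>} \<times> UNIV)"
  have "good (\<Gamma>, \<Delta>)" using S0 not_prov by (simp add: good_def)
  moreover have "countable \<C>" using fms by (simp add: \<C>_def)
  moreover have "dense good C" if "C \<in> \<C>" for C
    using that dense_ind_condition by (auto simp: \<C>_def)
  ultimately obtain L R where LR: "saturated S c pr ?prov S\<^sub>0 L R" "fset \<Gamma> \<subseteq> L" "fset \<Delta> \<subseteq> R"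
    "\<forall>C \<in> \<C>. \<exists>\<Gamma> \<Delta>. fset \<Gamma> \<subseteq> L \<and> fset \<Delta> \<subseteq> R \<and> C (\<Gamma>, \<Delta>)"
    by (rule exE[OF saturation[of \<Gamma> \<Delta> \<C>]]) blast+
  interpret saturated S c pr ?prov S\<^sub>0 L R by (rule LR(1))
  obtain e :: "'f tm \<Rightarrow> 'd" where "term_model S c pr ?prov S\<^sub>0 L R e"
    using ex_naming[OF inf] S0 countable_finite by blast
  then interpret term_model S c pr ?prov S\<^sub>0 L R e .
  have truth: "hsat (M, D\<^sub>0) v\<^sub>0 \<phi> \<longleftrightarrow> \<phi> \<in> L" if "wf_fm S\<^sub>0 \<phi>" for \<phi>
  proof (rule truth_henkin[OF _ that])
    fix x y \<phi> s t z \<psi>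
    assume a: "RTC x y \<phi> s t \<in> L" "wf_fm S\<^sub>0 \<psi>" "subst (Var(z := s)) \<psi> \<in> L" "subst (Var(z := t)) \<psi> \<in> R"
    have "ind_condition (RTC x y \<phi> s t, \<psi>, z) \<in> \<C>"
      using L_wf0[OF a(1)] a(2) unfolding \<C>_def by blast
    from bspec[OF LR(4) this] obtain \<Gamma>' \<Delta>' where GD: "fset \<Gamma>' \<subseteq> L" "fset \<Delta>' \<subseteq> R"
      "ind_condition (RTC x y \<phi> s t, \<psi>, z) (\<Gamma>', \<Delta>')" by blast
    have "RTC x y \<phi> s t |\<notin>| \<Delta>'" "subst (Var(z := s)) \<psi> |\<notin>| \<Delta>'" "subst (Var(z := t)) \<psi> |\<notin>| \<Gamma>'"
      using GD a in_R_iff L_wf0 R_wf0 by blast+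
    then obtain a b where "subst (Var(z := Var a)) \<psi> |\<in>| \<Gamma>'" "subst (Var(x := Var a, y := Var b)) \<phi> |\<in>| \<Gamma>'"
      "subst (Var(z := Var b)) \<psi> |\<in>| \<Delta>'"
      using GD(3) unfolding ind_condition_def by auto
    then show "\<exists>a b. subst (Var(z := Var a)) \<psi> \<in> L \<and> subst (Var(x := Var a, y := Var b)) \<phi> \<in> L \<and>
        subst (Var(z := Var b)) \<psi> \<in> R"
      using GD(1,2) by blast
  qed
  have "(M, D\<^sub>0) \<in> admissible_henkin S c pr"
    using henkin_struct_M[OF truth] admissible_M by (simp add: admissible_henkin_def)
  moreover have "falsifies (M, D\<^sub>0) v\<^sub>0 (\<Gamma>, \<Delta>)"
    unfolding falsifies_def fst_conv snd_conv
    using LR(2,3) truth L_wf0 R_wf0 in_R_iff v0_valuation by blast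
  ultimately show False
    using valid unfolding hvalid_in_iff by blast
qed

theorem theorem4:
  fixes S :: "('f, 'p) signature" and c pr :: 'f and \<Gamma> \<Delta> :: "('f, 'p) fm fset"
  assumes "c \<in> funs S" and "fun_ar S c = 0"
    and "pr \<in> funs S" and "fun_ar S pr = 2"
    and "infinite (UNIV :: 'd set)"
    and "wf_seq S (\<Gamma>, \<Delta>)"
  shows "(fin_provable S (pair_RTC_G S c pr) (\<Gamma>, \<Delta>) \<longleftrightarrow>
            hvalid_in (admissible_henkin S c pr :: ('d, 'f, 'p) frame set) (\<Gamma>, \<Delta>)) \<and>
         (omega_provable S (pair_RTC_G_omega S c pr) (\<Gamma>, \<Delta>) \<longleftrightarrow>
            valid_in (admissible_standard S c pr :: ('d, 'f, 'p) struct set) (\<Gamma>, \<Delta>))"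
  by (rule conjI; rule iffI; erule fin_sound fin_complete[OF assms] omega_sound omega_complete[OF assms])

end
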